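(* Let $q>2$ be a prime power. Suppose there exists an $[[n,n-k-l,k+1;k-l]]_q$ MDS EAQECC constructed by the Hermitian construction from an $[n,k]_{q^2}$ GRS code with $l$-dimensional Hermitian hull, where $0\le2k\le n$ and $0\le l\le k$. Then for any integers $0\le i\le\min\{l,q^2+1-n\}$ and $0\le s\le l-i$, there exists an $[[n+i,n+i-k-s,k+1;k-s]]_q$ MDS EAQECC.
   Context: Classical codes: for a linear code $\mathcal C\subseteq\mathbb F_{q^2}^n$, $\mathcal C^{\perp_H}=\{\bm x:\sum_i y_ix_i^q=0\ \forall\bm y\in\mathcal C\}$ and $\mathrm{Hull}_H(\mathcal C)=\mathcal C\cap\mathcal C^{\perp_H}$. An $[n,k]_{q^2}$ GRS code is a code $\{(v_1f(a_1),\dots,v_nf(a_n)):f\in\mathbb F_{q^2}[x],\deg f\le k-1\}$ with distinct $a_j\in\mathbb F_{q^2}$ and $v_j\in\mathbb F_{q^2}^*$. EAQECCs: a $q$-ary entanglement-assisted quantum error-correcting code $[[n,\kappa,d;c]]_q$ encodes $\kappa$ information qudits into $n$ channel qudits with the help of $c$ pre-shared pairs of maximally entangled qudits, with minimum distance $d$. Explicitly (standard definition): there is an isometry $U:(\mathbb C^q)^{\otimes\kappa}\otimes(\mathbb C^q)^{\otimes c}\to(\mathbb C^q)^{\otimes n}$ such that, with $|\Phi\rangle=q^{-1/2}\sum_{x}|x\rangle|x\rangle$, the code space $Q=\{(U\otimes I)(|\varphi\rangle\otimes|\Phi\rangle^{\otimes c})\}\subseteq(\mathbb C^q)^{\otimes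 n}\otimes(\mathbb C^q)^{\otimes c}$ (where $U$ acts on the information qudits and the sender's halves of the pairs) detects every error $E\otimes I$ with $E$ acting nontrivially on at most $d-1$ of the $n$ channel qudits, i.e. $P(E\otimes I)P\in\mathbb C P$ for the projector $P$ onto $Q$. MDS: an $[[n,\kappa,d;c]]_q$ EAQECC with $2d\le n+2$ is MDS if $\kappa=c+n-2d+2$ (equality in the bound $\kappa\le c+\max\{0,n-2d+2\}$). Hermitian construction (known result, referred to in the claim): if $\mathcal C$ is an $[n,k,d]_{q^2}$ linear code, $\mathcal C^{\perp_H}$ has minimum distance $d^{\perp_H}$, and $r=\dim\mathrm{Hull}_H(\mathcal C)$, then there exist EAQECCs with parameters $[[n,k-r,d;n-k-r]]_q$ and $[[n,n-k-r,d^{\perp_H};k-r]]_q$. *)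

theory Defs
  imports
    Complex_Main
    "HOL-Library.Cardinality"
    "HOL-Computational_Algebra.Polynomial"
    "HOL-Number_Theory.Prime_Powers"
    "Jordan_Normal_Form.VS_Connect"
begin

section \<open>Classical codes\<close>

text \<open>Codes of length \<open>n\<close> are subsets of \<^term>\<open>carrier_vec n\<close>; coordinates are numbered from 0.\<close>

definition linear_code :: "nat \<Rightarrow> 'a::field vec set \<Rightarrow> bool" where
  "linear_code n C \<longleftrightarrow> VectorSpace.subspace class_ring C (module_vec TYPE('a) n)"

definition code_dim :: "nat \<Rightarrow> 'a::field vec set \<Rightarrow> nat" where
  "code_dim n C = vectorspace.dim class_ring ((module_vec TYPE('a) n)\<lparr>carrier := C\<rparr>)"

definition hamming_dist :: "'a vec \<Rightarrow> 'a vec \<Rightarrow> nat" where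
  "hamming_dist x y = card {i. i < dim_vec x \<and> x $ i \<noteq> y $ i}"

text \<open>Meaningful only for codes with at least two words.\<close>
definition min_dist :: "'a vec set \<Rightarrow> nat" where
  "min_dist C = Inf {hamming_dist x y | x y. x \<in> C \<and> y \<in> C \<and> x \<noteq> y}"

definition hermitian_dual :: "nat \<Rightarrow> nat \<Rightarrow> 'a::field vec set \<Rightarrow> 'a vec set" where
  "hermitian_dual q n C =
     {x \<in> carrier_vec n. \<forall>y\<in>C. (\<Sum>i<n. y $ i * (x $ i) ^ q) = 0}"

definition hermitian_hull :: "nat \<Rightarrow> nat \<Rightarrow> 'a::field vec set \<Rightarrow> 'a vec set" where
  "hermitian_hull q n C = C \<inter> hermitian_dual q n C"

text \<open>The polynomials of degree at most \<open>k - 1\<close> are written \<open>f = 0 \<or> degree f < k\<close>, because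
  \<^term>\<open>degree 0 = 0\<close>; for \<open>k = 0\<close> only the zero polynomial remains.\<close>
definition is_GRS_code :: "nat \<Rightarrow> nat \<Rightarrow> 'a::field vec set \<Rightarrow> bool" where
  "is_GRS_code n k C \<longleftrightarrow>
     (\<exists>a v. inj_on a {..<n} \<and> (\<forall>j<n. v j \<noteq> 0) \<and>
        C = {vec n (\<lambda>j. v j * poly f (a j)) | f. f = 0 \<or> degree f < k})"


section \<open>Finite-dimensional Hilbert spaces\<close>

text \<open>For a finite set \<open>B\<close> of basis labels, the space with orthonormal basis \<open>B\<close> consists of the
  functions vanishing outside \<open>B\<close>. Operators are given by their matrices; only the entries
  labelled by basis elements are relevant.\<close>

definition hilb :: "'b set \<Rightarrow> ('b \<Rightarrow> complex) set" where
  "hilb B = {\<psi>. \<forall>x. x \<notin> B \<longrightarrow> \<psi> x = 0}"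

definition op_apply :: "'b set \<Rightarrow> ('b \<Rightarrow> 'b \<Rightarrow> complex) \<Rightarrow> ('b \<Rightarrow> complex) \<Rightarrow> ('b \<Rightarrow> complex)" where
  "op_apply B M \<psi> = (\<lambda>y. if y \<in> B then \<Sum>x\<in>B. M y x * \<psi> x else 0)"

definition op_mult ::
  "'b set \<Rightarrow> ('b \<Rightarrow> 'b \<Rightarrow> complex) \<Rightarrow> ('b \<Rightarrow> 'b \<Rightarrow> complex) \<Rightarrow> ('b \<Rightarrow> 'b \<Rightarrow> complex)" where
  "op_mult B M N = (\<lambda>x z. \<Sum>y\<in>B. M x y * N y z)"

text \<open>\<^term>\<open>U y x\<close> is the entry in row \<open>y \<in> B\<close> and column \<open>x \<in> A\<close>; the condition is \<open>U\<^sup>\<dagger> U = I\<close>.\<close>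
definition is_isometry :: "'a set \<Rightarrow> 'b set \<Rightarrow> ('b \<Rightarrow> 'a \<Rightarrow> complex) \<Rightarrow> bool" where
  "is_isometry A B U \<longleftrightarrow>
     (\<forall>x\<in>A. \<forall>x'\<in>A. (\<Sum>y\<in>B. cnj (U y x) * U y x') = of_bool (x = x'))"

definition is_projector ::
  "'b set \<Rightarrow> ('b \<Rightarrow> complex) set \<Rightarrow> ('b \<Rightarrow> 'b \<Rightarrow> complex) \<Rightarrow> bool" where
  "is_projector B Q P \<longleftrightarrow>
     (\<forall>x\<in>B. \<forall>y\<in>B. P y x = cnj (P x y)) \<and>
     (\<forall>x\<in>B. \<forall>y\<in>B. op_mult B P P x y = P x y) \<and>
     op_apply B P ` hilb B = Q"


section \<open>Entanglement-assisted quantum codes\<close>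

text \<open>Labels of the standard basis of the \<open>n\<close>-th tensor power of the \<open>q\<close>-dimensional space.\<close>
definition words :: "nat \<Rightarrow> nat \<Rightarrow> nat list set" where
  "words q n = {w. set w \<subseteq> {..<q} \<and> length w = n}"

text \<open>Amplitudes of one maximally entangled pair, and of \<open>c\<close> such pairs with the \<open>c\<close> sender halves
  and the \<open>c\<close> receiver halves grouped together.\<close>
definition ebit :: "nat \<Rightarrow> nat \<Rightarrow> nat \<Rightarrow> complex" where
  "ebit q x y = of_bool (x = y) / complex_of_real (sqrt (real q))"

definition ebits :: "nat \<Rightarrow> nat \<Rightarrow> nat list \<Rightarrow> nat list \<Rightarrow> complex" where
  "ebits q c a b = (\<Prod>j<c. ebit q (a ! j) (b ! j))"

text \<open>The state \<open>(U \<otimes> I)(\<phi> \<otimes> \<Phi>)\<close>, where \<open>\<Phi>\<close> stands for the \<open>c\<close> pairs: \<open>U\<close> acts on the information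
  word \<open>x\<close> and the sender halves \<open>a\<close>; the receiver halves \<open>b\<close> are left alone.\<close>
definition encode ::
  "nat \<Rightarrow> nat \<Rightarrow> nat \<Rightarrow> nat \<Rightarrow> (nat list \<Rightarrow> nat list \<times> nat list \<Rightarrow> complex) \<Rightarrow>
     (nat list \<Rightarrow> complex) \<Rightarrow> (nat list \<times> nat list \<Rightarrow> complex)" where
  "encode q n \<kappa> c U \<phi> = (\<lambda>(y, b).
     if y \<in> words q n \<and> b \<in> words q c
     then \<Sum>x\<in>words q \<kappa>. \<Sum>a\<in>words q c. U y (x, a) * (\<phi> x * ebits q c a b)
     else 0)"

definition code_space ::
  "nat \<Rightarrow> nat \<Rightarrow> nat \<Rightarrow> nat \<Rightarrow> (nat list \<Rightarrow> nat list \<times> nat list \<Rightarrow> complex) \<Rightarrow>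
     (nat list \<times> nat list \<Rightarrow> complex) set" where
  "code_space q n \<kappa> c U = encode q n \<kappa> c U ` hilb (words q \<kappa>)"

text \<open>\<open>E\<close> is of the form \<open>A \<otimes> I\<close>, with \<open>A\<close> acting on the qudits at the positions in \<open>S\<close> and the
  identity acting on the others.\<close>
definition supported_on ::
  "nat \<Rightarrow> nat \<Rightarrow> nat set \<Rightarrow> (nat list \<Rightarrow> nat list \<Rightarrow> complex) \<Rightarrow> bool" where
  "supported_on q n S E \<longleftrightarrow>
     (\<exists>A. \<forall>x\<in>words q n. \<forall>y\<in>words q n.
        E x y = A (nths x S) (nths y S) * of_bool (nths x (- S) = nths y (- S)))"

text \<open>The operator \<open>E \<otimes> I\<close>, with the identity acting on the receiver halves.\<close>
definition extend_error ::
  "(nat list \<Rightarrow> nat list \<Rightarrow> complex) \<Rightarrow>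
     (nat list \<times> nat list \<Rightarrow> nat list \<times> nat list \<Rightarrow> complex)" where
  "extend_error E = (\<lambda>(y, b) (y', b'). E y y' * of_bool (b = b'))"

definition detects ::
  "'b set \<Rightarrow> ('b \<Rightarrow> 'b \<Rightarrow> complex) \<Rightarrow> ('b \<Rightarrow> 'b \<Rightarrow> complex) \<Rightarrow> bool" where
  "detects B P F \<longleftrightarrow>
     (\<exists>z. \<forall>x\<in>B. \<forall>y\<in>B. op_mult B P (op_mult B F P) x y = z * P x y)"

text \<open>There is an \<open>[[n, \<kappa>, d; c]]\<close> code over qudits of dimension \<open>q\<close>. As usual for existence
  statements, \<open>d\<close> is a guaranteed distance.\<close>
definition EAQECC :: "nat \<Rightarrow> nat \<Rightarrow> nat \<Rightarrow> nat \<Rightarrow> nat \<Rightarrow> bool" where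
  "EAQECC q n \<kappa> d c \<longleftrightarrow>
     (\<exists>U P. is_isometry (words q \<kappa> \<times> words q c) (words q n) U \<and>
        is_projector (words q n \<times> words q c) (code_space q n \<kappa> c U) P \<and>
        (\<forall>E S. S \<subseteq> {..<n} \<and> card S < d \<and> supported_on q n S E \<longrightarrow>
           detects (words q n \<times> words q c) P (extend_error E)))"

text \<open>Equality in the bound \<open>\<kappa> \<le> c + max 0 (n - 2 d + 2)\<close>, in the range \<open>2 d \<le> n + 2\<close>.\<close>
definition MDS_parameters :: "nat \<Rightarrow> nat \<Rightarrow> nat \<Rightarrow> nat \<Rightarrow> bool" where
  "MDS_parameters n \<kappa> d c \<longleftrightarrow> 2 * d \<le> n + 2 \<and> int \<kappa> = int c + int n - 2 * int d + 2"

definition MDS_EAQECC :: "nat \<Rightarrow> nat \<Rightarrow> nat \<Rightarrow> nat \<Rightarrow> nat \<Rightarrow> bool" where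
  "MDS_EAQECC q n \<kappa> d c \<longleftrightarrow> EAQECC q n \<kappa> d c \<and> MDS_parameters n \<kappa> d c"

text \<open>\<open>[[n, \<kappa>, d; c]]\<close> is one of the two parameter sets that the Hermitian construction yields from
  the linear code \<open>C\<close>. The subtractions do not truncate, because the hull is contained in both \<open>C\<close>
  and its Hermitian dual.\<close>
definition hermitian_construction ::
  "nat \<Rightarrow> nat \<Rightarrow> 'a::field vec set \<Rightarrow> nat \<Rightarrow> nat \<Rightarrow> nat \<Rightarrow> bool" where
  "hermitian_construction q n C \<kappa> d c \<longleftrightarrow>
     linear_code n C \<and>
     (let k = code_dim n C; r = code_dim n (hermitian_hull q n C) in
        (\<kappa> = k - r \<and> d = min_dist C \<and> c = n - k - r) \<or>
        (\<kappa> = n - k - r \<and> d = min_dist (hermitian_dual q n C) \<and> c = k - r))"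

end

theory Submission
  imports Defs "HOL-Library.Function_Algebras"
begin

text \<open>On the polynomials of degree below \<open>k\<close>, the Hermitian inner product of the GRS code is the form
  \<open>\<Sum>\<^sub>j w\<^sub>j f(a\<^sub>j) g(a\<^sub>j)\<^sup>q\<close> with weights \<open>w\<^sub>j = v\<^sub>j\<^sup>q\<^sup>+\<^sup>1\<close> in the field with \<open>q\<close> elements, and the hull is its
  radical. Each of \<open>i\<close> further evaluation points (possibly the point at infinity) lowers the dimension
  of the radical by at most one, so it stays at least \<open>l - i \<ge> s\<close>. As \<open>q > 2\<close>, there are
  two different nonzero weights, and some choice of nonzero weights makes the form nondegenerate.
  Changing the weights one at a time changes the dimension of the radical by at most one, so some
  choice gives exactly \<open>s\<close>.

  Diagonalizing the resulting form of rank \<open>k - s\<close> and appending the negatives of its diagonal terms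
  as \<open>k - s\<close> extra coordinates yields a self-orthogonal code of length \<open>n + i + k - s\<close>, whose stabilizer
  code is the code space, the extra qudits being the receiver halves. The projections of
  the code onto any \<open>k\<close> of the first \<open>n + i\<close> coordinates and onto the extra coordinates are
  surjective. Hence averaging an operator on the corresponding qudits over the stabilizer group
  depolarizes it completely, which gives both the detection of errors on \<open>k\<close> qudits and the maximally
  mixed receiver halves that make the code an entanglement-assisted one.\<close>

section \<open>Splitting symmetric bicharacters\<close>

text \<open>The weights are never turned back into column multipliers. A weight in the field with q
  elements merely rescales the phase of the Weyl operator on its qudit, so the form may carry
  arbitrary nonzero weights, and the coordinates that complete it to zero need no (q+1)-th roots. A
  form that vanishes identically makes the Weyl operators commute, because the antisymmetrized
  Hermitian product \<open>s * t^q - s^q * t\<close> is a multiple of the symplectic form of the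
  coordinates over the subfield.

  Two nonzero weights are enough for this reason: if h is nondegenerate and h(u,v) + c e(u) e(v)^q
  is not, then h(x,.) is -c e(x) times the q-th power of e for some x with e(x) nonzero. Such x are
  unique up to scaling, so at most one c is bad. For q = 2 the only nonzero weight is 1 and there is
  no second choice.

  Dimensions appear as exponents of cardinalities: rank, hull dimension and the MDS property all
  become counting arguments over a finite field.\<close>

primrec nmul :: "nat \<Rightarrow> 'v::ab_group_add \<Rightarrow> 'v" where
  "nmul 0 a = 0"
| "nmul (Suc n) a = a + nmul n a"

lemma nmul_add: "nmul (m + n) a = nmul m a + nmul n a"
  by (induction m) (simp_all add: add.assoc)

lemma nmul_mult: "nmul (m * n) a = nmul m (nmul n a)"
  by (induction m) (simp_all add: nmul_add)

definition add_subgroup :: "'v::ab_group_add set \<Rightarrow> bool" where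
  "add_subgroup B \<longleftrightarrow> 0 \<in> B \<and> (\<forall>u\<in>B. \<forall>v\<in>B. u - v \<in> B)"

lemma add_subgroup_zero: "add_subgroup B \<Longrightarrow> 0 \<in> B"
  and add_subgroup_diff: "add_subgroup B \<Longrightarrow> u \<in> B \<Longrightarrow> v \<in> B \<Longrightarrow> u - v \<in> B"
  by (simp_all add: add_subgroup_def)

lemma add_subgroup_uminus: "add_subgroup B \<Longrightarrow> u \<in> B \<Longrightarrow> - u \<in> B"
  using add_subgroup_diff[of B 0 u] by (simp add: add_subgroup_zero)

lemma add_subgroup_add: "add_subgroup B \<Longrightarrow> u \<in> B \<Longrightarrow> v \<in> B \<Longrightarrow> u + v \<in> B"
  using add_subgroup_diff[of B u "- v"] by (simp add: add_subgroup_uminus)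

lemma add_subgroup_nmul: "add_subgroup B \<Longrightarrow> u \<in> B \<Longrightarrow> nmul n u \<in> B"
  by (induction n) (simp_all add: add_subgroup_zero add_subgroup_add)

lemma add_subgroup_UNIV: "add_subgroup UNIV"
  by (simp add: add_subgroup_def)

lemma add_subgroup_singleton_zero: "add_subgroup {0}"
  by (simp add: add_subgroup_def)

lemma add_subgroup_translate_bij:
  assumes "add_subgroup B" "u \<in> B"
  shows "bij_betw (\<lambda>v. v + u) B B"
  by (rule bij_betwI[where g = "\<lambda>v. v - u"])
     (auto simp: assms add_subgroup_add add_subgroup_diff)

lemma add_subgroup_uminus_bij:
  assumes "add_subgroup B"
  shows "bij_betw uminus B B"
  by (rule bij_betwI[where g = uminus]) (auto simp: assms add_subgroup_uminus)

definition sym_bichar :: "'v::ab_group_add set \<Rightarrow> ('v \<Rightarrow> 'v \<Rightarrow> complex) \<Rightarrow> bool" where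
  "sym_bichar V s \<longleftrightarrow>
     (\<forall>u\<in>V. \<forall>v\<in>V. s u v = s v u \<and> norm (s u v) = 1) \<and>
     (\<forall>u\<in>V. \<forall>v\<in>V. \<forall>w\<in>V. s (u + v) w = s u w * s v w)"

text \<open>For a bicharacter with values in \<open>{1, -1}\<close>, a splitting may need fourth roots of unity; this is why
  the splitting is constructed abstractly and not by a quadratic form.\<close>
definition cocycle_splitting ::
  "'v::ab_group_add set \<Rightarrow> ('v \<Rightarrow> 'v \<Rightarrow> complex) \<Rightarrow> ('v \<Rightarrow> complex) \<Rightarrow> bool" where
  "cocycle_splitting B s \<theta> \<longleftrightarrow>
     (\<forall>u\<in>B. norm (\<theta> u) = 1) \<and> (\<forall>u\<in>B. \<forall>v\<in>B. \<theta> (u + v) = \<theta> u * \<theta> v * s u v)"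

lemma sym_bichar_zero:
  assumes "sym_bichar V s" "add_subgroup V" "v \<in> V"
  shows "s 0 v = 1"
proof -
  have "0 \<in> V" using assms add_subgroup_zero by blast
  hence "s (0 + 0) v = s 0 v * s 0 v" "norm (s 0 v) = 1"
    using assms unfolding sym_bichar_def by blast+
  thus ?thesis by (cases "s 0 v = 0") auto
qed

lemma sym_bichar_nmul:
  assumes "sym_bichar V s" "add_subgroup V" "u \<in> V" "v \<in> V"
  shows "s (nmul n u) v = s u v ^ n"
proof (induction n)
  case (Suc n)
  thus ?case using assms add_subgroup_nmul[OF assms(2,3), of n] by (simp add: sym_bichar_def)
qed (simp add: sym_bichar_zero[OF assms(1,2,4)])

text \<open>Once the value \<open>z\<close> at \<open>a\<close> is chosen, the value at
  \<open>b + nmul i a\<close> is forced to be \<open>F b i\<close>; the binomial coefficient counts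
  the factors \<open>s a a\<close> collected while adding \<open>a\<close> repeatedly. The only
  consistency condition is that the two values at \<open>nmul m a\<close> agree. The chosen value
  stays visible in the conclusion so that a nontrivial character can be obtained.\<close>

lemma cocycle_splitting_extend:
  fixes V :: "'v::ab_group_add set"
  assumes V: "add_subgroup V" and s: "sym_bichar V s"
    and B: "add_subgroup B" "B \<subseteq> V" and th: "cocycle_splitting B s \<theta>"
    and a: "a \<in> V" and m: "m > 0" "nmul m a \<in> B" "\<And>d. 0 < d \<Longrightarrow> d < m \<Longrightarrow> nmul d a \<notin> B"
    and z: "z ^ m * s a a ^ (m choose 2) = \<theta> (nmul m a)"
  obtains B' \<theta>' where "add_subgroup B'" "B' \<subseteq> V" "B \<subseteq> B'" "a \<in> B'" "\<And>b. b \<in> B \<Longrightarrow> \<theta>' b = \<theta> b"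
    "cocycle_splitting B' s \<theta>'" "\<theta>' a = z"
proof -
  have thn: "norm (\<theta> u) = 1" if "u \<in> B" for u
    using th that by (simp add: cocycle_splitting_def)
  have tha: "\<theta> (u + v) = \<theta> u * \<theta> v * s u v" if "u \<in> B" "v \<in> B" for u v
    using th that by (simp add: cocycle_splitting_def)
  have sn: "norm (s u v) = 1" and sc: "s u v = s v u" if "u \<in> V" "v \<in> V" for u v
    using s that by (simp_all add: sym_bichar_def)
  have sa: "s (u + v) w = s u w * s v w" if "u \<in> V" "v \<in> V" "w \<in> V" for u v w
    using s that by (simp add: sym_bichar_def)
  have sa2: "s w (u + v) = s w u * s w v" if "u \<in> V" "v \<in> V" "w \<in> V" for u v w
    using that sa sc add_subgroup_add[OF V] by metis
  have sna: "s (nmul n u) v = s u v ^ n" if "u \<in> V" "v \<in> V" for u v n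
    using sym_bichar_nmul[OF s V that] .
  have sna2: "s v (nmul n u) = s v u ^ n" if "u \<in> V" "v \<in> V" for u v n
    using sna that sc add_subgroup_nmul[OF V] by metis
  have s0: "s 0 v = 1" if "v \<in> V" for v using sym_bichar_zero[OF s V that] .
  have BV: "b \<in> V" if "b \<in> B" for b using that B by blast
  have naV: "nmul n a \<in> V" for n using add_subgroup_nmul[OF V a] .
  have B0: "0 \<in> B" using add_subgroup_zero[OF B(1)] .
  have th0: "\<theta> 0 = 1"
  proof -
    have "\<theta> (0 + 0) = \<theta> 0 * \<theta> 0 * s 0 0" using tha[OF B0 B0] .
    thus ?thesis using thn[OF B0] s0[OF BV[OF B0]] by (cases "\<theta> 0 = 0") auto
  qed
  have zn: "norm z = 1"
  proof -
    have "norm (z ^ m * s a a ^ (m choose 2)) = 1" using z thn[OF m(2)] by simp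
    hence "norm z ^ m = 1" by (simp add: norm_mult norm_power sn[OF a a])
    thus ?thesis using m(1) by (metis norm_ge_zero power_eq_1_iff real_norm_def abs_norm_cancel less_numeral_extra(3))
  qed
  define F where "F b i = \<theta> b * s b a ^ i * z ^ i * s a a ^ (i choose 2)" for b i
  have F_mult: "F (b + b') (i + i') = F b i * F b' i' * s (b + nmul i a) (b' + nmul i' a)"
    if b: "b \<in> B" "b' \<in> B" for b b' i i'
  proof -
    have ch: "(i + i') choose 2 = (i choose 2) + (i' choose 2) + i * i'"
    proof (induction i')
      case (Suc j)
      have "(i + Suc j) choose 2 = ((i + j) choose 2) + (i + j)"
        by (simp add: numeral_2_eq_2)
      thus ?case using Suc by (simp add: numeral_2_eq_2)
    qed simp
    have "s (b + nmul i a) (b' + nmul i' a) = s b b' * s b a ^ i' * s b' a ^ i * s a a ^ (i * i')"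
    proof -
      have "s (b + nmul i a) (b' + nmul i' a) = s b b' * s (nmul i a) b' * (s b (nmul i' a) * s (nmul i a) (nmul i' a))"
        using b BV naV add_subgroup_add[OF V] by (simp only: sa sa2)
      also have "s (nmul i a) b' = s b' a ^ i" using sna[OF a BV[OF b(2)]] sc[OF a BV[OF b(2)]] by simp
      also have "s b (nmul i' a) = s b a ^ i'" using sna2[OF a BV[OF b(1)]] by simp
      also have "s (nmul i a) (nmul i' a) = s a a ^ (i * i')"
        using sna[OF a naV] sna2[OF a a] by (simp add: power_mult mult.commute[of i])
      finally show ?thesis by (simp add: mult_ac)
    qed
    moreover have "\<theta> (b + b') = \<theta> b * \<theta> b' * s b b'" using tha b by simp
    moreover have "s (b + b') a = s b a * s b' a" using sa b BV a by simp
    ultimately show ?thesis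
      unfolding F_def ch by (simp add: power_add power_mult_distrib mult_ac)
  qed
  \<comment> \<open>Trading \<open>m\<close> copies of \<open>a\<close> for the element
    \<open>nmul m a\<close> of \<open>B\<close> generates all the ambiguity in a
    representation.\<close>
  have F_period: "F b (i + m) = F (b + nmul m a) i" if b: "b \<in> B" for b i
  proof -
    have "F (b + 0) (i + m) = F b i * F 0 m * s (b + nmul i a) (0 + nmul m a)"
      by (rule F_mult) (use b B0 in auto)
    moreover have "F (b + nmul m a) (i + 0) = F b i * F (nmul m a) 0 * s (b + nmul i a) (nmul m a + nmul 0 a)"
      by (rule F_mult) (use b m in auto)
    moreover have "F 0 m = F (nmul m a) 0"
      using z by (simp add: F_def th0 s0[OF a] binomial_eq_0)
    ultimately show ?thesis by simp
  qed
  have F_period': "F b (i + r * m) = F (b + nmul (r * m) a) i" if b: "b \<in> B" for b i r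
    using b
  proof (induction r arbitrary: b)
    case (Suc r)
    have "F b (i + Suc r * m) = F b ((i + r * m) + m)" by (simp add: add_ac)
    also have "\<dots> = F (b + nmul m a) (i + r * m)" using F_period Suc.prems by simp
    also have "\<dots> = F (b + nmul m a + nmul (r * m) a) i"
      by (rule Suc.IH) (use Suc.prems m B add_subgroup_add in blast)
    finally show ?case by (simp add: nmul_add add_ac)
  qed simp
  have mdvd: "m dvd d" if "nmul d a \<in> B" for d
  proof (rule ccontr)
    assume "\<not> m dvd d"
    hence "0 < d mod m" by (simp add: mod_greater_zero_iff_not_dvd)
    moreover have "nmul (d mod m) a \<in> B"
    proof -
      have "nmul d a = nmul (d div m * m) a + nmul (d mod m) a"
        by (simp flip: nmul_add)
      hence "nmul (d mod m) a = nmul d a - nmul (d div m) (nmul m a)"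
        by (simp add: nmul_mult)
      thus ?thesis using that B(1) m add_subgroup_diff add_subgroup_nmul by metis
    qed
    ultimately show False using m(3)[of "d mod m"] m(1) by simp
  qed
  have F_wd': "F b i = F b' i'" if b: "b \<in> B" "b' \<in> B" and e: "b + nmul i a = b' + nmul i' a" and le: "i \<le> i'"
    for b b' i i'
  proof -
    have "nmul i' a = nmul i a + nmul (i' - i) a" using le by (simp flip: nmul_add)
    hence bb: "b = b' + nmul (i' - i) a" using e by (simp add: algebra_simps)
    hence "nmul (i' - i) a = b - b'" by simp
    hence "nmul (i' - i) a \<in> B" using b B(1) add_subgroup_diff by metis
    then obtain r where r: "i' - i = r * m" using mdvd by (metis dvd_def mult.commute)
    hence "F b' i' = F b' (i + r * m)" using le by (metis le_add_diff_inverse)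
    also have "\<dots> = F b i" using F_period'[OF b(2)] bb r by simp
    finally show ?thesis by simp
  qed
  have F_wd: "F b i = F b' i'" if b: "b \<in> B" "b' \<in> B" and e: "b + nmul i a = b' + nmul i' a"
    for b b' i i'
    using F_wd'[OF b e] F_wd'[OF b(2,1) e[symmetric]] by (cases "i \<le> i'") auto
  define B' where "B' = {b + nmul i a | b i. b \<in> B}"
  define \<theta>' where "\<theta>' u = (let p = (SOME p. fst p \<in> B \<and> u = fst p + nmul (snd p) a) in F (fst p) (snd p))" for u
  have th': "\<theta>' (b + nmul i a) = F b i" if "b \<in> B" for b i
  proof -
    define p where "p = (SOME p. fst p \<in> B \<and> b + nmul i a = fst p + nmul (snd p) a)"
    have "fst p \<in> B \<and> b + nmul i a = fst p + nmul (snd p) a"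
      unfolding p_def by (rule someI[of _ "(b, i)"]) (use that in auto)
    thus ?thesis unfolding \<theta>'_def Let_def p_def[symmetric] using F_wd that by metis
  qed
  \<comment> \<open>\<open>B'\<close> is built from natural multiples of \<open>a\<close>;
    \<open>nmul m a \<in> B\<close> supplies the negative ones.\<close>
  have negm: "- nmul i a = nmul (i * (m - 1)) a - nmul i (nmul m a)" for i
  proof -
    have "i * m = i * (m - 1) + i" using m(1) by (cases m) auto
    hence "nmul i (nmul m a) = nmul (i * (m - 1)) a + nmul i a"
      by (metis nmul_add nmul_mult)
    thus ?thesis by simp
  qed
  show ?thesis
  proof (rule that[of B' \<theta>'])
    show "add_subgroup B'"
      unfolding add_subgroup_def
    proof (intro conjI ballI)
      show "0 \<in> B'" unfolding B'_def using B0 by (auto intro!: exI[of _ 0])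
      fix u v assume "u \<in> B'" "v \<in> B'"
      then obtain b i b' i' where bi: "b \<in> B" "b' \<in> B" "u = b + nmul i a" "v = b' + nmul i' a"
        unfolding B'_def by blast
      have "u - v = u - b' + (- nmul i' a)" using bi by simp
      also have "\<dots> = (b - b' - nmul i' (nmul m a)) + nmul (i + i' * (m - 1)) a"
        unfolding negm bi by (simp add: nmul_add)
      finally have "u - v = (b - b' - nmul i' (nmul m a)) + nmul (i + i' * (m - 1)) a" .
      moreover have "b - b' - nmul i' (nmul m a) \<in> B"
        using bi m(2) B(1) add_subgroup_diff add_subgroup_nmul by metis
      ultimately show "u - v \<in> B'" unfolding B'_def by blast
    qed
    show "B' \<subseteq> V" unfolding B'_def using BV naV add_subgroup_add[OF V] by blast
    show "B \<subseteq> B'"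
    proof
      fix b assume "b \<in> B"
      moreover have "b = b + nmul 0 a" by simp
      ultimately show "b \<in> B'" unfolding B'_def by blast
    qed
    show "a \<in> B'" unfolding B'_def using B0 by (auto intro!: exI[of _ 0] exI[of _ 1])
    show "\<theta>' b = \<theta> b" if "b \<in> B" for b using th'[OF that, of 0] by (simp add: F_def binomial_eq_0)
    show "cocycle_splitting B' s \<theta>'"
      unfolding cocycle_splitting_def
    proof (intro conjI ballI)
      fix u assume "u \<in> B'"
      then obtain b i where "b \<in> B" "u = b + nmul i a" unfolding B'_def by blast
      thus "norm (\<theta>' u) = 1"
        by (simp add: th' F_def norm_mult norm_power thn sn BV a zn)
    next
      fix u v assume "u \<in> B'" "v \<in> B'"
      then obtain b i b' i' where bi: "b \<in> B" "b' \<in> B" "u = b + nmul i a" "v = b' + nmul i' a"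
        unfolding B'_def by blast
      have "u + v = (b + b') + nmul (i + i') a" by (simp add: bi nmul_add)
      hence "\<theta>' (u + v) = F (b + b') (i + i')"
        using th'[of "b + b'" "i + i'"] bi B(1) add_subgroup_add by metis
      also have "\<dots> = F b i * F b' i' * s u v" using F_mult bi by simp
      finally show "\<theta>' (u + v) = \<theta>' u * \<theta>' v * s u v" using th' bi by simp
    qed
    show "\<theta>' a = z" using th'[OF B0, of 1] by (simp add: F_def th0 s0 a numeral_2_eq_2)
  qed
qed

lemma finite_nmul_order:
  fixes a :: "'v::ab_group_add"
  assumes "finite V" "add_subgroup V" "a \<in> V" "0 \<in> B"
  obtains m where "m > 0" "nmul m a \<in> B" "\<And>d. 0 < d \<Longrightarrow> d < m \<Longrightarrow> nmul d a \<notin> B"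
proof -
  have "\<not> inj_on (\<lambda>n. nmul n a) (UNIV :: nat set)"
  proof
    assume "inj (\<lambda>n. nmul n a)"
    moreover have "range (\<lambda>n. nmul n a) \<subseteq> V" using add_subgroup_nmul[OF assms(2,3)] by blast
    ultimately show False using assms(1) finite_subset finite_imageD infinite_UNIV_nat by metis
  qed
  then obtain i j where "i < j" "nmul i a = nmul j a"
    unfolding inj_on_def by (metis linorder_neqE_nat)
  moreover from this have "nmul j a = nmul i a + nmul (j - i) a"
    by (metis nmul_add le_add_diff_inverse less_imp_le)
  ultimately have ex: "0 < j - i \<and> nmul (j - i) a \<in> B" using assms(4) by simp
  define m where "m = (LEAST d. 0 < d \<and> nmul d a \<in> B)"
  have "0 < m \<and> nmul m a \<in> B" unfolding m_def using LeastI[where P = "\<lambda>d. 0 < d \<and> nmul d a \<in> B", OF ex] .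
  moreover have "\<And>d. 0 < d \<Longrightarrow> d < m \<Longrightarrow> nmul d a \<notin> B"
    unfolding m_def using not_less_Least by blast
  ultimately show ?thesis using that by blast
qed

lemma complex_nth_root_exists:
  fixes w :: complex
  assumes "m > 0"
  obtains z where "z ^ m = w"
proof -
  have "rcis (root m (norm w)) (Arg w / m) ^ m = rcis (norm w) (Arg w)"
    using assms by (simp add: DeMoivre2)
  thus ?thesis using that by (metis rcis_cmod_Arg)
qed

text \<open>Enlarging \<open>B\<close> step by step never meets an obstruction: the equation for the
  new value asks only for an \<open>m\<close>-th root, which complex numbers always have.\<close>

lemma cocycle_splitting_extend_all:
  fixes V :: "'v::ab_group_add set"
  assumes V: "finite V" "add_subgroup V" and s: "sym_bichar V s"
    and B: "add_subgroup B" "B \<subseteq> V" and th: "cocycle_splitting B s \<theta>"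
  shows "\<exists>\<theta>'. cocycle_splitting V s \<theta>' \<and> (\<forall>b\<in>B. \<theta>' b = \<theta> b)"
  using B th
proof (induction "card (V - B)" arbitrary: B \<theta> rule: less_induct)
  case less
  show ?case
  proof (cases "B = V")
    case False
    then obtain a where a: "a \<in> V" "a \<notin> B" using less.prems by blast
    obtain m where m: "m > 0" "nmul m a \<in> B" "\<And>d. 0 < d \<Longrightarrow> d < m \<Longrightarrow> nmul d a \<notin> B"
      using finite_nmul_order[OF V a(1) add_subgroup_zero[OF less.prems(1)]] by blast
    obtain z where "z ^ m = \<theta> (nmul m a) / s a a ^ (m choose 2)"
      using complex_nth_root_exists[OF m(1)] by blast
    moreover have "s a a \<noteq> 0" using s a unfolding sym_bichar_def by (metis norm_zero zero_neq_one)
    ultimately have z: "z ^ m * s a a ^ (m choose 2) = \<theta> (nmul m a)" by simp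
    obtain B' \<theta>' where B': "add_subgroup B'" "B' \<subseteq> V" "B \<subseteq> B'" "a \<in> B'"
      "\<And>b. b \<in> B \<Longrightarrow> \<theta>' b = \<theta> b" "cocycle_splitting B' s \<theta>'"
      using cocycle_splitting_extend[OF V(2) s less.prems a(1) m z] by metis
    have "card (V - B') < card (V - B)"
      by (rule psubset_card_mono) (use V a B' in auto)
    then obtain \<theta>'' where "cocycle_splitting V s \<theta>''" "\<forall>b\<in>B'. \<theta>'' b = \<theta>' b"
      using less.hyps[of B' \<theta>'] B' by blast
    thus ?thesis using B' by (metis subsetD)
  qed (use less.prems in blast)
qed

lemma cocycle_splitting_exists:
  fixes V :: "'v::ab_group_add set"
  assumes V: "finite V" "add_subgroup V" and s: "sym_bichar V s"
  obtains \<theta> where "cocycle_splitting V s \<theta>"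
proof -
  have "s 0 0 = 1" using sym_bichar_zero[OF s V(2)] add_subgroup_zero[OF V(2)] by simp
  hence "cocycle_splitting {0} s (\<lambda>_. 1)" by (simp add: cocycle_splitting_def)
  thus ?thesis
    using cocycle_splitting_extend_all[OF V s add_subgroup_singleton_zero] add_subgroup_zero[OF V(2)] that
    by blast
qed

text \<open>A splitting of the trivial bicharacter is a character. Sending 1 to
  \<open>cis (2 * pi / m)\<close>, where \<open>m\<close> is the additive order of 1, defines one on
  the multiples of 1, which then extends to the whole field. \<open>m\<close> is not 1 because 1 is
  not 0.\<close>

lemma nontrivial_additive_character:
  obtains \<chi> :: "'a::{field,finite} \<Rightarrow> complex"
  where "\<And>x. norm (\<chi> x) = 1" "\<And>x y. \<chi> (x + y) = \<chi> x * \<chi> y" "\<chi> 1 \<noteq> 1"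
proof -
  let ?s = "\<lambda>_ _. 1 :: complex"
  have V: "finite (UNIV :: 'a set)" "add_subgroup (UNIV :: 'a set)" by (simp_all add: add_subgroup_UNIV)
  have s: "sym_bichar (UNIV :: 'a set) ?s" by (simp add: sym_bichar_def)
  have B: "add_subgroup {0 :: 'a}" "{0 :: 'a} \<subseteq> UNIV" by (simp_all add: add_subgroup_singleton_zero)
  have th: "cocycle_splitting {0 :: 'a} ?s (\<lambda>_. 1)" by (simp add: cocycle_splitting_def)
  obtain m where m: "m > 0" "nmul m (1::'a) \<in> {0}" "\<And>d. 0 < d \<Longrightarrow> d < m \<Longrightarrow> nmul d (1::'a) \<notin> {0}"
    using finite_nmul_order[OF V UNIV_I[of 1], of "{0}"] by blast
  have "m \<noteq> 1"
  proof
    assume "m = 1"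
    thus False using m(2) by simp
  qed
  define z where "z = cis (2 * pi / m)"
  have "z ^ m = 1" using m(1) by (simp add: z_def DeMoivre)
  have "z \<noteq> 1"
  proof
    assume "z = 1"
    hence "cos (2 * pi / m) = 1" by (metis z_def Re_complex_of_real cis.sel(1) of_real_1)
    then obtain n :: int where "2 * pi / m = of_int n * 2 * pi" using cos_one_2pi_int by blast
    hence "1 = of_int n * real m" using m(1) by (simp add: field_simps)
    hence "n * int m = 1" by (metis of_int_1 of_int_eq_iff of_int_mult of_int_of_nat_eq)
    thus False using \<open>m \<noteq> 1\<close> m(1) by (metis nat_int pos_zmult_eq_1_iff mult.commute of_nat_0_less_iff nat_1 of_nat_1 of_nat_eq_iff)
  qed
  obtain B' \<theta> where B': "add_subgroup B'" "(1::'a) \<in> B'" "cocycle_splitting B' ?s \<theta>" "\<theta> 1 = z"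
    using cocycle_splitting_extend[OF V(2) s B th UNIV_I m, of z] \<open>z ^ m = 1\<close>
    by (metis mult_1_right power_one)
  obtain \<chi> where "cocycle_splitting UNIV ?s \<chi>" "\<forall>b\<in>B'. \<chi> b = \<theta> b"
    using cocycle_splitting_extend_all[OF V s B'(1) subset_UNIV B'(3)] by blast
  thus ?thesis using that[of \<chi>] B' \<open>z \<noteq> 1\<close> by (simp add: cocycle_splitting_def)
qed

section \<open>Stabilizer projectors\<close>

lemma op_mult_assoc:
  "op_mult B (op_mult B M N) K = op_mult B M (op_mult B N K)"
proof (intro ext)
  fix x z
  have "op_mult B (op_mult B M N) K x z = (\<Sum>y\<in>B. \<Sum>w\<in>B. M x w * N w y * K y z)"
    by (simp add: op_mult_def sum_distrib_right)
  also have "\<dots> = (\<Sum>w\<in>B. \<Sum>y\<in>B. M x w * N w y * K y z)" by (rule sum.swap)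
  also have "\<dots> = op_mult B M (op_mult B N K) x z"
    by (simp add: op_mult_def sum_distrib_left mult.assoc)
  finally show "op_mult B (op_mult B M N) K x z = op_mult B M (op_mult B N K) x z" .
qed

lemma op_mult_cong:
  assumes "\<And>y. y \<in> B \<Longrightarrow> M x y = M' x y" "\<And>y. y \<in> B \<Longrightarrow> N y z = N' y z"
  shows "op_mult B M N x z = op_mult B M' N' x z"
  unfolding op_mult_def using assms by (intro sum.cong) auto

lemma op_mult_sum_left:
  "op_mult B (\<lambda>x y. \<Sum>u\<in>V. M u x y) N = (\<lambda>x y. \<Sum>u\<in>V. op_mult B (M u) N x y)"
  unfolding op_mult_def by (intro ext) (simp add: sum_distrib_right sum.swap[of _ V B])

lemma op_mult_sum_right:
  "op_mult B N (\<lambda>x y. \<Sum>u\<in>V. M u x y) = (\<lambda>x y. \<Sum>u\<in>V. op_mult B N (M u) x y)"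
  unfolding op_mult_def by (intro ext) (simp add: sum_distrib_left sum.swap[of _ V B])

lemma op_mult_scale_left: "op_mult B (\<lambda>x y. c * M x y) N = (\<lambda>x y. c * op_mult B M N x y)"
  unfolding op_mult_def by (simp add: sum_distrib_left mult.assoc)

lemma op_mult_scale_right: "op_mult B N (\<lambda>x y. c * M x y) = (\<lambda>x y. c * op_mult B N M x y)"
  unfolding op_mult_def by (simp add: sum_distrib_left mult_ac)

text \<open>The cancellation behind orthogonality of characters, kept general enough to cover
  averages of phases times matrix entries.\<close>

lemma sum_eq_zero_if_translate:
  fixes f :: "'v::ab_group_add \<Rightarrow> complex"
  assumes "add_subgroup V" "u0 \<in> V" "c \<noteq> 1"
    and "\<And>u. u \<in> V \<Longrightarrow> f (u + u0) = c * f u"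
  shows "sum f V = 0"
proof -
  have "sum f V = (\<Sum>u\<in>V. f (u + u0))"
    by (rule sum.reindex_bij_betw[OF add_subgroup_translate_bij[OF assms(1,2)], symmetric])
  also have "\<dots> = c * sum f V" using assms(4) by (simp add: sum_distrib_left)
  finally show ?thesis using assms(3) by simp
qed

section \<open>Weyl operators and the projector onto their common fixed space\<close>

locale weyl_system =
  fixes V :: "'v::ab_group_add set" and L :: "'l::ab_group_add set"
    and sh :: "'v \<Rightarrow> 'l" and ph :: "'v \<Rightarrow> 'l \<Rightarrow> complex" and \<theta> :: "'v \<Rightarrow> complex"
  assumes V: "finite V" "add_subgroup V" and L: "finite L" "add_subgroup L"
    and sh: "\<And>u. u \<in> V \<Longrightarrow> sh u \<in> L"
    and sh_add: "\<And>u v. u \<in> V \<Longrightarrow> v \<in> V \<Longrightarrow> sh (u + v) = sh u + sh v"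
    and ph_norm: "\<And>u x. u \<in> V \<Longrightarrow> x \<in> L \<Longrightarrow> norm (ph u x) = 1"
    and ph_add_left: "\<And>u v x. u \<in> V \<Longrightarrow> v \<in> V \<Longrightarrow> x \<in> L \<Longrightarrow> ph (u + v) x = ph u x * ph v x"
    and ph_add_right: "\<And>u x y. u \<in> V \<Longrightarrow> x \<in> L \<Longrightarrow> y \<in> L \<Longrightarrow> ph u (x + y) = ph u x * ph u y"
    and splitting: "cocycle_splitting V (\<lambda>u v. ph u (sh v)) \<theta>"
begin

lemma V0: "0 \<in> V" and L0: "0 \<in> L"
  using V L by (simp_all add: add_subgroup_zero)

lemma sh_zero: "sh 0 = 0"
  using sh_add[OF V0 V0] by simp

lemma sh_uminus: "u \<in> V \<Longrightarrow> sh (- u) = - sh u"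
  using sh_add[of u "- u"] by (simp add: sh_zero add_subgroup_uminus[OF V(2)] eq_neg_iff_add_eq_0 add.commute)

lemma ph_nz: "u \<in> V \<Longrightarrow> x \<in> L \<Longrightarrow> ph u x \<noteq> 0"
  using ph_norm by fastforce

lemma ph_zero_left: "x \<in> L \<Longrightarrow> ph 0 x = 1"
  using ph_add_left[OF V0 V0] ph_nz[OF V0] by simp

lemma ph_zero_right: "u \<in> V \<Longrightarrow> ph u 0 = 1"
  using ph_add_right[OF _ L0 L0] ph_nz[OF _ L0] by simp

lemma ph_uminus_left: "u \<in> V \<Longrightarrow> x \<in> L \<Longrightarrow> ph (- u) x = inverse (ph u x)"
  using ph_add_left[of u "- u" x] ph_nz[of u x]
  by (simp add: ph_zero_left add_subgroup_uminus[OF V(2)] inverse_unique)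

lemma ph_uminus_right: "u \<in> V \<Longrightarrow> x \<in> L \<Longrightarrow> ph u (- x) = inverse (ph u x)"
  using ph_add_right[of u x "- x"] ph_nz[of u x]
  by (simp add: ph_zero_right add_subgroup_uminus[OF L(2)] inverse_unique)

lemma \<theta>_norm: "u \<in> V \<Longrightarrow> norm (\<theta> u) = 1"
  and \<theta>_add: "u \<in> V \<Longrightarrow> v \<in> V \<Longrightarrow> \<theta> (u + v) = \<theta> u * \<theta> v * ph u (sh v)"
  using splitting by (simp_all add: cocycle_splitting_def)

lemma \<theta>_nz: "u \<in> V \<Longrightarrow> \<theta> u \<noteq> 0"
  using \<theta>_norm by fastforce

lemma \<theta>_zero: "\<theta> 0 = 1"
  using \<theta>_add[OF V0 V0] \<theta>_nz[OF V0] by (simp add: sh_zero ph_zero_right V0)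

text \<open>A shift of the labels combined with a phase, as a matrix with row \<open>y\<close> and
  column \<open>x\<close>. The factor \<open>\<theta> u\<close> turns a projective representation of
  \<open>V\<close> into a true one.\<close>

definition weyl :: "'v \<Rightarrow> 'l \<Rightarrow> 'l \<Rightarrow> complex" where
  "weyl u y x = (if x \<in> L \<and> y = x + sh u then \<theta> u * ph u x else 0)"

definition code_projector :: "'l \<Rightarrow> 'l \<Rightarrow> complex" where
  "code_projector y x = (\<Sum>u\<in>V. weyl u y x) / of_nat (card V)"

lemma card_V: "card V > 0"
  using V V0 card_gt_0_iff by blast

lemma op_mult_weyl_left:
  assumes "u \<in> V"
  shows "op_mult L (weyl u) M x y = (if x \<in> L then \<theta> u * ph u (x - sh u) * M (x - sh u) y else 0)"
proof -
  have "op_mult L (weyl u) M x y = (\<Sum>w\<in>L. if w = x - sh u then \<theta> u * ph u w * M w y else 0)"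
    unfolding op_mult_def weyl_def by (intro sum.cong) auto
  also have "\<dots> = (if x - sh u \<in> L then \<theta> u * ph u (x - sh u) * M (x - sh u) y else 0)"
    by (simp add: sum.delta' L(1) cong: if_cong)
  also have "x - sh u \<in> L \<longleftrightarrow> x \<in> L"
    using add_subgroup_diff[OF L(2), of x "sh u"] add_subgroup_add[OF L(2), of "x - sh u" "sh u"] sh[OF assms]
    by auto
  finally show ?thesis .
qed

lemma op_mult_weyl_right:
  assumes "u \<in> V"
  shows "op_mult L M (weyl u) x y = (if y \<in> L then M x (y + sh u) * (\<theta> u * ph u y) else 0)"
proof -
  have "op_mult L M (weyl u) x y = (\<Sum>w\<in>L. if w = y + sh u then (if y \<in> L then M x w * (\<theta> u * ph u y) else 0) else 0)"
    unfolding op_mult_def weyl_def by (intro sum.cong) auto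
  thus ?thesis using add_subgroup_add[OF L(2) _ sh[OF assms]] by (simp add: L(1))
qed

text \<open>Moving the shift of \<open>v\<close> past the phase of \<open>u\<close> produces
  \<open>ph u (sh v)\<close>, exactly the factor that \<open>\<theta>\<close> splits.\<close>

lemma op_mult_weyl_weyl:
  assumes "u \<in> V" "v \<in> V"
  shows "op_mult L (weyl u) (weyl v) = weyl (u + v)"
proof (intro ext)
  fix x y
  show "op_mult L (weyl u) (weyl v) x y = weyl (u + v) x y"
    using assms sh[OF assms(2)]
    by (auto simp: op_mult_weyl_right weyl_def sh_add \<theta>_add ph_add_left ph_add_right add_ac
        add_subgroup_add[OF L(2)])
qed

lemma weyl_cnj:
  assumes "u \<in> V" "x \<in> L" "y \<in> L"
  shows "cnj (weyl u x y) = weyl (- u) y x"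
proof -
  have V': "- u \<in> V" using assms V add_subgroup_uminus by blast
  have cnj1: "cnj z = inverse z" if "norm z = 1" for z :: complex
    using that by (simp add: divide_inverse_commute inverse_complex_def complex_eq_iff cmod_power2[symmetric])
  \<comment> \<open>Read off from \<open>\<theta> (u + (- u)) = 1\<close>; it fixes the scalar in
    the adjoint of a Weyl operator.\<close>
  have "\<theta> u * \<theta> (- u) * inverse (ph u (sh u)) = 1"
    using \<theta>_add[OF assms(1) V'] assms by (simp add: \<theta>_zero sh_uminus ph_uminus_right sh)
  hence "\<theta> (- u) = inverse (\<theta> u) * ph u (sh u)"
    using \<theta>_nz[OF assms(1)] ph_nz[OF assms(1) sh[OF assms(1)]] by (simp add: field_simps)
  thus ?thesis
    using assms V'
    by (auto simp: weyl_def sh_uminus cnj1 \<theta>_norm ph_norm ph_uminus_left ph_add_right sh ph_nz)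
qed

lemma code_projector_eq: "code_projector = (\<lambda>y x. inverse (of_nat (card V)) * (\<Sum>u\<in>V. weyl u y x))"
  by (intro ext) (simp add: code_projector_def field_simps)

lemma weyl_absorb_left:
  assumes "u \<in> V"
  shows "op_mult L (weyl u) code_projector = code_projector"
proof (intro ext)
  fix x y
  have "op_mult L (weyl u) code_projector x y = inverse (of_nat (card V)) * (\<Sum>v\<in>V. weyl (v + u) x y)"
    unfolding code_projector_eq op_mult_scale_right op_mult_sum_right
    using assms by (simp add: op_mult_weyl_weyl add.commute)
  also have "(\<Sum>v\<in>V. weyl (v + u) x y) = (\<Sum>v\<in>V. weyl v x y)"
    by (rule sum.reindex_bij_betw[OF add_subgroup_translate_bij[OF V(2) assms]])
  finally show "op_mult L (weyl u) code_projector x y = code_projector x y"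
    by (simp add: code_projector_eq)
qed

lemma weyl_absorb_right:
  assumes "u \<in> V"
  shows "op_mult L code_projector (weyl u) = code_projector"
proof (intro ext)
  fix x y
  have "op_mult L code_projector (weyl u) x y = inverse (of_nat (card V)) * (\<Sum>v\<in>V. weyl (v + u) x y)"
    unfolding code_projector_eq op_mult_scale_left op_mult_sum_left
    using assms by (simp add: op_mult_weyl_weyl)
  also have "(\<Sum>v\<in>V. weyl (v + u) x y) = (\<Sum>v\<in>V. weyl v x y)"
    by (rule sum.reindex_bij_betw[OF add_subgroup_translate_bij[OF V(2) assms]])
  finally show "op_mult L code_projector (weyl u) x y = code_projector x y"
    by (simp add: code_projector_eq)
qed

lemma code_projector_idem: "op_mult L code_projector code_projector = code_projector"
proof -
  have "op_mult L code_projector code_projector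
      = (\<lambda>x y. inverse (of_nat (card V)) * (\<Sum>u\<in>V. op_mult L (weyl u) code_projector x y))"
    by (subst (1) code_projector_eq) (simp only: op_mult_scale_left op_mult_sum_left)
  thus ?thesis using card_V by (intro ext) (simp add: weyl_absorb_left)
qed

lemma code_projector_cnj:
  assumes "x \<in> L" "y \<in> L"
  shows "code_projector y x = cnj (code_projector x y)"
proof -
  have "cnj (code_projector x y) = (\<Sum>u\<in>V. cnj (weyl u x y)) / of_nat (card V)"
    by (simp add: code_projector_def)
  also have "(\<Sum>u\<in>V. cnj (weyl u x y)) = (\<Sum>u\<in>V. weyl (- u) y x)"
    using assms by (intro sum.cong) (simp_all add: weyl_cnj)
  also have "(\<Sum>u\<in>V. weyl (- u) y x) = (\<Sum>u\<in>V. weyl u y x)"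
    by (rule sum.reindex_bij_betw[OF add_subgroup_uminus_bij[OF V(2)]])
  finally show ?thesis by (simp only: code_projector_def)
qed

text \<open>Only the identity contributes: a nonzero shift has no diagonal entries, and a nontrivial
  pure phase is a character that sums to zero over \<open>L\<close>. The value is the dimension of
  the code.\<close>

lemma code_projector_trace:
  assumes faithful: "\<And>u. u \<in> V \<Longrightarrow> sh u = 0 \<Longrightarrow> (\<And>x. x \<in> L \<Longrightarrow> ph u x = 1) \<Longrightarrow> u = 0"
  shows "(\<Sum>x\<in>L. code_projector x x) = of_nat (card L) / of_nat (card V)"
proof -
  have "(\<Sum>x\<in>L. weyl u x x) = (if u = 0 then of_nat (card L) else 0)" if u: "u \<in> V" for u
  proof (cases "u = 0")
    case True
    thus ?thesis by (simp add: weyl_def sh_zero \<theta>_zero ph_zero_left)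
  next
    case False
    show ?thesis
    proof (cases "sh u = 0")
      case True
      then obtain x where x: "x \<in> L" "ph u x \<noteq> 1" using faithful[OF u] False by blast
      have "(\<Sum>x\<in>L. ph u x) = 0"
        by (rule sum_eq_zero_if_translate[OF L(2) x]) (simp add: ph_add_right u x)
      thus ?thesis using True False by (simp add: weyl_def flip: sum_distrib_left)
    qed (simp add: weyl_def False)
  qed
  hence "(\<Sum>u\<in>V. \<Sum>x\<in>L. weyl u x x) = of_nat (card L)"
    using V V0 by simp
  thus ?thesis
    by (simp add: code_projector_def sum.swap[of _ V L] flip: sum_divide_distrib)
qed

lemma weyl_conjugation:
  assumes "u \<in> V" "x \<in> L" "y \<in> L"
  shows "op_mult L (weyl u) (op_mult L E (weyl (- u))) x y = ph u (x - y) * E (x - sh u) (y - sh u)"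
proof -
  have V': "- u \<in> V" using assms V add_subgroup_uminus by blast
  have "\<theta> u * \<theta> (- u) * ph u (- sh u) = 1"
    using \<theta>_add[OF assms(1) V'] by (simp add: \<theta>_zero sh_uminus assms(1))
  moreover have "ph u (x - sh u) = ph u x * ph u (- sh u)" "ph u (x - y) = ph u x * ph u (- y)"
    using assms ph_add_right[of u x "- sh u"] ph_add_right[of u x "- y"] add_subgroup_uminus[OF L(2)] sh by simp_all
  moreover have "ph (- u) y = ph u (- y)" using assms by (simp add: ph_uminus_left ph_uminus_right)
  ultimately show ?thesis
    using assms V' by (simp add: op_mult_weyl_left op_mult_weyl_right sh_uminus mult_ac)
qed

text \<open>Averaging an operator over conjugation by the stabilizers does not change its compression to
  the code, and an operator that only sees a part of the code on which the Weyl operators act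
  irreducibly averages to a scalar.\<close>
lemma compression_scalar:
  assumes off: "\<And>x y. x \<in> L \<Longrightarrow> y \<in> L \<Longrightarrow> x \<noteq> y \<Longrightarrow>
      (\<Sum>u\<in>V. ph u (x - y) * E (x - sh u) (y - sh u)) = 0"
    and diag: "\<And>x. x \<in> L \<Longrightarrow> (\<Sum>u\<in>V. E (x - sh u) (x - sh u)) = (\<Sum>u\<in>V. E (- sh u) (- sh u))"
    and xy: "x \<in> L" "y \<in> L"
  shows "op_mult L code_projector (op_mult L E code_projector) x y
    = (\<Sum>w\<in>L. E w w) / of_nat (card L) * code_projector x y"
proof -
  let ?P = code_projector and ?v = "of_nat (card V) :: complex"
  \<comment> \<open>The diagonal value of the averaged operator. Conjugation preserves traces, so
    comparing traces expresses \<open>z\<close> by the trace of \<open>E\<close>.\<close>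
  define z where "z = (\<Sum>u\<in>V. E (- sh u) (- sh u))"
  have card_L: "card L > 0" using L L0 card_gt_0_iff by blast
  have "(\<Sum>x\<in>L. \<Sum>u\<in>V. E (x - sh u) (x - sh u)) = of_nat (card L) * z"
    using diag by (simp add: z_def)
  moreover have "(\<Sum>x\<in>L. \<Sum>u\<in>V. E (x - sh u) (x - sh u)) = (\<Sum>u\<in>V. \<Sum>x\<in>L. E (x - sh u) (x - sh u))"
    by (rule sum.swap)
  moreover have "(\<Sum>x\<in>L. E (x - sh u) (x - sh u)) = (\<Sum>w\<in>L. E w w)" if "u \<in> V" for u
    using sum.reindex_bij_betw[OF add_subgroup_translate_bij[OF L(2), of "- sh u"], of "\<lambda>x. E x x"]
      add_subgroup_uminus[OF L(2) sh[OF that]] by simp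
  ultimately have z: "?v * (\<Sum>w\<in>L. E w w) = of_nat (card L) * z" by simp
  define A where "A = (\<lambda>x y. \<Sum>u\<in>V. op_mult L (weyl u) (op_mult L E (weyl (- u))) x y)"
  have A: "A x y = z * (if x = y then 1 else 0)" if "x \<in> L" "y \<in> L" for x y
  proof (cases "x = y")
    case True
    thus ?thesis using diag[OF that(2)] by (simp add: A_def weyl_conjugation z_def ph_zero_right that)
  qed (use that off in \<open>simp add: A_def weyl_conjugation\<close>)
  \<comment> \<open>The projector absorbs stabilizers on both sides, so each conjugate of
    \<open>E\<close> has the same compression.\<close>
  have "op_mult L ?P (op_mult L E ?P)
      = op_mult L ?P (op_mult L (op_mult L (weyl u) (op_mult L E (weyl (- u)))) ?P)" (is "?PEP = ?f u") if "u \<in> V" for u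
  proof -
    have "?PEP = op_mult L (op_mult L ?P (weyl u)) (op_mult L E (op_mult L (weyl (- u)) ?P))"
      using that add_subgroup_uminus[OF V(2) that] by (simp add: weyl_absorb_left weyl_absorb_right)
    thus ?thesis by (simp only: op_mult_assoc)
  qed
  hence "(\<Sum>u\<in>V. ?f u x y) = (\<Sum>u\<in>V. ?PEP x y)"
    by (intro sum.cong refl) metis
  hence "?v * ?PEP x y = (\<Sum>u\<in>V. ?f u x y)" by simp
  also have "\<dots> = op_mult L ?P (op_mult L A ?P) x y"
    by (simp add: A_def op_mult_sum_left op_mult_sum_right)
  also have "\<dots> = op_mult L ?P (\<lambda>x y. z * ?P x y) x y"
  proof (rule op_mult_cong)
    fix w assume w: "w \<in> L"
    have "op_mult L A ?P w y = (\<Sum>w'\<in>L. if w' = w then z * ?P w' y else 0)"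
      unfolding op_mult_def by (intro sum.cong) (auto simp: A w)
    thus "op_mult L A ?P w y = z * ?P w y" using w L by simp
  qed simp
  also have "\<dots> = z * ?P x y" by (simp add: op_mult_scale_right code_projector_idem)
  finally have "?v * ?PEP x y = z * ?P x y" .
  hence "?v * (of_nat (card L) * ?PEP x y) = ?v * ((\<Sum>w\<in>L. E w w) * ?P x y)"
    using z by (metis mult.assoc mult.commute)
  hence "of_nat (card L) * ?PEP x y = (\<Sum>w\<in>L. E w w) * ?P x y" using card_V by simp
  thus ?thesis using card_L by (simp add: field_simps)
qed

end

section \<open>Codes from projectors\<close>

definition orthonormal_on :: "'b set \<Rightarrow> nat \<Rightarrow> (nat \<Rightarrow> 'b \<Rightarrow> complex) \<Rightarrow> bool" where
  "orthonormal_on B m v \<longleftrightarrow> (\<forall>i<m. \<forall>j<m. (\<Sum>x\<in>B. cnj (v i x) * v j x) = of_bool (i = j))"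

text \<open>Rank-one pieces are split off one at a time. A diagonal entry of a projector is the
  squared norm of its row, so a zero entry kills the row; subtracting the piece given by the
  normalized column of \<open>x0\<close> removes a nonzero diagonal entry and creates none.\<close>

lemma projector_orthonormal_basis:
  fixes P :: "'b \<Rightarrow> 'b \<Rightarrow> complex"
  assumes B: "finite B"
    and herm: "\<And>x y. x \<in> B \<Longrightarrow> y \<in> B \<Longrightarrow> P y x = cnj (P x y)"
    and idem: "\<And>x y. x \<in> B \<Longrightarrow> y \<in> B \<Longrightarrow> op_mult B P P x y = P x y"
  shows "\<exists>m v. orthonormal_on B m v \<and> (\<forall>x\<in>B. \<forall>y\<in>B. P x y = (\<Sum>i<m. v i x * cnj (v i y)))"
  using herm idem
proof (induction "card {x\<in>B. P x x \<noteq> 0}" arbitrary: P rule: less_induct)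
  case less
  note herm = less.prems(1) and idem = less.prems(2)
  have row: "P x x = of_real (\<Sum>y\<in>B. (norm (P x y))\<^sup>2)" if "x \<in> B" for x
  proof -
    have "P x x = (\<Sum>y\<in>B. P x y * P y x)" using idem[OF that that] by (simp add: op_mult_def)
    also have "\<dots> = (\<Sum>y\<in>B. of_real ((norm (P x y))\<^sup>2))"
      using that by (intro sum.cong) (simp_all add: herm[of x] complex_norm_square[symmetric])
    finally show ?thesis by simp
  qed
  have row0: "P x y = 0" if "x \<in> B" "y \<in> B" "P x x = 0" for x y
  proof -
    have "(\<Sum>y\<in>B. (norm (P x y))\<^sup>2) = 0" using row[OF that(1)] that(3) of_real_eq_0_iff by metis
    thus ?thesis using that(2) B by (simp add: sum_nonneg_eq_0_iff)
  qed
  show ?case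
  proof (cases "\<exists>x0\<in>B. P x0 x0 \<noteq> 0")
    case False
    hence "\<forall>x\<in>B. \<forall>y\<in>B. P x y = 0" using row0 by blast
    thus ?thesis by (intro exI[of _ 0] exI[of _ undefined]) (simp add: orthonormal_on_def)
  next
    case True
    then obtain x0 where x0: "x0 \<in> B" "P x0 x0 \<noteq> 0" by blast
    define r where "r = (\<Sum>y\<in>B. (norm (P x0 y))\<^sup>2)"
    have r: "P x0 x0 = of_real r" "r > 0"
    proof -
      show "P x0 x0 = of_real r" using row[OF x0(1)] by (simp add: r_def)
      hence "r \<noteq> 0" using x0 by auto
      moreover have "r \<ge> 0" unfolding r_def by (intro sum_nonneg) simp
      ultimately show "r > 0" by simp
    qed
    \<comment> \<open>\<open>r\<close> is also the squared norm of the column at \<open>x0\<close>,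
      so \<open>w\<close> is a unit vector fixed by \<open>P\<close>.\<close>
    define w where "w y = P y x0 / of_real (sqrt r)" for y
    have rr: "of_real (sqrt r) * of_real (sqrt r) = (of_real r :: complex)"
      using r(2) by (simp flip: of_real_mult)
    have ww: "w x * cnj (w y) = P x x0 * P x0 y / of_real r" if "y \<in> B" for x y
      using herm[OF x0(1) that] by (simp add: w_def rr)
    have w_norm: "(\<Sum>x\<in>B. cnj (w x) * w x) = 1"
    proof -
      have "(\<Sum>x\<in>B. cnj (w x) * w x) = (\<Sum>x\<in>B. P x0 x * P x x0 / of_real r)"
        using ww by (intro sum.cong) (auto simp: mult.commute)
      also have "\<dots> = op_mult B P P x0 x0 / of_real r"
        by (simp add: op_mult_def sum_divide_distrib)
      finally show ?thesis using idem[OF x0(1) x0(1)] r by simp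
    qed
    have Pw: "(\<Sum>y\<in>B. P x y * w y) = w x" if "x \<in> B" for x
      using idem[OF that x0(1)] by (simp add: w_def op_mult_def flip: sum_divide_distrib)
    have wP: "(\<Sum>y\<in>B. cnj (w y) * P y x) = cnj (w x)" if "x \<in> B" for x
    proof -
      have "cnj (\<Sum>y\<in>B. P x y * w y) = (\<Sum>y\<in>B. cnj (w y) * P y x)"
        using that by (simp add: herm[of x] mult.commute)
      thus ?thesis using Pw[OF that] by simp
    qed
    define P' where "P' x y = P x y - w x * cnj (w y)" for x y
    have herm': "P' y x = cnj (P' x y)" if "x \<in> B" "y \<in> B" for x y
      using herm[OF that] by (simp add: P'_def mult.commute)
    have idem': "op_mult B P' P' x y = P' x y" if "x \<in> B" "y \<in> B" for x y
    proof -
      have "op_mult B P' P' x y = (\<Sum>z\<in>B. P x z * P z y - (P x z * w z) * cnj (w y)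
          - w x * (cnj (w z) * P z y) + w x * cnj (w y) * (cnj (w z) * w z))"
        unfolding op_mult_def P'_def by (intro sum.cong) (auto simp: algebra_simps)
      also have "\<dots> = op_mult B P P x y - (\<Sum>z\<in>B. P x z * w z) * cnj (w y)
          - w x * (\<Sum>z\<in>B. cnj (w z) * P z y) + w x * cnj (w y) * (\<Sum>z\<in>B. cnj (w z) * w z)"
        by (simp add: op_mult_def sum.distrib sum_subtractf sum_distrib_left sum_distrib_right)
      finally show ?thesis using idem[OF that] Pw[OF that(1)] wP[OF that(2)] w_norm
        by (simp add: P'_def)
    qed
    have "{x\<in>B. P' x x \<noteq> 0} \<subset> {x\<in>B. P x x \<noteq> 0}"
    proof
      show "{x\<in>B. P' x x \<noteq> 0} \<subseteq> {x\<in>B. P x x \<noteq> 0}"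
        using row0 x0(1) by (auto simp: P'_def w_def)
      have "P' x0 x0 = 0" using ww[OF x0(1), of x0] r by (simp add: P'_def)
      thus "{x\<in>B. P' x x \<noteq> 0} \<noteq> {x\<in>B. P x x \<noteq> 0}" using x0 by auto
    qed
    hence "card {x\<in>B. P' x x \<noteq> 0} < card {x\<in>B. P x x \<noteq> 0}"
      using B by (intro psubset_card_mono) auto
    then obtain m v where ov: "orthonormal_on B m v"
      and P'v: "\<forall>x\<in>B. \<forall>y\<in>B. P' x y = (\<Sum>i<m. v i x * cnj (v i y))"
      using less.hyps[of P'] herm' idem' by blast
    \<comment> \<open>\<open>P'\<close> annihilates \<open>w\<close>, while the \<open>v j\<close>
      span the range of \<open>P'\<close>.\<close>
    have vw: "(\<Sum>x\<in>B. cnj (v j x) * w x) = 0" if j: "j < m" for j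
    proof -
      have P'w: "(\<Sum>y\<in>B. P' x y * w y) = 0" if "x \<in> B" for x
      proof -
        have "(\<Sum>y\<in>B. P' x y * w y) = (\<Sum>y\<in>B. P x y * w y) - w x * (\<Sum>y\<in>B. cnj (w y) * w y)"
          by (simp add: P'_def algebra_simps sum_subtractf sum_distrib_left)
        thus ?thesis using Pw[OF that] w_norm by simp
      qed
      have "0 = (\<Sum>x\<in>B. cnj (v j x) * (\<Sum>y\<in>B. P' x y * w y))" using P'w by simp
      also have "\<dots> = (\<Sum>x\<in>B. \<Sum>y\<in>B. \<Sum>i<m. (cnj (v j x) * v i x) * (cnj (v i y) * w y))"
        using P'v by (simp add: sum_distrib_left sum_distrib_right mult_ac)
      also have "\<dots> = (\<Sum>i<m. (\<Sum>x\<in>B. cnj (v j x) * v i x) * (\<Sum>y\<in>B. cnj (v i y) * w y))"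
        unfolding sum_product by (subst sum.swap[of _ "{..<m}"], subst sum.swap[of _ "{..<m}" B]) simp
      also have "\<dots> = (\<Sum>i<m. if i = j then (\<Sum>y\<in>B. cnj (v i y) * w y) else 0)"
        using ov j unfolding orthonormal_on_def by (intro sum.cong) auto
      finally show ?thesis using j by simp
    qed
    have wv: "(\<Sum>x\<in>B. cnj (w x) * v j x) = 0" if j: "j < m" for j
    proof -
      have "cnj (\<Sum>x\<in>B. cnj (v j x) * w x) = (\<Sum>x\<in>B. cnj (w x) * v j x)"
        by (simp add: mult.commute)
      thus ?thesis using vw[OF j] by simp
    qed
    let ?v = "\<lambda>i. if i < m then v i else w"
    have "orthonormal_on B (Suc m) ?v"
      unfolding orthonormal_on_def
    proof (intro allI impI)
      fix i j assume "i < Suc m" "j < Suc m"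
      thus "(\<Sum>x\<in>B. cnj (?v i x) * ?v j x) = of_bool (i = j)"
        using ov vw wv w_norm unfolding orthonormal_on_def by (cases "i < m"; cases "j < m") auto
    qed
    moreover have "\<forall>x\<in>B. \<forall>y\<in>B. P x y = (\<Sum>i<Suc m. ?v i x * cnj (?v i y))"
    proof (intro ballI)
      fix x y assume "x \<in> B" "y \<in> B"
      hence "P x y = (\<Sum>i<m. v i x * cnj (v i y)) + w x * cnj (w y)"
        using P'v by (simp add: P'_def algebra_simps)
      thus "P x y = (\<Sum>i<Suc m. ?v i x * cnj (?v i y))" by simp
    qed
    ultimately show ?thesis by blast
  qed
qed

section \<open>Encoding isometries from maximally mixed receiver halves\<close>

lemma finite_words: "finite (words q n)"
  unfolding words_def using finite_lists_length_eq[of "{..<q}" n] by simp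

lemma card_words: "card (words q n) = q ^ n"
  unfolding words_def using card_lists_length_eq[of "{..<q}" n] by simp

lemma ebits_words:
  assumes "a \<in> words q c" "b \<in> words q c"
  shows "ebits q c a b = of_bool (a = b) / of_real (sqrt (real q)) ^ c"
proof (cases "a = b")
  case True
  thus ?thesis by (simp add: ebits_def ebit_def power_divide)
next
  case False
  then obtain j where "j < c" "a ! j \<noteq> b ! j"
    using assms by (auto simp: words_def list_eq_iff_nth_eq)
  thus ?thesis using False by (auto simp: ebits_def ebit_def)
qed

text \<open>The operator \<open>I \<otimes> |b\<rangle>\<langle>b'|\<close> with the identity acting on the channel qudits.\<close>
definition receiver_unit :: "nat list \<Rightarrow> nat list \<Rightarrow> nat list \<times> nat list \<Rightarrow> nat list \<times> nat list \<Rightarrow> complex" where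
  "receiver_unit b b' = (\<lambda>(y, \<beta>) (y', \<beta>'). of_bool (y = y' \<and> \<beta> = b \<and> \<beta>' = b'))"

text \<open>Hypothesis \<open>receiver\<close> says that the receiver halves of all code states are maximally mixed, which
  is what makes the encoding map extracted from an orthonormal basis of the code an isometry.\<close>
lemma EAQECC_if_projector:
  fixes P :: "nat list \<times> nat list \<Rightarrow> nat list \<times> nat list \<Rightarrow> complex"
    and q n \<kappa> c d :: nat
  defines "B \<equiv> words q n \<times> words q c"
  assumes q: "q > 0"
    and herm: "\<And>x y. x \<in> B \<Longrightarrow> y \<in> B \<Longrightarrow> P y x = cnj (P x y)"
    and idem: "\<And>x y. x \<in> B \<Longrightarrow> y \<in> B \<Longrightarrow> op_mult B P P x y = P x y"
    and trace: "(\<Sum>x\<in>B. P x x) = of_nat (q ^ \<kappa>)"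
    and receiver: "\<And>b b' x y. b \<in> words q c \<Longrightarrow> b' \<in> words q c \<Longrightarrow> x \<in> B \<Longrightarrow> y \<in> B \<Longrightarrow>
      op_mult B P (op_mult B (receiver_unit b b') P) x y = of_bool (b = b') / of_nat (q ^ c) * P x y"
    and detect: "\<And>E S. S \<subseteq> {..<n} \<Longrightarrow> card S < d \<Longrightarrow> supported_on q n S E \<Longrightarrow>
      detects B P (extend_error E)"
  shows "EAQECC q n \<kappa> d c"
proof -
  have B: "finite B" by (simp add: B_def finite_words)
  obtain m v where ov: "orthonormal_on B m v"
    and Pv: "\<And>x y. x \<in> B \<Longrightarrow> y \<in> B \<Longrightarrow> P x y = (\<Sum>i<m. v i x * cnj (v i y))"
    using projector_orthonormal_basis[of B P, OF B herm idem] by metis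
  have ov': "(\<Sum>x\<in>B. cnj (v i x) * v j x) = of_bool (i = j)" if "i < m" "j < m" for i j
    using ov that by (simp add: orthonormal_on_def)
  have "(\<Sum>x\<in>B. P x x) = (\<Sum>i<m. \<Sum>x\<in>B. cnj (v i x) * v i x)"
    by (subst sum.swap) (simp add: Pv mult.commute)
  also have "\<dots> = of_nat m" by (simp add: ov')
  finally have m: "m = q ^ \<kappa>" using trace of_nat_eq_iff by metis
  then obtain e where e: "bij_betw e (words q \<kappa>) {..<m}"
    by (metis card_words card_lessThan finite_words finite_lessThan finite_same_card_bij)
  have e_less: "e x < m" if "x \<in> words q \<kappa>" for x using bij_betwE[OF e] that by blast
  have e_eq: "e x = e x' \<longleftrightarrow> x = x'" if "x \<in> words q \<kappa>" "x' \<in> words q \<kappa>" for x x'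
    using bij_betw_imp_inj_on[OF e] that by (auto simp: inj_on_def)
  have Pv1: "(\<Sum>y\<in>B. P x y * v j y) = v j x" if "x \<in> B" "j < m" for x j
  proof -
    have "(\<Sum>y\<in>B. P x y * v j y) = (\<Sum>y\<in>B. \<Sum>i<m. v i x * (cnj (v i y) * v j y))"
      using that by (intro sum.cong refl) (simp add: Pv sum_distrib_right mult.assoc)
    also have "\<dots> = (\<Sum>i<m. v i x * (\<Sum>y\<in>B. cnj (v i y) * v j y))"
      by (subst sum.swap) (simp add: sum_distrib_left)
    also have "\<dots> = (\<Sum>i<m. if i = j then v i x else 0)"
      using that by (intro sum.cong) (auto simp: ov')
    finally show ?thesis using that by simp
  qed
  have Pv2: "(\<Sum>x\<in>B. cnj (v j x) * P x y) = cnj (v j y)" if "y \<in> B" "j < m" for y j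
  proof -
    have "cnj (\<Sum>x\<in>B. P y x * v j x) = (\<Sum>x\<in>B. cnj (v j x) * P x y)"
      using that by (simp add: herm[of y] mult.commute)
    thus ?thesis using Pv1[OF that] by simp
  qed
  \<comment> \<open>Sandwiching the receiver condition between two basis vectors gives orthogonality
    of their slices at fixed receiver words.\<close>
  have receiver_v: "(\<Sum>y\<in>words q n. cnj (v i (y, b)) * v j (y, b')) = of_bool (i = j) * of_bool (b = b') / of_nat (q ^ c)"
    if ij: "i < m" "j < m" and b: "b \<in> words q c" "b' \<in> words q c" for i j b b'
  proof -
    let ?F = "receiver_unit b b'"
    have "(\<Sum>x\<in>B. \<Sum>y\<in>B. cnj (v i x) * op_mult B P (op_mult B ?F P) x y * v j y)
        = (\<Sum>x\<in>B. \<Sum>y\<in>B. \<Sum>z\<in>B. \<Sum>w\<in>B. (cnj (v i x) * P x z) * ?F z w * (P w y * v j y))"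
      by (simp add: op_mult_def sum_distrib_left sum_distrib_right mult.assoc)
    also have "\<dots> = (\<Sum>z\<in>B. \<Sum>w\<in>B. (\<Sum>x\<in>B. cnj (v i x) * P x z) * ?F z w * (\<Sum>y\<in>B. P w y * v j y))"
    proof -
      have "(\<Sum>x\<in>B. \<Sum>y\<in>B. \<Sum>z\<in>B. \<Sum>w\<in>B. f x y z w) = (\<Sum>z\<in>B. \<Sum>w\<in>B. \<Sum>y\<in>B. \<Sum>x\<in>B. f x y z w)"
        for f :: "_ \<Rightarrow> _ \<Rightarrow> _ \<Rightarrow> _ \<Rightarrow> complex"
      proof -
        have "(\<Sum>x\<in>B. \<Sum>y\<in>B. \<Sum>z\<in>B. \<Sum>w\<in>B. f x y z w) = (\<Sum>x\<in>B. \<Sum>z\<in>B. \<Sum>y\<in>B. \<Sum>w\<in>B. f x y z w)"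
          by (rule sum.cong[OF refl], rule sum.swap)
        also have "\<dots> = (\<Sum>z\<in>B. \<Sum>x\<in>B. \<Sum>y\<in>B. \<Sum>w\<in>B. f x y z w)" by (rule sum.swap)
        also have "\<dots> = (\<Sum>z\<in>B. \<Sum>x\<in>B. \<Sum>w\<in>B. \<Sum>y\<in>B. f x y z w)"
          by (rule sum.cong[OF refl], rule sum.cong[OF refl], rule sum.swap)
        also have "\<dots> = (\<Sum>z\<in>B. \<Sum>w\<in>B. \<Sum>x\<in>B. \<Sum>y\<in>B. f x y z w)"
          by (rule sum.cong[OF refl], rule sum.swap)
        also have "\<dots> = (\<Sum>z\<in>B. \<Sum>w\<in>B. \<Sum>y\<in>B. \<Sum>x\<in>B. f x y z w)"
          by (rule sum.cong[OF refl], rule sum.cong[OF refl], rule sum.swap)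
        finally show ?thesis .
      qed
      thus ?thesis by (simp add: sum_distrib_left sum_distrib_right mult.assoc)
    qed
    also have "\<dots> = (\<Sum>z\<in>B. \<Sum>w\<in>B. cnj (v i z) * ?F z w * v j w)"
      using ij by (intro sum.cong refl) (simp add: Pv1 Pv2)
    also have "\<dots> = (\<Sum>y\<in>words q n. \<Sum>\<beta>\<in>words q c. \<Sum>y'\<in>words q n. \<Sum>\<beta>'\<in>words q c.
        if \<beta>' = b' then (if y' = y then (if \<beta> = b then cnj (v i (y, b)) * v j (y, b') else 0) else 0) else 0)"
      unfolding B_def sum.cartesian_product' by (intro sum.cong refl) (auto simp: receiver_unit_def)
    also have "\<dots> = (\<Sum>y\<in>words q n. cnj (v i (y, b)) * v j (y, b'))"
      using b by (simp add: finite_words cong: if_cong)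
    finally have 1: "(\<Sum>x\<in>B. \<Sum>y\<in>B. cnj (v i x) * op_mult B P (op_mult B ?F P) x y * v j y)
      = (\<Sum>y\<in>words q n. cnj (v i (y, b)) * v j (y, b'))" .
    have "(\<Sum>x\<in>B. \<Sum>y\<in>B. cnj (v i x) * op_mult B P (op_mult B ?F P) x y * v j y)
        = (\<Sum>x\<in>B. of_bool (b = b') / of_nat (q ^ c) * (cnj (v i x) * (\<Sum>y\<in>B. P x y * v j y)))"
      using b by (intro sum.cong refl) (simp add: receiver sum_distrib_left mult_ac)
    also have "\<dots> = of_bool (b = b') / of_nat (q ^ c) * (\<Sum>x\<in>B. cnj (v i x) * v j x)"
      using ij by (simp add: Pv1 sum_distrib_left)
    finally show ?thesis using 1 ij by (simp add: ov')
  qed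
  \<comment> \<open>Compensates the amplitude of the \<open>c\<close> pairs, each of which
    contributes \<open>1 / sqrt q\<close>; it also makes the slices of the basis vectors into unit
    columns of \<open>U\<close>.\<close>
  define s :: complex where "s = of_real (sqrt (real q)) ^ c"
  have s: "cnj s = s" "s * s = of_nat (q ^ c)" "s \<noteq> 0"
    using q by (simp_all add: s_def flip: power_mult_distrib of_real_mult)
  define U :: "nat list \<Rightarrow> nat list \<times> nat list \<Rightarrow> complex" where "U = (\<lambda>y (x, b). s * v (e x) (y, b))"
  have "is_isometry (words q \<kappa> \<times> words q c) (words q n) U"
    unfolding is_isometry_def
  proof (intro ballI)
    fix p p' assume "p \<in> words q \<kappa> \<times> words q c" "p' \<in> words q \<kappa> \<times> words q c"
    then obtain x b x' b' where p: "p = (x, b)" "p' = (x', b')" "x \<in> words q \<kappa>" "x' \<in> words q \<kappa>"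
      "b \<in> words q c" "b' \<in> words q c" by blast
    have "(\<Sum>y\<in>words q n. cnj (U y p) * U y p') = (s * s) * (\<Sum>y\<in>words q n. cnj (v (e x) (y, b)) * v (e x') (y, b'))"
      by (simp add: p U_def s(1) sum_distrib_left mult_ac)
    also have "\<dots> = of_bool (p = p')"
      using p q by (simp add: receiver_v e_less e_eq s)
    finally show "(\<Sum>y\<in>words q n. cnj (U y p) * U y p') = of_bool (p = p')" .
  qed
  moreover have "is_projector B (code_space q n \<kappa> c U) P"
    unfolding is_projector_def
  proof (intro conjI ballI)
    define comb where "comb \<phi> = (\<lambda>x. if x \<in> B then \<Sum>i<m. \<phi> i * v i x else 0)" for \<phi> :: "nat \<Rightarrow> complex"
    have comb_cong: "comb \<phi> = comb \<phi>'" if "\<And>i. i < m \<Longrightarrow> \<phi> i = \<phi>' i" for \<phi> \<phi>'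
      unfolding comb_def using that by (intro ext if_cong sum.cong arg_cong2[where f = "(*)"] refl) auto
    \<comment> \<open>With this \<open>U\<close>, encoding the word \<open>x\<close> yields the
      basis vector \<open>v (e x)\<close>.\<close>
    have enc: "encode q n \<kappa> c U \<phi> = comb (\<lambda>i. \<phi> (the_inv_into (words q \<kappa>) e i))" for \<phi>
    proof
      fix p :: "nat list \<times> nat list"
      obtain y b where p: "p = (y, b)" by fastforce
      show "encode q n \<kappa> c U \<phi> p = comb (\<lambda>i. \<phi> (the_inv_into (words q \<kappa>) e i)) p"
      proof (cases "p \<in> B")
        case True
        hence yb: "y \<in> words q n" "b \<in> words q c" by (simp_all add: p B_def)
        have "encode q n \<kappa> c U \<phi> p = (\<Sum>x\<in>words q \<kappa>. \<Sum>a\<in>words q c. if a = b then \<phi> x * v (e x) p else 0)"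
          using yb s(3) unfolding p encode_def case_prod_conv
          by (auto intro!: sum.cong simp: ebits_words U_def s_def)
        also have "\<dots> = (\<Sum>x\<in>words q \<kappa>. \<phi> (the_inv_into (words q \<kappa>) e (e x)) * v (e x) p)"
          using yb bij_betw_imp_inj_on[OF e] by (simp add: finite_words the_inv_into_f_f)
        also have "\<dots> = (\<Sum>i<m. \<phi> (the_inv_into (words q \<kappa>) e i) * v i p)"
          by (rule sum.reindex_bij_betw[OF e])
        finally show ?thesis using True by (simp add: comb_def)
      qed (auto simp: comb_def encode_def p B_def)
    qed
    have app: "op_apply B P \<psi> = comb (\<lambda>i. \<Sum>x\<in>B. cnj (v i x) * \<psi> x)" for \<psi>
    proof
      fix y
      show "op_apply B P \<psi> y = comb (\<lambda>i. \<Sum>x\<in>B. cnj (v i x) * \<psi> x) y"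
      proof (cases "y \<in> B")
        case True
        have "(\<Sum>x\<in>B. P y x * \<psi> x) = (\<Sum>x\<in>B. \<Sum>i<m. cnj (v i x) * \<psi> x * v i y)"
          using True by (intro sum.cong refl) (simp add: Pv sum_distrib_left sum_distrib_right mult_ac)
        thus ?thesis using True
          by (simp add: op_apply_def comb_def sum_distrib_right sum.swap[of _ B])
      qed (simp add: op_apply_def comb_def)
    qed
    show "op_apply B P ` hilb B = code_space q n \<kappa> c U"
    proof (intro equalityI subsetI)
      fix \<psi> assume "\<psi> \<in> op_apply B P ` hilb B"
      then obtain \<phi> where \<phi>: "\<psi> = comb \<phi>" using app by blast
      define \<phi>' where "\<phi>' x = (if x \<in> words q \<kappa> then \<phi> (e x) else 0)" for x
      have "\<phi>' (the_inv_into (words q \<kappa>) e i) = \<phi> i" if "i < m" for i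
        using that f_the_inv_into_f_bij_betw[OF e, of i] the_inv_into_into[OF bij_betw_imp_inj_on[OF e], of i, OF _ subset_refl]
          bij_betw_imp_surj_on[OF e] by (simp add: \<phi>'_def)
      hence "encode q n \<kappa> c U \<phi>' = \<psi>" unfolding enc \<phi> comb_def by (intro ext) simp
      moreover have "\<phi>' \<in> hilb (words q \<kappa>)" by (simp add: hilb_def \<phi>'_def)
      ultimately show "\<psi> \<in> code_space q n \<kappa> c U" unfolding code_space_def by blast
    next
      fix \<psi> assume "\<psi> \<in> code_space q n \<kappa> c U"
      then obtain \<phi> where \<phi>: "\<psi> = comb \<phi>" using enc unfolding code_space_def by blast
      have "(\<Sum>x\<in>B. cnj (v i x) * comb \<phi> x) = \<phi> i" if "i < m" for i
      proof -
        have "(\<Sum>x\<in>B. cnj (v i x) * comb \<phi> x) = (\<Sum>x\<in>B. \<Sum>j<m. \<phi> j * (cnj (v i x) * v j x))"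
          by (intro sum.cong refl) (simp add: comb_def sum_distrib_left mult_ac)
        also have "\<dots> = (\<Sum>j<m. \<phi> j * (\<Sum>x\<in>B. cnj (v i x) * v j x))"
          by (subst sum.swap) (simp add: sum_distrib_left)
        also have "\<dots> = (\<Sum>j<m. if j = i then \<phi> j else 0)"
          using that by (intro sum.cong) (auto simp: ov')
        finally show ?thesis using that by simp
      qed
      hence "op_apply B P \<psi> = \<psi>" unfolding app \<phi> by (intro comb_cong)
      moreover have "\<psi> \<in> hilb B" by (simp add: \<phi> comb_def hilb_def)
      ultimately show "\<psi> \<in> op_apply B P ` hilb B" by (metis imageI)
    qed
  qed (rule herm, assumption, assumption, rule idem, assumption, assumption)
  ultimately show ?thesis
    unfolding EAQECC_def B_def[symmetric] using detect by blast
qed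

section \<open>Fields of square order\<close>

lemma card_le_card_image_mult:
  assumes "finite A" "\<And>y. y \<in> f ` A \<Longrightarrow> card {x\<in>A. f x = y} \<le> c"
  shows "card A \<le> card (f ` A) * c"
proof -
  have "card A = (\<Sum>y\<in>f ` A. card {x\<in>A. f x = y})"
    unfolding card_eq_sum by (rule sum.image_gen[OF assms(1)])
  also have "\<dots> \<le> (\<Sum>y\<in>f ` A. c)" by (intro sum_mono assms(2))
  finally show ?thesis by simp
qed

lemma nths_eq_iff:
  assumes "length xs = length ys"
  shows "nths xs I = nths ys I \<longleftrightarrow> (\<forall>i<length xs. i \<in> I \<longrightarrow> xs ! i = ys ! i)"
  using assms
proof (induction xs ys arbitrary: I rule: list_induct2)
  case (Cons x xs y ys)
  show ?case
    using Cons by (cases "0 \<in> I") (auto simp: nths_Cons All_less_Suc2)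
qed simp

lemma finite_field_power_card:
  fixes x :: "'a::{field,finite}"
  shows "x ^ CARD('a) = x"
proof (cases "x = 0")
  case False
  let ?U = "UNIV - {0 :: 'a}"
  have "bij_betw ((*) x) ?U ?U"
    by (rule bij_betwI[where g = "\<lambda>y. y / x"]) (use False in auto)
  hence "(\<Prod>y\<in>?U. x * y) = \<Prod>?U" using prod.reindex_bij_betw[of "(*) x" ?U ?U "\<lambda>y. y"] by simp
  hence "x ^ card ?U = 1" by (simp add: prod.distrib)
  moreover have "CARD('a) = Suc (card ?U)" by (rule card.remove) simp_all
  ultimately show ?thesis by (metis power_Suc mult_1_right)
qed (simp add: zero_power finite_UNIV_card_ge_0)

section \<open>The Frobenius map and the subfield of order q\<close>

locale square_order_field =
  fixes q :: nat and field_type :: "'a::{field,finite} itself"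
  assumes primepow: "primepow q" and card: "CARD('a) = q ^ 2"
begin

lemma q_gt_1: "q > 1"
  using primepow_gt_Suc_0[OF primepow] by simp

lemma q_gt_0: "q > 0"
  using q_gt_1 by simp

lemma frob_add: "((x::'a) + y) ^ q = x ^ q + y ^ q"
proof -
  obtain p m where p: "prime p" "m > 0" "q = p ^ m"
    using primepow unfolding primepow_def by blast
  have "prime CHAR('a)" using prime_CHAR_semidom[where ?'a = 'a] finite_imp_CHAR_pos[where ?'a = 'a] by simp
  moreover have "CHAR('a) dvd p ^ (m * 2)"
  proof -
    \<comment> \<open>Shifting by 1 permutes the field, so the sum of all elements equals itself
      plus \<open>CARD('a)\<close> copies of 1.\<close>
    have "bij_betw (\<lambda>x :: 'a. x + 1) UNIV UNIV" by (rule bij_betwI[where g = "\<lambda>x. x - 1"]) auto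
    hence "(\<Sum>x\<in>UNIV. x + 1 :: 'a) = \<Sum>UNIV"
      using sum.reindex_bij_betw[of "\<lambda>x :: 'a. x + 1" UNIV UNIV "\<lambda>x. x"] by simp
    hence "of_nat CARD('a) = (0 :: 'a)" by (simp add: sum.distrib)
    hence "CHAR('a) dvd CARD('a)" by (simp only: of_nat_eq_0_iff_char_dvd)
    thus ?thesis using card p(3) by (simp add: power_mult)
  qed
  ultimately have "CHAR('a) = p" using p(1) prime_dvd_power primes_dvd_imp_eq by blast
  hence "q = CHAR('a) ^ m" using p(3) by simp
  with \<open>prime CHAR('a)\<close> show ?thesis by (rule freshmans_dream')
qed

lemma frob_zero: "(0::'a) ^ q = 0"
  using q_gt_0 by simp

lemma frob_minus: "(- (x::'a)) ^ q = - (x ^ q)"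
  using frob_add[of x "- x"] by (simp add: frob_zero eq_neg_iff_add_eq_0 add.commute)

lemma frob_diff: "((x::'a) - y) ^ q = x ^ q - y ^ q"
  using frob_add[of x "- y"] by (simp add: frob_minus)

lemma frob_frob: "((x::'a) ^ q) ^ q = x"
  using finite_field_power_card[of x] card by (simp add: power2_eq_square flip: power_mult)

lemma frob_sum: "(\<Sum>i\<in>I. f i :: 'a) ^ q = (\<Sum>i\<in>I. f i ^ q)"
  by (induction I rule: infinite_finite_induct) (simp_all add: frob_zero frob_add)

definition base :: "'a set" where
  "base = {x. x ^ q = x}"

lemma base_0: "0 \<in> base" and base_1: "1 \<in> base"
  and base_diff: "x \<in> base \<Longrightarrow> y \<in> base \<Longrightarrow> x - y \<in> base"
  and base_minus: "x \<in> base \<Longrightarrow> - x \<in> base"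
  and base_mult: "x \<in> base \<Longrightarrow> y \<in> base \<Longrightarrow> x * y \<in> base"
  and base_inverse: "x \<in> base \<Longrightarrow> inverse x \<in> base"
  by (simp_all add: base_def frob_zero frob_diff frob_minus power_mult_distrib power_inverse)

lemma base_norm: "(x::'a) ^ (q + 1) \<in> base"
  by (simp add: base_def power_mult_distrib frob_frob power_add mult.commute)

text \<open>These are roots of \<open>X^q - d X\<close>. The values 1 and -1 of \<open>d\<close>
  count the subfield; a general \<open>d\<close> occurs for Hermitian forms.\<close>

lemma card_frob_eigenspace_le: "card {x::'a. x ^ q = d * x} \<le> q"
proof -
  define p where "p = monom 1 q - [:0, d:]"
  have "coeff p q = 1" using q_gt_1 by (simp add: p_def coeff_pCons split: nat.split)
  hence "p \<noteq> 0" by auto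
  have "degree p \<le> q"
    unfolding p_def using q_gt_1 by (intro degree_diff_le) (simp_all add: degree_monom_le)
  have "{x. poly p x = 0} = {x. x ^ q = d * x}" by (simp add: p_def poly_monom mult.commute)
  thus ?thesis using card_poly_roots_bound[OF \<open>p \<noteq> 0\<close>] \<open>degree p \<le> q\<close> by simp
qed

text \<open>The lower bound comes from the additive map \<open>x^q - x\<close>: its kernel is the
  subfield and its image lies among the at most \<open>q\<close> solutions of
  \<open>x^q = - x\<close>, while the field has \<open>q^2\<close> elements.\<close>

lemma card_base: "card base = q"
proof (rule antisym)
  show "card base \<le> q" using card_frob_eigenspace_le[of 1] by (simp add: base_def)
  define f where "f x = x ^ q - x" for x :: 'a
  have "card {x\<in>UNIV. f x = y} \<le> card base" if "y \<in> f ` UNIV" for y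
  proof -
    obtain x0 where x0: "y = f x0" using \<open>y \<in> f ` UNIV\<close> by blast
    show ?thesis
    proof (rule card_inj_on_le[where f = "\<lambda>x. x - x0"])
      show "(\<lambda>x. x - x0) ` {x \<in> UNIV. f x = y} \<subseteq> base"
        by (auto simp: x0 f_def base_def frob_diff algebra_simps)
    qed (auto simp: inj_on_def)
  qed
  hence 1: "CARD('a) \<le> card (range f) * card base" by (intro card_le_card_image_mult) auto
  have "card (range f) \<le> card {x::'a. x ^ q = (- 1) * x}"
    by (intro card_mono) (auto simp: f_def frob_diff frob_frob)
  also have "\<dots> \<le> q" by (rule card_frob_eigenspace_le)
  finally have "card (range f) * card base \<le> q * card base" by (rule mult_right_mono[OF _ le0])
  with 1 have "CARD('a) \<le> q * card base" by (rule le_trans)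
  hence "q * q \<le> q * card base" by (simp add: card power2_eq_square)
  thus "q \<le> card base" using q_gt_0 by simp
qed

lemma not_base_exists: obtains \<omega> where "\<omega> \<notin> base"
proof -
  have "base \<noteq> UNIV"
  proof
    assume "base = UNIV"
    hence "q = q ^ 2" using card_base card by simp
    thus False using q_gt_1 by (simp add: power2_eq_square)
  qed
  thus ?thesis using that by blast
qed

end

section \<open>Codes from self-orthogonal systems of functionals\<close>

text \<open>An operator on the coordinates in \<open>T\<close> tensored with the identity, described
  by entries so that, after relabelling, channel errors and \<open>receiver_unit\<close> are both
  instances.\<close>

definition local_on :: "nat \<Rightarrow> (nat \<Rightarrow> 'a) set \<Rightarrow> nat set \<Rightarrow> ((nat \<Rightarrow> 'a) \<Rightarrow> (nat \<Rightarrow> 'a) \<Rightarrow> complex) \<Rightarrow> bool" where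
  "local_on M L T E \<longleftrightarrow>
     (\<forall>x\<in>L. \<forall>y\<in>L. (\<exists>j<M. j \<notin> T \<and> x j \<noteq> y j) \<longrightarrow> E x y = 0) \<and>
     (\<forall>x\<in>L. \<forall>y\<in>L. \<forall>x'\<in>L. \<forall>y'\<in>L.
        (\<forall>j\<in>T. x j = x' j \<and> y j = y' j) \<longrightarrow> (\<forall>j<M. j \<notin> T \<longrightarrow> x j = y j \<and> x' j = y' j) \<longrightarrow>
        E x y = E x' y')"

text \<open>\<open>e j u\<close> is coordinate \<open>j\<close> of the codeword of \<open>u\<close>.
  The character is defined on the large field; as 1 belongs to the subfield,
  \<open>\<chi> 1 \<noteq> 1\<close> makes it nontrivial there.\<close>

locale self_orthogonal_system = square_order_field q field_type
  for q and field_type :: "'a::{field,finite} itself" +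
  fixes V :: "'v::ab_group_add set" and M :: nat and e :: "nat \<Rightarrow> 'v \<Rightarrow> 'a" and w :: "nat \<Rightarrow> 'a"
    and \<omega> :: 'a and \<chi> :: "'a \<Rightarrow> complex"
  assumes V: "finite V" "add_subgroup V"
    and e_add: "\<And>j u v. j < M \<Longrightarrow> u \<in> V \<Longrightarrow> v \<in> V \<Longrightarrow> e j (u + v) = e j u + e j v"
    and w: "\<And>j. j < M \<Longrightarrow> w j \<in> base" "\<And>j. j < M \<Longrightarrow> w j \<noteq> 0"
    and ortho: "\<And>u v. u \<in> V \<Longrightarrow> v \<in> V \<Longrightarrow> (\<Sum>j<M. w j * e j u * e j v ^ q) = 0"
    and inj: "\<And>u. u \<in> V \<Longrightarrow> (\<And>j. j < M \<Longrightarrow> e j u = 0) \<Longrightarrow> u = 0"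
    and \<omega>: "\<omega> \<notin> base"
    and \<chi>_norm: "\<And>x. norm (\<chi> x) = 1" and \<chi>_add: "\<And>x y. \<chi> (x + y) = \<chi> x * \<chi> y"
    and \<chi>_1: "\<chi> 1 \<noteq> 1"
begin

section \<open>Coordinates over the subfield and Weyl operators on qudits\<close>

text \<open>The coordinates of \<open>t = ca t + cb t * \<omega>\<close> over the subfield.\<close>
definition cb :: "'a \<Rightarrow> 'a" where "cb t = (t - t ^ q) / (\<omega> - \<omega> ^ q)"
definition ca :: "'a \<Rightarrow> 'a" where "ca t = t - cb t * \<omega>"

lemma \<omega>_nz: "\<omega> - \<omega> ^ q \<noteq> 0"
  using \<omega> by (auto simp: base_def)

lemma cb_base: "cb t \<in> base"
proof -
  have "cb t ^ q = (t ^ q - t) / (\<omega> ^ q - \<omega>)"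
    by (simp add: cb_def power_divide frob_diff frob_frob)
  also have "\<dots> = cb t" by (metis cb_def minus_diff_eq minus_divide_divide)
  finally show ?thesis by (simp add: base_def)
qed

lemma ca_base: "ca t \<in> base"
proof -
  have "cb t * (\<omega> - \<omega> ^ q) = t - t ^ q" using \<omega>_nz by (simp add: cb_def)
  hence 1: "t ^ q - cb t * \<omega> ^ q = t - cb t * \<omega>" by (simp add: algebra_simps)
  have "ca t ^ q = t ^ q - cb t * \<omega> ^ q"
    using cb_base[of t] by (simp add: ca_def frob_diff power_mult_distrib base_def)
  also note 1
  finally show ?thesis by (simp add: ca_def base_def)
qed

lemma cb_add: "cb (s + t) = cb s + cb t"
  by (simp add: cb_def frob_add add_divide_distrib[symmetric])

lemma ca_add: "ca (s + t) = ca s + ca t"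
  by (simp add: ca_def cb_add algebra_simps)

lemma cb_of_base: "x \<in> base \<Longrightarrow> cb x = 0"
  by (simp add: cb_def base_def)

lemma ca_of_base: "x \<in> base \<Longrightarrow> ca x = x"
  by (simp add: ca_def cb_of_base)

lemma cb_of_base_\<omega>: "x \<in> base \<Longrightarrow> cb (x * \<omega>) = x"
  using \<omega>_nz by (simp add: cb_def base_def power_mult_distrib flip: right_diff_distrib)

lemma ca_of_base_\<omega>: "x \<in> base \<Longrightarrow> ca (x * \<omega>) = 0"
  by (simp add: ca_def cb_of_base_\<omega>)

lemma ca_cb_eq_zero: "ca t = 0 \<Longrightarrow> cb t = 0 \<Longrightarrow> t = 0"
  by (simp add: ca_def)

text \<open>The bridge from Hermitian orthogonality to commuting operators: on the right stands the
  antisymmetrized Hermitian product, on the left the symplectic form of the subfield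
  coordinates.\<close>

lemma symplectic: "cb s * ca t - cb t * ca s = (s * t ^ q - s ^ q * t) / (\<omega> - \<omega> ^ q)"
proof -
  have "cb s * ca t - cb t * ca s = cb s * t - cb t * s" by (simp add: ca_def algebra_simps)
  also have "\<dots> = ((s - s ^ q) * t - (t - t ^ q) * s) / (\<omega> - \<omega> ^ q)"
    by (simp add: cb_def diff_divide_distrib left_diff_distrib)
  finally show ?thesis by (simp add: algebra_simps)
qed

text \<open>Setting the entries from \<open>M\<close> on to 0 makes the labels a finite group under
  pointwise addition.\<close>

definition L :: "(nat \<Rightarrow> 'a) set" where
  "L = {x. (\<forall>j<M. x j \<in> base) \<and> (\<forall>j\<ge>M. x j = 0)}"

definition sh :: "'v \<Rightarrow> nat \<Rightarrow> 'a" where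
  "sh u = (\<lambda>j. if j < M then ca (e j u) else 0)"

text \<open>The first subfield coordinate shifts and the second gives the phase. The weight enters
  only here, so commutators see the weighted sum of the symplectic forms.\<close>

definition ph :: "'v \<Rightarrow> (nat \<Rightarrow> 'a) \<Rightarrow> complex" where
  "ph u x = \<chi> (\<Sum>j<M. w j * cb (e j u) * x j)"

lemma L_bij:
  assumes \<rho>: "bij_betw \<rho> {..<q} base" and M: "M = n + c"
  defines "\<Phi> \<equiv> (\<lambda>(y, b) j. if j < n then \<rho> (y ! j) else if j < M then \<rho> (b ! (j - n)) else 0)"
  shows "bij_betw \<Phi> (words q n \<times> words q c) L"
  unfolding bij_betw_def
proof
  have \<rho>_inj: "r = s" if "\<rho> r = \<rho> s" "r < q" "s < q" for r s
    using \<rho> that by (auto simp: bij_betw_def inj_on_def)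
  have M': "n \<le> M" "\<And>j. j < M \<Longrightarrow> \<not> j < n \<Longrightarrow> j - n < c" "\<And>j. j < c \<Longrightarrow> n + j < M" "\<And>j. j < n \<Longrightarrow> j < M"
    using M by auto
  have word_nth: "y ! j < q" if "y \<in> words q l" "j < l" for y j l
    using that nth_mem by (fastforce simp: words_def)
  show "inj_on \<Phi> (words q n \<times> words q c)"
  proof (rule inj_onI)
    fix p p' assume "p \<in> words q n \<times> words q c" "p' \<in> words q n \<times> words q c" and eq: "\<Phi> p = \<Phi> p'"
    then obtain y b y' b' where p: "p = (y, b)" "p' = (y', b')" "y \<in> words q n" "y' \<in> words q n"
      "b \<in> words q c" "b' \<in> words q c" by blast
    have "y ! j = y' ! j" if "j < n" for j
      using fun_cong[OF eq, of j] that p by (auto simp: \<Phi>_def intro!: \<rho>_inj word_nth)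
    moreover have "b ! j = b' ! j" if "j < c" for j
      using fun_cong[OF eq, of "n + j"] that p M by (auto simp: \<Phi>_def intro!: \<rho>_inj word_nth)
    ultimately show "p = p'" using p by (auto simp: words_def intro!: nth_equalityI)
  qed
  show "\<Phi> ` (words q n \<times> words q c) = L"
  proof (intro equalityI subsetI)
    fix x assume "x \<in> \<Phi> ` (words q n \<times> words q c)"
    thus "x \<in> L" using bij_betwE[OF \<rho>] word_nth M' by (auto simp: \<Phi>_def L_def)
  next
    fix x assume x: "x \<in> L"
    define \<sigma> where "\<sigma> = the_inv_into {..<q} \<rho>"
    have \<sigma>: "\<sigma> t < q" "\<rho> (\<sigma> t) = t" if "t \<in> base" for t
      using bij_betwE[OF bij_betw_the_inv_into[OF \<rho>]] f_the_inv_into_f_bij_betw[OF \<rho>] that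
      by (auto simp: \<sigma>_def)
    let ?y = "map (\<lambda>j. \<sigma> (x j)) [0..<n]" and ?b = "map (\<lambda>j. \<sigma> (x (n + j))) [0..<c]"
    have "\<Phi> (?y, ?b) = x" using x M' by (intro ext) (auto simp: \<Phi>_def L_def \<sigma>)
    moreover have "?y \<in> words q n" "?b \<in> words q c" using x M' by (auto simp: words_def L_def \<sigma>)
    ultimately show "x \<in> \<Phi> ` (words q n \<times> words q c)" by force
  qed
qed

lemma card_L: "card L = q ^ M" and finite_L: "finite L"
proof -
  obtain \<rho> where \<rho>: "bij_betw \<rho> {..<q} base"
    using finite_same_card_bij[of "{..<q}" base] card_base by auto
  note bij = L_bij[OF \<rho>, of M 0, simplified]
  show "card L = q ^ M" using bij_betw_same_card[OF bij] by (simp add: card_words card_cartesian_product)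
  show "finite L" using bij_betw_finite[OF bij] by (simp add: finite_words)
qed

lemma L_subgroup: "add_subgroup L"
  by (auto simp: add_subgroup_def L_def base_0 base_diff)

lemma sh_L: "sh u \<in> L"
  by (simp add: sh_def L_def ca_base)

text \<open>By \<open>symplectic\<close>, the exponents differ by a constant multiple of the form at
  \<open>u\<close>, \<open>v\<close> minus the form at \<open>v\<close>, \<open>u\<close>, and both
  are zero.\<close>

lemma ph_sh_sym:
  assumes "u \<in> V" "v \<in> V"
  shows "ph u (sh v) = ph v (sh u)"
proof -
  have "(\<Sum>j<M. w j * cb (e j u) * sh v j) - (\<Sum>j<M. w j * cb (e j v) * sh u j)
      = (\<Sum>j<M. w j * (cb (e j u) * ca (e j v) - cb (e j v) * ca (e j u)))"
    by (simp add: sh_def algebra_simps flip: sum_subtractf)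
  also have "\<dots> = (\<Sum>j<M. (w j * e j u * e j v ^ q - w j * e j v * e j u ^ q) / (\<omega> - \<omega> ^ q))"
    unfolding symplectic by (intro sum.cong refl) (simp add: algebra_simps)
  also have "\<dots> = ((\<Sum>j<M. w j * e j u * e j v ^ q) - (\<Sum>j<M. w j * e j v * e j u ^ q)) / (\<omega> - \<omega> ^ q)"
    by (simp add: sum_subtractf flip: sum_divide_distrib)
  also have "\<dots> = 0" using assms by (simp add: ortho)
  finally show ?thesis by (simp add: ph_def)
qed

lemma sh_add: "u \<in> V \<Longrightarrow> v \<in> V \<Longrightarrow> sh (u + v) = sh u + sh v"
  by (intro ext) (simp add: sh_def e_add ca_add)

lemma ph_norm: "norm (ph u x) = 1"
  by (simp add: ph_def \<chi>_norm)

lemma ph_add_left: "u \<in> V \<Longrightarrow> v \<in> V \<Longrightarrow> ph (u + v) x = ph u x * ph v x"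
  by (simp add: ph_def e_add cb_add ring_distribs sum.distrib \<chi>_add)

lemma ph_add_right: "ph u (x + y) = ph u x * ph u y"
  by (simp add: ph_def ring_distribs sum.distrib \<chi>_add)

lemma weyl_system_exists:
  obtains \<theta> where "weyl_system V L sh ph \<theta>"
proof -
  have "sym_bichar V (\<lambda>u v. ph u (sh v))"
    by (simp add: sym_bichar_def ph_sh_sym ph_norm ph_add_left)
  then obtain \<theta> where "cocycle_splitting V (\<lambda>u v. ph u (sh v)) \<theta>"
    using cocycle_splitting_exists[OF V] by metis
  hence "weyl_system V L sh ph \<theta>"
    by unfold_locales (auto simp: V finite_L L_subgroup sh_L sh_add ph_norm ph_add_left ph_add_right)
  thus ?thesis using that by blast
qed

lemma faithful:
  assumes "u \<in> V" "sh u = 0" "\<And>x. x \<in> L \<Longrightarrow> ph u x = 1"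
  shows "u = 0"
proof (rule inj[OF assms(1)])
  fix j assume j: "j < M"
  have "ca (e j u) = 0" using fun_cong[OF assms(2), of j] j by (simp add: sh_def)
  moreover have "cb (e j u) = 0"
  proof (rule ccontr)
    assume nz: "cb (e j u) \<noteq> 0"
    \<comment> \<open>A label supported at \<open>j\<close>, scaled so that its phase under
      \<open>u\<close> is \<open>\<chi> 1\<close>.\<close>
    define x where "x i = (if i = j then inverse (w j * cb (e j u)) else 0)" for i
    have "x \<in> L" using j by (auto simp: L_def x_def base_0 intro!: base_inverse base_mult w cb_base)
    hence "ph u x = 1" using assms(3) by blast
    moreover have "(\<Sum>i<M. w i * cb (e i u) * x i) = (\<Sum>i<M. if i = j then 1 else 0)"
      using nz w j by (intro sum.cong) (auto simp: x_def field_simps)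
    ultimately show False using \<chi>_1 j by (simp add: ph_def)
  qed
  ultimately show "e j u = 0" by (rule ca_cb_eq_zero)
qed

text \<open>If the code projects onto all of \<open>F\<^sup>T\<close>, the stabilizers act on the qudits in \<open>T\<close> by all
  Weyl operators.\<close>
lemma compression_local:
  assumes \<theta>: "weyl_system V L sh ph \<theta>"
    and T: "T \<subseteq> {..<M}" and surj: "\<And>t. \<exists>u\<in>V. \<forall>j\<in>T. e j u = t j"
    and E: "local_on M L T E" and xy: "x \<in> L" "y \<in> L"
  defines "P \<equiv> weyl_system.code_projector V L sh ph \<theta>"
  shows "op_mult L P (op_mult L E P) x y = (\<Sum>z\<in>L. E z z) / of_nat (q ^ M) * P x y"
proof -
  interpret weyl_system V L sh ph \<theta> by (rule \<theta>)
  have E0: "E x y = 0" if "x \<in> L" "y \<in> L" "j < M" "j \<notin> T" "x j \<noteq> y j" for x y j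
    using E that unfolding local_on_def by blast
  have EE: "E x y = E x' y'"
    if "x \<in> L" "y \<in> L" "x' \<in> L" "y' \<in> L" "\<And>j. j \<in> T \<Longrightarrow> x j = x' j \<and> y j = y' j"
      "\<And>j. j < M \<Longrightarrow> j \<notin> T \<Longrightarrow> x j = y j \<and> x' j = y' j" for x y x' y'
    using E that unfolding local_on_def by blast
  have Ld: "x - sh u \<in> L" if "x \<in> L" for x u using add_subgroup_diff[OF L_subgroup that sh_L] .
  show ?thesis
    unfolding P_def card_L[symmetric]
  proof (rule compression_scalar[OF _ _ xy])
    fix x y assume x: "x \<in> L" and y: "y \<in> L" and ne: "x \<noteq> y"
    show "(\<Sum>u\<in>V. ph u (x - y) * E (x - sh u) (y - sh u)) = 0"
    proof (cases "\<exists>j<M. j \<notin> T \<and> x j \<noteq> y j")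
      case True
      then obtain j where "j < M" "j \<notin> T" "x j \<noteq> y j" by blast
      hence "E (x - sh u) (y - sh u) = 0" for u
        by (intro E0[of _ _ j] Ld x y) auto
      thus ?thesis by simp
    next
      case False
      obtain j0 where j0: "x j0 \<noteq> y j0" using ne by blast
      have "j0 < M"
      proof (rule ccontr)
        assume "\<not> j0 < M"
        thus False using x y j0 by (simp add: L_def)
      qed
      hence j0: "j0 \<in> T" "x j0 \<noteq> y j0" using j0 False by blast+
      \<comment> \<open>Scaled so that \<open>u0\<close> below gives \<open>x - y\<close> the phase
        \<open>\<chi> 1\<close>. On \<open>T\<close>, \<open>u0\<close> is a pure phase and moves no
        entry of \<open>E\<close>; outside \<open>T\<close> it may shift, but there \<open>E\<close>
        acts as the identity and \<open>x - y\<close> vanishes.\<close>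
      define d where "d = inverse (w j0 * (x j0 - y j0))"
      have d: "d \<in> base" unfolding d_def
        using x y \<open>j0 < M\<close> by (intro base_inverse base_mult base_diff w) (auto simp: L_def)
      obtain u0 where u0: "u0 \<in> V" "\<And>j. j \<in> T \<Longrightarrow> e j u0 = (if j = j0 then d * \<omega> else 0)"
        using surj[of "\<lambda>j. if j = j0 then d * \<omega> else 0"] by blast
      have ca0: "ca (e j u0) = 0" if "j \<in> T" for j
        using u0 that ca_of_base_\<omega> d ca_of_base base_0 by simp
      have "(\<Sum>j<M. w j * cb (e j u0) * (x - y) j) = (\<Sum>j<M. if j = j0 then 1 else 0)"
      proof (intro sum.cong refl)
        fix j assume "j \<in> {..<M}"
        show "w j * cb (e j u0) * (x - y) j = (if j = j0 then 1 else 0)"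
        proof (cases "j = j0")
          case True
          have "cb (e j0 u0) = d" using u0(2)[OF j0(1)] cb_of_base_\<omega>[OF d] by simp
          thus ?thesis using True w(2)[OF \<open>j0 < M\<close>] j0(2) by (simp add: d_def flip: mult.assoc)
        next
          case jj: False
          have "cb (e j u0) = 0 \<or> (x - y) j = 0"
            using jj False u0(2)[of j] \<open>j \<in> {..<M}\<close> by (cases "j \<in> T") (auto simp: cb_of_base base_0)
          thus ?thesis using jj by auto
        qed
      qed
      hence ph0: "ph u0 (x - y) = \<chi> 1" using \<open>j0 < M\<close> by (simp add: ph_def)
      show ?thesis
      proof (rule sum_eq_zero_if_translate[OF V(2) u0(1) \<chi>_1])
        fix u assume u: "u \<in> V"
        have "E (x - sh (u + u0)) (y - sh (u + u0)) = E (x - sh u) (y - sh u)"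
          using T False u u0 ca0
          by (intro EE Ld x y) (auto simp: sh_add sh_def[of u0])
        thus "ph (u + u0) (x - y) * E (x - sh (u + u0)) (y - sh (u + u0))
            = \<chi> 1 * (ph u (x - y) * E (x - sh u) (y - sh u))"
          using u u0 ph0 add_subgroup_diff[OF L_subgroup x y] by (simp add: ph_add_left mult_ac)
      qed
    qed
  next
    fix x assume x: "x \<in> L"
    \<comment> \<open>The shift of \<open>u0\<close> cancels the part of \<open>x\<close> in
      \<open>T\<close>, and a diagonal entry of \<open>E\<close> depends on that part only.\<close>
    obtain u0 where u0: "u0 \<in> V" "\<And>j. j \<in> T \<Longrightarrow> e j u0 = x j" using surj[of x] by blast
    have "(\<Sum>u\<in>V. E (x - sh u) (x - sh u)) = (\<Sum>u\<in>V. E (x - sh (u + u0)) (x - sh (u + u0)))"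
      by (rule sum.reindex_bij_betw[OF add_subgroup_translate_bij[OF V(2) u0(1)], symmetric])
    also have "\<dots> = (\<Sum>u\<in>V. E (0 - sh u) (0 - sh u))"
    proof (intro sum.cong refl EE Ld x L0)
      fix u j assume "u \<in> V" "j \<in> T"
      moreover from this have "x j \<in> base" "j < M" using x T by (auto simp: L_def)
      ultimately show "(x - sh (u + u0)) j = (0 - sh u) j \<and> (x - sh (u + u0)) j = (0 - sh u) j"
        using u0 by (simp add: sh_add sh_def[of u0] ca_of_base)
    qed simp
    finally show "(\<Sum>u\<in>V. E (x - sh u) (x - sh u)) = (\<Sum>u\<in>V. E (- sh u) (- sh u))" by simp
  qed
qed

end

section \<open>The stabilizer code in the basis of words\<close>

lemma op_mult_reindex:
  assumes "bij_betw \<Phi> B L"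
  shows "op_mult B (\<lambda>x y. F (\<Phi> x) (\<Phi> y)) (\<lambda>x y. G (\<Phi> x) (\<Phi> y)) = (\<lambda>x y. op_mult L F G (\<Phi> x) (\<Phi> y))"
  unfolding op_mult_def by (intro ext sum.reindex_bij_betw[OF assms])

text \<open>Both requirements come from \<open>compression_local\<close>: \<open>surj1\<close> lets
  \<open>T\<close> be any set of at most \<open>k\<close> channel positions, for the errors, and
  \<open>surj2\<close> lets \<open>T\<close> be the receiver positions. The dimension is
  \<open>q ^ (n + c)\<close> divided by \<open>card V\<close>, which is
  \<open>q ^ \<kappa>\<close>.\<close>

lemma (in square_order_field) EAQECC_if_self_orthogonal:
  fixes V :: "'v::ab_group_add set" and e :: "nat \<Rightarrow> 'v \<Rightarrow> 'a" and w :: "nat \<Rightarrow> 'a"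
  assumes V: "finite V" "add_subgroup V" and V_card: "card V = q ^ (2 * k)"
    and e_add: "\<And>j u v. j < n + c \<Longrightarrow> u \<in> V \<Longrightarrow> v \<in> V \<Longrightarrow> e j (u + v) = e j u + e j v"
    and w: "\<And>j. j < n + c \<Longrightarrow> w j \<in> base" "\<And>j. j < n + c \<Longrightarrow> w j \<noteq> 0"
    and ortho: "\<And>u v. u \<in> V \<Longrightarrow> v \<in> V \<Longrightarrow> (\<Sum>j<n + c. w j * e j u * e j v ^ q) = 0"
    and inj: "\<And>u. u \<in> V \<Longrightarrow> (\<And>j. j < n \<Longrightarrow> e j u = 0) \<Longrightarrow> u = 0"
    and surj1: "\<And>T t. T \<subseteq> {..<n} \<Longrightarrow> card T \<le> k \<Longrightarrow> \<exists>u\<in>V. \<forall>j\<in>T. e j u = t j"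
    and surj2: "\<And>t. \<exists>u\<in>V. \<forall>j\<in>{n..<n + c}. e j u = t j"
    and \<kappa>: "\<kappa> + 2 * k = n + c"
  shows "EAQECC q n \<kappa> (k + 1) c"
proof -
  obtain \<omega> where \<omega>: "\<omega> \<notin> base" using not_base_exists by blast
  obtain \<chi> :: "'a \<Rightarrow> complex" where \<chi>: "\<And>x. norm (\<chi> x) = 1" "\<And>x y. \<chi> (x + y) = \<chi> x * \<chi> y" "\<chi> 1 \<noteq> 1"
    using nontrivial_additive_character by blast
  define M where "M = n + c"
  interpret self_orthogonal_system q field_type V M e w \<omega> \<chi>
    by unfold_locales (use V e_add w ortho inj \<omega> \<chi> in \<open>auto simp: M_def\<close>)
  obtain \<theta> where \<theta>: "weyl_system V L sh ph \<theta>" using weyl_system_exists by blast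
  interpret weyl_system V L sh ph \<theta> by (rule \<theta>)
  define P where "P = weyl_system.code_projector V L sh ph \<theta>"
  note compression = compression_local[OF \<theta>, folded P_def]
  obtain \<rho> where \<rho>: "bij_betw \<rho> {..<q} base"
    using finite_same_card_bij[of "{..<q}" base] card_base by auto
  define B where "B = words q n \<times> words q c"
  define \<Phi> where "\<Phi> = (\<lambda>(y, b) j. if j < n then \<rho> (y ! j) else if j < M then \<rho> (b ! (j - n)) else 0)"
  have \<Phi>: "bij_betw \<Phi> B L" unfolding B_def \<Phi>_def by (rule L_bij[OF \<rho> M_def])
  have \<Phi>L: "\<Phi> x \<in> L" if "x \<in> B" for x using bij_betwE[OF \<Phi>] that by blast
  have \<rho>_eq: "\<rho> r = \<rho> s \<longleftrightarrow> r = s" if "r < q" "s < q" for r s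
    using \<rho> that by (auto simp: bij_betw_def inj_on_def)
  have word_nth: "y ! j < q" if "y \<in> words q l" "j < l" for y j l
    using that nth_mem by (fastforce simp: words_def)
  have word_len: "length y = l" if "y \<in> words q l" for y l using that by (simp add: words_def)
  have \<Phi>_fst: "\<Phi> (y, b) j = \<Phi> (y', b') j \<longleftrightarrow> y ! j = y' ! j"
    if "y \<in> words q n" "y' \<in> words q n" "j < n" for y b y' b' j
    using that by (simp add: \<Phi>_def \<rho>_eq word_nth)
  have \<Phi>_snd: "\<Phi> (y, b) (n + j) = \<Phi> (y', b') (n + j) \<longleftrightarrow> b ! j = b' ! j"
    if "b \<in> words q c" "b' \<in> words q c" "j < c" for y b y' b' j
    using that by (simp add: \<Phi>_def M_def \<rho>_eq word_nth)
  have words_eq: "y = y' \<longleftrightarrow> (\<forall>j<l. y ! j = y' ! j)" if "y \<in> words q l" "y' \<in> words q l" for y y' l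
    using that by (auto simp: words_def list_eq_iff_nth_eq)
  have snd_eqI: "b = b'"
    if "b \<in> words q c" "b' \<in> words q c" "\<And>j. j < c \<Longrightarrow> \<Phi> (y, b) (n + j) = \<Phi> (y', b') (n + j)" for y b y' b'
    using that \<Phi>_snd[OF that(1,2)] words_eq[OF that(1,2)] by blast
  have nths_eqI: "nths y I = nths y' I"
    if "y \<in> words q n" "y' \<in> words q n" "\<And>j. j < n \<Longrightarrow> j \<in> I \<Longrightarrow> \<Phi> (y, b) j = \<Phi> (y', b') j" for y b y' b' I
    using that \<Phi>_fst[OF that(1,2)] word_len[OF that(1)] word_len[OF that(2)]
    by (subst nths_eq_iff) auto
  \<comment> \<open>Carries \<open>compression_local\<close> over to pairs of words;
    \<open>off\<close> and \<open>on\<close> restate \<open>local_on\<close> through the relabelling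
    \<open>\<Phi>\<close>.\<close>
  have transfer: "op_mult B (\<lambda>x y. P (\<Phi> x) (\<Phi> y)) (op_mult B F (\<lambda>x y. P (\<Phi> x) (\<Phi> y))) x y
      = (\<Sum>z\<in>B. F z z) / of_nat (q ^ M) * P (\<Phi> x) (\<Phi> y)"
    if T: "T \<subseteq> {..<M}" "\<And>t. \<exists>u\<in>V. \<forall>j\<in>T. e j u = t j" and xy: "x \<in> B" "y \<in> B"
      and off: "\<And>x y j. x \<in> B \<Longrightarrow> y \<in> B \<Longrightarrow> j < M \<Longrightarrow> j \<notin> T \<Longrightarrow> \<Phi> x j \<noteq> \<Phi> y j \<Longrightarrow> F x y = 0"
      and on: "\<And>x y x' y'. x \<in> B \<Longrightarrow> y \<in> B \<Longrightarrow> x' \<in> B \<Longrightarrow> y' \<in> B \<Longrightarrow>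
        (\<And>j. j \<in> T \<Longrightarrow> \<Phi> x j = \<Phi> x' j \<and> \<Phi> y j = \<Phi> y' j) \<Longrightarrow>
        (\<And>j. j < M \<Longrightarrow> j \<notin> T \<Longrightarrow> \<Phi> x j = \<Phi> y j \<and> \<Phi> x' j = \<Phi> y' j) \<Longrightarrow> F x y = F x' y'"
    for T F x y
  proof -
    define \<Psi> where "\<Psi> = the_inv_into B \<Phi>"
    have \<Psi>: "\<Psi> (\<Phi> x) = x" if "x \<in> B" for x
      using that bij_betw_imp_inj_on[OF \<Phi>] by (simp add: \<Psi>_def the_inv_into_f_f)
    have \<Psi>': "\<Psi> x \<in> B" "\<Phi> (\<Psi> x) = x" if "x \<in> L" for x
      using that bij_betwE[OF bij_betw_the_inv_into[OF \<Phi>]] f_the_inv_into_f_bij_betw[OF \<Phi>]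
      by (auto simp: \<Psi>_def)
    define E where "E x y = F (\<Psi> x) (\<Psi> y)" for x y
    have "local_on M L T E"
      unfolding local_on_def
    proof (intro conjI ballI impI)
      fix x y assume "x \<in> L" "y \<in> L" "\<exists>j<M. j \<notin> T \<and> x j \<noteq> y j"
      then obtain j where "j < M" "j \<notin> T" "x j \<noteq> y j" by blast
      thus "E x y = 0" unfolding E_def using \<open>x \<in> L\<close> \<open>y \<in> L\<close> by (intro off[of _ _ j]) (simp_all add: \<Psi>')
    next
      fix x y x' y' assume L: "x \<in> L" "y \<in> L" "x' \<in> L" "y' \<in> L"
        and "\<forall>j\<in>T. x j = x' j \<and> y j = y' j" "\<forall>j<M. j \<notin> T \<longrightarrow> x j = y j \<and> x' j = y' j"
      thus "E x y = E x' y'" unfolding E_def by (intro on) (simp_all add: \<Psi>')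
    qed
    note comp = compression[OF T this \<Phi>L[OF xy(1)] \<Phi>L[OF xy(2)]]
    have "op_mult B (\<lambda>x y. P (\<Phi> x) (\<Phi> y)) (op_mult B F (\<lambda>x y. P (\<Phi> x) (\<Phi> y))) x y
        = op_mult B (\<lambda>x y. P (\<Phi> x) (\<Phi> y)) (op_mult B (\<lambda>x y. E (\<Phi> x) (\<Phi> y)) (\<lambda>x y. P (\<Phi> x) (\<Phi> y))) x y"
      by (intro op_mult_cong refl) (simp add: E_def \<Psi>)
    also have "\<dots> = op_mult L P (op_mult L E P) (\<Phi> x) (\<Phi> y)"
      by (simp add: op_mult_reindex[OF \<Phi>])
    also have "\<dots> = (\<Sum>z\<in>L. E z z) / of_nat (q ^ M) * P (\<Phi> x) (\<Phi> y)" by (rule comp)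
    also have "(\<Sum>z\<in>L. E z z) = (\<Sum>z\<in>B. E (\<Phi> z) (\<Phi> z))"
      by (rule sum.reindex_bij_betw[OF \<Phi>, symmetric])
    also have "\<dots> = (\<Sum>z\<in>B. F z z)" by (intro sum.cong) (simp_all add: E_def \<Psi>)
    finally show ?thesis .
  qed
  show ?thesis
  proof (rule EAQECC_if_projector[where P = "\<lambda>x y. P (\<Phi> x) (\<Phi> y)"
          and q = q and n = n and c = c, folded B_def])
    show "q > 0" by (rule q_gt_0)
    show "P (\<Phi> y) (\<Phi> x) = cnj (P (\<Phi> x) (\<Phi> y))" if "x \<in> B" "y \<in> B" for x y
      unfolding P_def by (rule code_projector_cnj[OF \<Phi>L[OF that(1)] \<Phi>L[OF that(2)]])
    show "op_mult B (\<lambda>x y. P (\<Phi> x) (\<Phi> y)) (\<lambda>x y. P (\<Phi> x) (\<Phi> y)) x y = P (\<Phi> x) (\<Phi> y)" for x y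
      by (simp add: op_mult_reindex[OF \<Phi>] P_def code_projector_idem)
    have "(\<Sum>x\<in>B. P (\<Phi> x) (\<Phi> x)) = (\<Sum>x\<in>L. P x x)" by (rule sum.reindex_bij_betw[OF \<Phi>])
    also have "\<dots> = of_nat (card L) / of_nat (card V)"
      unfolding P_def by (rule code_projector_trace[OF faithful])
    also have "\<dots> = of_nat (q ^ \<kappa>)"
    proof -
      have "card L = q ^ \<kappa> * q ^ (2 * k)" unfolding card_L by (metis M_def \<kappa> power_add)
      thus ?thesis using q_gt_0 by (simp add: V_card)
    qed
    finally show "(\<Sum>x\<in>B. P (\<Phi> x) (\<Phi> x)) = of_nat (q ^ \<kappa>)" .
  next
    fix b b' x y assume b: "b \<in> words q c" "b' \<in> words q c" and xy: "x \<in> B" "y \<in> B"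
    let ?F = "receiver_unit b b'"
    have "op_mult B (\<lambda>x y. P (\<Phi> x) (\<Phi> y)) (op_mult B ?F (\<lambda>x y. P (\<Phi> x) (\<Phi> y))) x y
      = (\<Sum>z\<in>B. ?F z z) / of_nat (q ^ M) * P (\<Phi> x) (\<Phi> y)"
    proof (rule transfer[OF _ _ xy])
      show "{n..<M} \<subseteq> {..<M}" by auto
      show "\<exists>u\<in>V. \<forall>j\<in>{n..<M}. e j u = t j" for t using surj2 unfolding M_def .
    next
      fix x y j assume "x \<in> B" "y \<in> B" "j < M" "j \<notin> {n..<M}" "\<Phi> x j \<noteq> \<Phi> y j"
      thus "?F x y = 0" using \<Phi>_fst by (auto simp: B_def receiver_unit_def)
    next
      fix x y x' y' assume B: "x \<in> B" "y \<in> B" "x' \<in> B" "y' \<in> B"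
        and T: "\<And>j. j \<in> {n..<M} \<Longrightarrow> \<Phi> x j = \<Phi> x' j \<and> \<Phi> y j = \<Phi> y' j"
        and nT: "\<And>j. j < M \<Longrightarrow> j \<notin> {n..<M} \<Longrightarrow> \<Phi> x j = \<Phi> y j \<and> \<Phi> x' j = \<Phi> y' j"
      obtain x1 x2 y1 y2 x1' x2' y1' y2' where xs: "x = (x1, x2)" "y = (y1, y2)" "x' = (x1', x2')" "y' = (y1', y2')"
        by fastforce
      have "x1 = y1" "x1' = y1'" using B nT \<Phi>_fst xs by (auto simp: B_def M_def words_eq[of _ n])
      moreover have "x2 = x2'" "y2 = y2'"
        using B T xs by (auto simp: B_def M_def intro!: snd_eqI[of x2 x2' x1 x1'] snd_eqI[of y2 y2' y1 y1'])
      ultimately show "?F x y = ?F x' y'" by (simp add: xs receiver_unit_def)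
    qed
    \<comment> \<open>The trace is \<open>q ^ n\<close> if \<open>b = b'\<close> and 0 otherwise;
      division by \<open>q ^ (n + c)\<close> gives the maximally mixed value.\<close>
    also have "(\<Sum>z\<in>B. ?F z z) = (\<Sum>y\<in>words q n. \<Sum>\<beta>\<in>words q c. if \<beta> = b then of_bool (b = b') else 0)"
      unfolding B_def sum.cartesian_product' by (intro sum.cong) (auto simp: receiver_unit_def)
    also have "\<dots> = of_nat (q ^ n) * of_bool (b = b')" using b by (simp add: finite_words card_words)
    also have "of_nat (q ^ n) * of_bool (b = b') / of_nat (q ^ M) = (of_bool (b = b') / of_nat (q ^ c) :: complex)"
      using q_gt_0 by (simp add: M_def power_add)
    finally show "op_mult B (\<lambda>x y. P (\<Phi> x) (\<Phi> y)) (op_mult B ?F (\<lambda>x y. P (\<Phi> x) (\<Phi> y))) x y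
      = of_bool (b = b') / of_nat (q ^ c) * P (\<Phi> x) (\<Phi> y)" .
  next
    fix E S assume S: "S \<subseteq> {..<n}" "card S < k + 1" and "supported_on q n S E"
    then obtain A where A: "\<And>x y. x \<in> words q n \<Longrightarrow> y \<in> words q n \<Longrightarrow>
        E x y = A (nths x S) (nths y S) * of_bool (nths x (- S) = nths y (- S))"
      unfolding supported_on_def by blast
    let ?F = "extend_error E"
    show "detects B (\<lambda>x y. P (\<Phi> x) (\<Phi> y)) ?F"
      unfolding detects_def
    proof (rule exI[of _ "(\<Sum>z\<in>B. ?F z z) / of_nat (q ^ M)"], intro ballI)
      fix x y assume xy: "x \<in> B" "y \<in> B"
      show "op_mult B (\<lambda>x y. P (\<Phi> x) (\<Phi> y)) (op_mult B ?F (\<lambda>x y. P (\<Phi> x) (\<Phi> y))) x y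
        = (\<Sum>z\<in>B. ?F z z) / of_nat (q ^ M) * P (\<Phi> x) (\<Phi> y)"
      proof (rule transfer[OF _ _ xy])
        show "S \<subseteq> {..<M}" using S by (auto simp: M_def)
        show "\<exists>u\<in>V. \<forall>j\<in>S. e j u = t j" for t using surj1 S by simp
      next
        fix x y j assume B: "x \<in> B" "y \<in> B" and j: "j < M" "j \<notin> S" "\<Phi> x j \<noteq> \<Phi> y j"
        obtain x1 x2 y1 y2 where xs: "x = (x1, x2)" "y = (y1, y2)" by fastforce
        show "?F x y = 0"
        proof (cases "j < n")
          case True
          hence "x1 ! j \<noteq> y1 ! j" using B j \<Phi>_fst by (auto simp: B_def xs)
          hence "nths x1 (- S) \<noteq> nths y1 (- S)"
            using B j True by (auto simp: B_def xs nths_eq_iff word_len[of _ n])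
          thus ?thesis using B A by (simp add: B_def xs extend_error_def)
        next
          case False
          hence "x2 ! (j - n) \<noteq> y2 ! (j - n)"
            using B j \<Phi>_snd[of x2 y2 "j - n" x1 y1] by (auto simp: B_def xs M_def)
          thus ?thesis by (auto simp: xs extend_error_def)
        qed
      next
        fix x y x' y' assume B: "x \<in> B" "y \<in> B" "x' \<in> B" "y' \<in> B"
          and T: "\<And>j. j \<in> S \<Longrightarrow> \<Phi> x j = \<Phi> x' j \<and> \<Phi> y j = \<Phi> y' j"
          and nT: "\<And>j. j < M \<Longrightarrow> j \<notin> S \<Longrightarrow> \<Phi> x j = \<Phi> y j \<and> \<Phi> x' j = \<Phi> y' j"
        obtain x1 x2 y1 y2 x1' x2' y1' y2' where xs: "x = (x1, x2)" "y = (y1, y2)" "x' = (x1', x2')" "y' = (y1', y2')"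
          by fastforce
        have "n + j < M" "n + j \<notin> S" if "j < c" for j
          using S(1) that by (auto simp: M_def)
        hence "x2 = y2" "x2' = y2'"
          using B nT xs by (auto simp: B_def intro!: snd_eqI[of x2 y2 x1 y1] snd_eqI[of x2' y2' x1' y1'])
        moreover have "nths x1 S = nths x1' S" "nths y1 S = nths y1' S"
          using B T xs by (auto simp: B_def intro!: nths_eqI[of x1 x1' S x2 x2'] nths_eqI[of y1 y1' S y2 y2'])
        moreover have "nths x1 (- S) = nths y1 (- S)" "nths x1' (- S) = nths y1' (- S)"
          using B nT xs
          by (auto simp: B_def M_def intro!: nths_eqI[of x1 y1 "- S" x2 y2] nths_eqI[of x1' y1' "- S" x2' y2'])
        ultimately show "?F x y = ?F x' y'" using B A by (simp add: B_def xs extend_error_def)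
      qed
    qed
  qed
qed

section \<open>Hermitian forms and their radicals\<close>

locale hermitian_space = square_order_field q field_type
  for q and field_type :: "'a::{field,finite} itself" +
  fixes V :: "'v::ab_group_add set" and scale :: "'a \<Rightarrow> 'v \<Rightarrow> 'v"
  assumes V: "finite V" "add_subgroup V" and V_scale: "\<And>a u. u \<in> V \<Longrightarrow> scale a u \<in> V"
begin

definition lin :: "('v \<Rightarrow> 'a) \<Rightarrow> bool" where
  "lin e \<longleftrightarrow> (\<forall>u\<in>V. \<forall>v\<in>V. e (u + v) = e u + e v) \<and> (\<forall>a. \<forall>u\<in>V. e (scale a u) = a * e u)"

definition hermitian :: "('v \<Rightarrow> 'v \<Rightarrow> 'a) \<Rightarrow> bool" where
  "hermitian h \<longleftrightarrow> (\<forall>v\<in>V. lin (\<lambda>u. h u v)) \<and> (\<forall>u\<in>V. \<forall>v\<in>V. h v u = h u v ^ q)"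

definition diag_form :: "nat \<Rightarrow> (nat \<Rightarrow> 'a) \<Rightarrow> (nat \<Rightarrow> 'v \<Rightarrow> 'a) \<Rightarrow> 'v \<Rightarrow> 'v \<Rightarrow> 'a" where
  "diag_form n w e u v = (\<Sum>j<n. w j * e j u * e j v ^ q)"

definition radical :: "('v \<Rightarrow> 'v \<Rightarrow> 'a) \<Rightarrow> 'v set" where
  "radical h = {u\<in>V. \<forall>v\<in>V. h u v = 0}"

text \<open>For functionals in \<open>lin\<close> and finite \<open>T\<close> this is linear
  independence, in the form in which it gets used.\<close>

definition jointly_surj :: "nat set \<Rightarrow> (nat \<Rightarrow> 'v \<Rightarrow> 'a) \<Rightarrow> bool" where
  "jointly_surj T e \<longleftrightarrow> (\<forall>t. \<exists>u\<in>V. \<forall>j\<in>T. e j u = t j)"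

definition admissible :: "nat \<Rightarrow> (nat \<Rightarrow> 'a) \<Rightarrow> bool" where
  "admissible n w \<longleftrightarrow> (\<forall>j<n. w j \<in> base \<and> w j \<noteq> 0)"

lemma V0: "0 \<in> V" and V_add: "u \<in> V \<Longrightarrow> v \<in> V \<Longrightarrow> u + v \<in> V"
  using add_subgroup_zero[OF V(2)] add_subgroup_add[OF V(2)] by simp_all

lemma lin_add: "lin e \<Longrightarrow> u \<in> V \<Longrightarrow> v \<in> V \<Longrightarrow> e (u + v) = e u + e v"
  and lin_scale: "lin e \<Longrightarrow> u \<in> V \<Longrightarrow> e (scale a u) = a * e u"
  by (simp_all add: lin_def)

lemma lin_zero: "lin e \<Longrightarrow> e 0 = 0"
  using lin_add[of e 0 0] V0 by (metis add.right_neutral add_left_cancel)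

lemma lin_diff: "lin e \<Longrightarrow> u \<in> V \<Longrightarrow> v \<in> V \<Longrightarrow> e (u - v) = e u - e v"
  using lin_add[of e "u - v" v] add_subgroup_diff[OF V(2)] by simp

lemma hermitian_lin: "hermitian h \<Longrightarrow> v \<in> V \<Longrightarrow> lin (\<lambda>u. h u v)"
  and hermitian_swap: "hermitian h \<Longrightarrow> u \<in> V \<Longrightarrow> v \<in> V \<Longrightarrow> h v u = h u v ^ q"
  unfolding hermitian_def by blast+

lemma card_field_gt_1: "CARD('a) > 1"
  unfolding card using q_gt_1 by (rule one_less_power) simp

lemma lin_diag_form:
  assumes "\<And>j. j < n \<Longrightarrow> lin (e j)"
  shows "lin (\<lambda>u. diag_form n w e u v)"
  unfolding lin_def diag_form_def
proof (intro conjI ballI allI)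
  fix u u' assume "u \<in> V" "u' \<in> V"
  thus "(\<Sum>j<n. w j * e j (u + u') * e j v ^ q) = (\<Sum>j<n. w j * e j u * e j v ^ q) + (\<Sum>j<n. w j * e j u' * e j v ^ q)"
    by (simp add: lin_add[OF assms] ring_distribs sum.distrib)
next
  fix a u assume "u \<in> V"
  thus "(\<Sum>j<n. w j * e j (scale a u) * e j v ^ q) = a * (\<Sum>j<n. w j * e j u * e j v ^ q)"
    by (simp add: lin_scale[OF assms] sum_distrib_left mult_ac)
qed

lemma hermitian_diag_form:
  assumes "\<And>j. j < n \<Longrightarrow> lin (e j)" "admissible n w"
  shows "hermitian (diag_form n w e)"
  unfolding hermitian_def
proof (intro conjI ballI)
  show "lin (\<lambda>u. diag_form n w e u v)" for v using lin_diag_form assms(1) by blast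
  fix u v assume "u \<in> V" "v \<in> V"
  have "diag_form n w e u v ^ q = (\<Sum>j<n. w j ^ q * e j u ^ q * (e j v ^ q) ^ q)"
    by (simp add: diag_form_def frob_sum power_mult_distrib)
  also have "\<dots> = diag_form n w e v u"
    unfolding diag_form_def using assms(2)
    by (intro sum.cong refl) (simp add: admissible_def base_def frob_frob mult_ac)
  finally show "diag_form n w e v u = diag_form n w e u v ^ q" by simp
qed

section \<open>Radicals and diagonalization\<close>

lemma radical_subgroup:
  assumes "hermitian h"
  shows "add_subgroup (radical h)"
  unfolding add_subgroup_def
proof (intro conjI ballI)
  show "0 \<in> radical h"
    using V0 lin_zero[OF hermitian_lin[OF assms]] by (simp add: radical_def)
  fix u v assume "u \<in> radical h" "v \<in> radical h"
  thus "u - v \<in> radical h"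
    using lin_diff[OF hermitian_lin[OF assms]] add_subgroup_diff[OF V(2)] by (simp add: radical_def)
qed

lemma finite_radical: "finite (radical h)"
  using V(1) by (simp add: radical_def)

text \<open>Vanishing at \<open>u + scale a v\<close> makes \<open>a\<close> a solution of
  \<open>a ^ q * h u v + a * h v u = 0\<close>; if \<open>h u v\<close> is nonzero, at most
  \<open>q\<close> of the \<open>q^2\<close> field elements are solutions. This replaces
  polarization and works in every characteristic.\<close>

lemma hermitian_eq_zero_if_anisotropic_empty:
  assumes h: "hermitian h" and iso: "\<And>u. u \<in> V \<Longrightarrow> h u u = 0" and uv: "u \<in> V" "v \<in> V"
  shows "h u v = 0"
proof (rule ccontr)
  assume nz: "h u v \<noteq> 0"
  have hl: "h (x + scale a y) z = h x z + a * h y z" if "x \<in> V" "y \<in> V" "z \<in> V" for x y z a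
    using lin_add[OF hermitian_lin[OF h that(3)] that(1) V_scale[OF that(2)]]
      lin_scale[OF hermitian_lin[OF h that(3)] that(2)] by simp
  have "a ^ q = (- (h v u / h u v)) * a" for a
  proof -
    let ?x = "u + scale a v"
    have x: "?x \<in> V" using uv V_add V_scale by simp
    have "h u ?x = (a * h v u) ^ q"
      using hermitian_swap[OF h x uv(1)] hl[OF uv uv(1)] iso[OF uv(1)] by simp
    hence "h u ?x = a ^ q * h u v"
      using hermitian_swap[OF h uv(2,1)] by (simp add: power_mult_distrib)
    moreover have "h v ?x = h v u"
      using hermitian_swap[OF h x uv(2)] hl[OF uv uv(2)] iso[OF uv(2)] hermitian_swap[OF h uv] by simp
    moreover have "h ?x ?x = h u ?x + a * h v ?x" using hl[OF uv x] .
    ultimately have "a ^ q * h u v + a * h v u = 0" using iso[OF x] by simp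
    thus ?thesis using nz by (simp add: field_simps eq_neg_iff_add_eq_0)
  qed
  hence "{x::'a. x ^ q = (- (h v u / h u v)) * x} = UNIV" by blast
  hence "CARD('a) \<le> q" using card_frob_eigenspace_le by metis
  thus False using card q_gt_1 by (simp add: power2_eq_square)
qed

text \<open>Pairing \<open>u\<close> with a vector dual to \<open>e j\<close> isolates
  \<open>w j * e j u\<close>.\<close>

lemma diag_form_radical:
  assumes "admissible n w" "jointly_surj {..<n} e" "u \<in> V" "\<And>v. v \<in> V \<Longrightarrow> diag_form n w e u v = 0" "j < n"
  shows "e j u = 0"
proof -
  obtain v where v: "v \<in> V" "\<And>i. i < n \<Longrightarrow> e i v = of_bool (i = j)"
    using assms(2)[unfolded jointly_surj_def, rule_format, of "\<lambda>i. of_bool (i = j)"] by auto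
  have "diag_form n w e u v = (\<Sum>i<n. if i = j then w i * e i u else 0)"
    unfolding diag_form_def using q_gt_0 by (intro sum.cong refl) (auto simp: v(2))
  thus ?thesis using assms v by (simp add: admissible_def)
qed

text \<open>Gram-Schmidt: subtracting a rank-one form built from an anisotropic \<open>u0\<close>
  puts \<open>u0\<close> into the radical and keeps the old radical, so the induction runs on the
  complement of the radical.\<close>

lemma diagonalization:
  assumes "hermitian h"
  shows "\<exists>t w e. (\<forall>j<t. lin (e j)) \<and> admissible t w \<and> jointly_surj {..<t} e \<and>
    (\<forall>u\<in>V. \<forall>v\<in>V. h u v = diag_form t w e u v)"
  using assms
proof (induction "card (V - radical h)" arbitrary: h rule: less_induct)
  case less
  note h = less.prems
  show ?case
  proof (cases "\<exists>u\<in>V. h u u \<noteq> 0")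
    case False
    hence "\<forall>u\<in>V. \<forall>v\<in>V. h u v = 0" using hermitian_eq_zero_if_anisotropic_empty[OF h] by blast
    thus ?thesis
      using V0 by (intro exI[of _ 0]) (auto simp: diag_form_def jointly_surj_def admissible_def)
  next
    case True
    then obtain u0 where u0: "u0 \<in> V" "h u0 u0 \<noteq> 0" by blast
    define l where "l v = h v u0" for v
    define d where "d = inverse (h u0 u0)"
    have d: "d \<in> base" "d \<noteq> 0"
      using hermitian_swap[OF h u0(1) u0(1)] u0 by (auto simp: d_def base_def power_inverse)
    have l: "lin l" unfolding l_def by (rule hermitian_lin[OF h u0(1)])
    define h' where "h' u v = h u v - d * l u * l v ^ q" for u v
    have h': "hermitian h'"
      unfolding hermitian_def
    proof (intro conjI ballI)
      fix v assume v: "v \<in> V"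
      have "lin (\<lambda>u. h u v)" using hermitian_lin[OF h v] .
      thus "lin (\<lambda>u. h' u v)" using l by (auto simp: lin_def h'_def algebra_simps)
    next
      fix u v assume "u \<in> V" "v \<in> V"
      hence "h v u = h u v ^ q" by (rule hermitian_swap[OF h])
      moreover have "(d * l u * l v ^ q) ^ q = d * l v * l u ^ q"
        using d(1) by (simp add: power_mult_distrib frob_frob base_def)
      ultimately show "h' v u = h' u v ^ q" by (simp only: h'_def frob_diff)
    qed
    have "h' u0 v = 0" if "v \<in> V" for v
    proof -
      have "d * l u0 = 1" using u0(2) by (simp add: d_def l_def)
      moreover have "h u0 v = l v ^ q" unfolding l_def by (rule hermitian_swap[OF h that u0(1)])
      ultimately show ?thesis by (simp add: h'_def)
    qed
    hence "u0 \<in> radical h'" using u0(1) by (simp add: radical_def)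
    moreover have "u0 \<notin> radical h" using u0 by (auto simp: radical_def)
    moreover have "radical h \<subseteq> radical h'" using u0 by (auto simp: radical_def h'_def l_def)
    ultimately have "V - radical h' \<subset> V - radical h" using u0 by auto
    hence "card (V - radical h') < card (V - radical h)" using V(1) by (intro psubset_card_mono) auto
    then obtain t w e where e: "\<And>j. j < t \<Longrightarrow> lin (e j)" and w: "admissible t w"
      and surj: "jointly_surj {..<t} e"
      and h'_eq: "\<And>u v. u \<in> V \<Longrightarrow> v \<in> V \<Longrightarrow> h' u v = diag_form t w e u v"
      using less.hyps[OF _ h'] by blast
    \<comment> \<open>The other functionals vanish at \<open>u0\<close> and \<open>l\<close> does
      not; hence \<open>l\<close> can be adjusted along \<open>u0\<close> without disturbing
      them.\<close>
    have e_u0: "e j u0 = 0" if "j < t" for j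
      using diag_form_radical[OF w surj u0(1) _ that] \<open>u0 \<in> radical h'\<close> h'_eq u0(1)
      by (simp add: radical_def)
    let ?e = "\<lambda>j. if j < t then e j else l" and ?w = "\<lambda>j. if j < t then w j else d"
    have "jointly_surj {..<Suc t} ?e"
      unfolding jointly_surj_def
    proof
      fix \<tau> :: "nat \<Rightarrow> 'a"
      obtain v where v: "v \<in> V" "\<And>j. j < t \<Longrightarrow> e j v = \<tau> j"
        using surj unfolding jointly_surj_def by blast
      define u where "u = v + scale (d * (\<tau> t - l v)) u0"
      have "u \<in> V" using v u0 V_add V_scale by (simp add: u_def)
      moreover have "e j u = \<tau> j" if "j < t" for j
        using that v u0 V_scale e_u0 by (simp add: u_def lin_add[OF e] lin_scale[OF e])
      moreover have "l u = \<tau> t"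
      proof -
        have "l u = l v + (d * l u0) * (\<tau> t - l v)"
          using v u0 V_scale by (simp add: u_def lin_add[OF l] lin_scale[OF l] mult_ac)
        moreover have "d * l u0 = 1" using u0 by (simp add: d_def l_def)
        ultimately show ?thesis by simp
      qed
      ultimately show "\<exists>u\<in>V. \<forall>j\<in>{..<Suc t}. ?e j u = \<tau> j"
        by (intro bexI[of _ u]) (auto simp: less_Suc_eq)
    qed
    moreover have "\<forall>j<Suc t. lin (?e j)" using e l by simp
    moreover have "admissible (Suc t) ?w" using w d by (simp add: admissible_def)
    moreover have "\<forall>u\<in>V. \<forall>v\<in>V. h u v = diag_form (Suc t) ?w ?e u v"
    proof (intro ballI)
      fix u v assume "u \<in> V" "v \<in> V"
      hence "h u v = diag_form t w e u v + d * l u * l v ^ q" using h'_eq[of u v] by (simp add: h'_def diff_eq_eq)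
      thus "h u v = diag_form (Suc t) ?w ?e u v" by (simp add: diag_form_def)
    qed
    ultimately show ?thesis by (intro exI[of _ "Suc t"] exI[of _ ?w] exI[of _ ?e] conjI)
  qed
qed

section \<open>Cardinalities of kernels and radicals\<close>

lemma card_joint_kernel:
  assumes "\<And>j. j < t \<Longrightarrow> lin (e j)" "jointly_surj {..<t} e"
  shows "card V = card {u\<in>V. \<forall>j<t. e j u = 0} * CARD('a) ^ t"
  using assms
proof (induction t)
  case (Suc t)
  define W where "W = {u\<in>V. \<forall>j<t. e j u = 0}"
  define W' where "W' = {u\<in>V. \<forall>j<Suc t. e j u = 0}"
  have W_fin: "finite W" using V by (simp add: W_def)
  \<comment> \<open>Every fibre of \<open>e t\<close> on \<open>W\<close> is a translate of
    \<open>W'\<close>; this counting stands in for rank-nullity.\<close>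
  have fib: "card {u\<in>W. e t u = y} = card W'" for y
  proof -
    obtain u0 where u0: "u0 \<in> V" "\<And>j. j < Suc t \<Longrightarrow> e j u0 = (if j = t then y else 0)"
      using Suc.prems(2)[unfolded jointly_surj_def, rule_format, of "\<lambda>j. if j = t then y else 0"] by auto
    have "bij_betw (\<lambda>u. u + u0) W' {u\<in>W. e t u = y}"
    proof (rule bij_betwI[where g = "\<lambda>u. u - u0"])
      show "(\<lambda>u. u + u0) \<in> W' \<rightarrow> {u\<in>W. e t u = y}"
        using u0 Suc.prems(1) by (auto simp: W_def W'_def lin_add V_add)
      show "(\<lambda>u. u - u0) \<in> {u\<in>W. e t u = y} \<rightarrow> W'"
        using u0 Suc.prems(1) add_subgroup_diff[OF V(2)] by (auto simp: W_def W'_def lin_diff less_Suc_eq)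
    qed auto
    thus ?thesis using bij_betw_same_card by metis
  qed
  have "card W = (\<Sum>y\<in>e t ` W. card {u\<in>W. e t u = y})"
    unfolding card_eq_sum by (rule sum.image_gen[OF W_fin])
  moreover have "e t ` W = UNIV"
  proof (intro equalityI subset_UNIV subsetI)
    fix y :: 'a
    obtain u where "u \<in> V" "\<And>j. j < Suc t \<Longrightarrow> e j u = (if j = t then y else 0)"
      using Suc.prems(2)[unfolded jointly_surj_def, rule_format, of "\<lambda>j. if j = t then y else 0"] by auto
    thus "y \<in> e t ` W" by (intro image_eqI[of _ _ u]) (auto simp: W_def)
  qed
  ultimately have "card W = CARD('a) * card W'" by (simp add: fib)
  moreover have "jointly_surj {..<t} e"
    using Suc.prems(2) unfolding jointly_surj_def by (meson lessThan_iff less_SucI)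
  hence "card V = card W * CARD('a) ^ t"
    unfolding W_def using Suc.IH Suc.prems(1) by simp
  ultimately show ?case unfolding W'_def by simp
qed simp

lemma joint_kernel_trivial:
  assumes "\<And>j. j < k \<Longrightarrow> lin (e j)" "jointly_surj {..<k} e" "card V = CARD('a) ^ k"
  shows "{u\<in>V. \<forall>j<k. e j u = 0} = {0}"
proof -
  have "card {u\<in>V. \<forall>j<k. e j u = 0} = 1"
    using card_joint_kernel[OF assms(1,2)] assms(3) card_field_gt_1 by simp
  then obtain z where "{u\<in>V. \<forall>j<k. e j u = 0} = {z}" using card_1_singletonE by blast
  moreover have "0 \<in> {u\<in>V. \<forall>j<k. e j u = 0}" using V0 assms(1) lin_zero by auto
  ultimately show ?thesis by simp
qed

text \<open>The radical is the joint kernel of the functionals, so the number \<open>t\<close> of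
  diagonal terms is the rank.\<close>

lemma card_radical_diag_form:
  assumes "\<And>j. j < t \<Longrightarrow> lin (e j)" "admissible t w" "jointly_surj {..<t} e"
    "\<And>u v. u \<in> V \<Longrightarrow> v \<in> V \<Longrightarrow> h u v = diag_form t w e u v"
  shows "card V = card (radical h) * CARD('a) ^ t"
proof -
  have "radical h = {u\<in>V. \<forall>j<t. e j u = 0}"
  proof (intro equalityI subsetI)
    fix u assume "u \<in> radical h"
    thus "u \<in> {u\<in>V. \<forall>j<t. e j u = 0}"
      using diag_form_radical[OF assms(2,3), of u] assms(4) by (auto simp: radical_def)
  next
    fix u assume "u \<in> {u\<in>V. \<forall>j<t. e j u = 0}"
    thus "u \<in> radical h" using assms(4) by (simp add: radical_def diag_form_def)
  qed
  thus ?thesis using card_joint_kernel[OF assms(1,3)] by simp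
qed

lemma card_radical_power:
  assumes "hermitian h" "card V = CARD('a) ^ k"
  obtains m where "card (radical h) = CARD('a) ^ m"
proof -
  obtain t w e where "\<And>j. j < t \<Longrightarrow> lin (e j)" "admissible t w" "jointly_surj {..<t} e"
      "\<And>u v. u \<in> V \<Longrightarrow> v \<in> V \<Longrightarrow> h u v = diag_form t w e u v"
    using diagonalization[OF assms(1)] by blast
  hence c: "CARD('a) ^ k = card (radical h) * CARD('a) ^ t"
    using card_radical_diag_form assms(2) by metis
  note Q = card_field_gt_1
  have "card (radical h) > 0"
    using finite_radical add_subgroup_zero[OF radical_subgroup[OF assms(1)]] card_gt_0_iff by blast
  hence "CARD('a) ^ t \<le> CARD('a) ^ k" unfolding c by simp
  hence "t \<le> k" using Q by simp
  hence "CARD('a) ^ (k - t) * CARD('a) ^ t = card (radical h) * CARD('a) ^ t"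
    unfolding c[symmetric] by (simp flip: power_add)
  hence "card (radical h) = CARD('a) ^ (k - t)" using Q by simp
  thus ?thesis using that by blast
qed

text \<open>On the kernel of \<open>e\<close> the added term vanishes, so the part of the old
  radical inside that kernel lies in the new one; cutting down to it divides the size by at most the
  number of values of \<open>e\<close>.\<close>

lemma card_radical_rank_one:
  assumes h: "hermitian h" and e: "lin e"
    and h': "\<And>u v. u \<in> V \<Longrightarrow> v \<in> V \<Longrightarrow> h' u v = h u v + d * e u * e v ^ q"
  shows "card (radical h) \<le> CARD('a) * card (radical h')"
proof -
  let ?K = "{u\<in>radical h. e u = 0}"
  have sub: "?K \<subseteq> radical h'" using h' by (auto simp: radical_def)
  have "card {u\<in>radical h. e u = y} \<le> card (radical h')" if "y \<in> e ` radical h" for y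
  proof -
    obtain u0 where u0: "u0 \<in> radical h" "y = e u0" using \<open>y \<in> e ` radical h\<close> by blast
    have RV: "radical h \<subseteq> V" by (auto simp: radical_def)
    have "card {u\<in>radical h. e u = y} \<le> card ?K"
    proof (rule card_inj_on_le[where f = "\<lambda>u. u - u0"])
      show "(\<lambda>u. u - u0) ` {u\<in>radical h. e u = y} \<subseteq> ?K"
        using u0 RV add_subgroup_diff[OF radical_subgroup[OF h]] by (auto simp: lin_diff[OF e] subset_iff)
    qed (auto simp: inj_on_def finite_radical)
    also have "\<dots> \<le> card (radical h')" by (rule card_mono[OF finite_radical sub])
    finally show ?thesis .
  qed
  hence "card (radical h) \<le> card (e ` radical h) * card (radical h')"
    by (intro card_le_card_image_mult finite_radical) auto
  also have "\<dots> \<le> CARD('a) * card (radical h')"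
    by (intro mult_right_mono card_mono) auto
  finally show ?thesis .
qed

section \<open>Choice of the weights\<close>

lemma nondegenerate_weights:
  assumes "q > 2" and k: "k \<le> n" and e: "\<And>j. j < n \<Longrightarrow> lin (e j)"
    and surj: "jointly_surj {..<k} e" and inj: "\<And>u. u \<in> V \<Longrightarrow> (\<And>j. j < k \<Longrightarrow> e j u = 0) \<Longrightarrow> u = 0"
  shows "\<exists>w. admissible n w \<and> radical (diag_form n w e) = {0}"
  using k e
proof (induction n rule: dec_induct)
  case base
  \<comment> \<open>The first \<open>k\<close> functionals separate the points of \<open>V\<close>,
    so weights 1 give a nondegenerate form.\<close>
  have adm: "admissible k (\<lambda>_. 1)" using base_1 by (simp add: admissible_def)
  have "radical (diag_form k (\<lambda>_. 1) e) \<subseteq> {0}"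
    using diag_form_radical[OF adm surj] inj by (auto simp: radical_def)
  moreover have "0 \<in> radical (diag_form k (\<lambda>_. 1) e)"
    by (rule add_subgroup_zero[OF radical_subgroup[OF hermitian_diag_form[OF base adm]]])
  ultimately show ?case using adm by blast
next
  case (step n)
  then obtain w where w: "admissible n w" "radical (diag_form n w e) = {0}" by auto
  obtain d where d: "d \<in> base" "d \<noteq> 0" "d \<noteq> 1"
  proof -
    have "\<not> base \<subseteq> {0, 1}"
    proof
      assume "base \<subseteq> {0, 1}"
      hence "card base \<le> card {0, 1 :: 'a}" by (intro card_mono) auto
      thus False using card_base \<open>q > 2\<close> by simp
    qed
    thus ?thesis using that by blast
  qed
  define h where "h = diag_form n w e"
  have hl: "lin (\<lambda>u. h u v)" for v unfolding h_def by (rule lin_diag_form) (use step in simp)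
  have en: "lin (e n)" using step.prems by simp
  have adm: "admissible (Suc n) (w(n := c))" if "c \<in> base" "c \<noteq> 0" for c
    using w that by (simp add: admissible_def)
  have form: "diag_form (Suc n) (w(n := c)) e u v = h u v + c * e n u * e n v ^ q" for c u v
    by (simp add: diag_form_def h_def)
  \<comment> \<open>A vector in the radical for the weight \<open>c\<close> represents a multiple of
    the last functional under \<open>h\<close>; \<open>e n x\<close> cannot vanish because
    \<open>h\<close> is nondegenerate.\<close>
  have bad: "\<exists>x\<in>V. e n x \<noteq> 0 \<and> (\<forall>v\<in>V. h x v = - c * e n x * e n v ^ q)"
    if c: "c \<in> base" "c \<noteq> 0" and ne: "radical (diag_form (Suc n) (w(n := c)) e) \<noteq> {0}" for c
  proof -
    have "0 \<in> radical (diag_form (Suc n) (w(n := c)) e)"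
      by (rule add_subgroup_zero[OF radical_subgroup[OF hermitian_diag_form[OF step.prems adm[OF c]]]])
    then obtain x where x: "x \<in> radical (diag_form (Suc n) (w(n := c)) e)" "x \<noteq> 0" using ne by blast
    hence xV: "x \<in> V" and hx: "\<And>v. v \<in> V \<Longrightarrow> h x v = - c * e n x * e n v ^ q"
      by (auto simp: radical_def form eq_neg_iff_add_eq_0)
    moreover have "e n x \<noteq> 0"
    proof
      assume "e n x = 0"
      hence "x \<in> radical (diag_form n w e)" using xV hx by (simp add: radical_def h_def)
      thus False using w(2) x(2) by simp
    qed
    ultimately show ?thesis by blast
  qed
  have "radical (diag_form (Suc n) (w(n := 1)) e) = {0} \<or> radical (diag_form (Suc n) (w(n := d)) e) = {0}"
  proof (rule ccontr)
    assume "\<not> ?thesis"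
    then obtain x y where x: "x \<in> V" "e n x \<noteq> 0" "\<And>v. v \<in> V \<Longrightarrow> h x v = - 1 * e n x * e n v ^ q"
      and y: "y \<in> V" "e n y \<noteq> 0" "\<And>v. v \<in> V \<Longrightarrow> h y v = - d * e n y * e n v ^ q"
      using bad[OF base_1 one_neq_zero] bad[OF d(1,2)] by blast
    \<comment> \<open>The coefficients cancel the two rank-one expressions, so \<open>z\<close> lies
      in the radical of \<open>h\<close> and is zero; yet its value under \<open>e n\<close> is
      \<open>(d - 1) * e n x * e n y\<close>.\<close>
    define z where "z = scale (d * e n y) x + scale (- e n x) y"
    have z: "z \<in> V" using x y V_add V_scale by (simp add: z_def)
    have "h z v = 0" if "v \<in> V" for v
      using x y that V_scale by (simp add: z_def lin_add[OF hl] lin_scale[OF hl])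
    hence "z \<in> radical (diag_form n w e)" using z by (simp add: radical_def h_def)
    hence "z = 0" using w(2) by simp
    hence "e n z = 0" using lin_zero[OF en] by simp
    hence "d * e n y * e n x - e n x * e n y = 0"
      using x y V_scale by (simp add: z_def lin_add[OF en] lin_scale[OF en])
    hence "(d - 1) * (e n x * e n y) = 0" by (simp add: algebra_simps)
    thus False using d x y by simp
  qed
  thus ?case using adm[OF base_1 one_neq_zero] adm[OF d(1,2)] by blast
qed

text \<open>Moving from one admissible weight vector to another one coordinate at a time, the dimension of
  the radical takes all intermediate values.\<close>
lemma weights_with_radical:
  assumes "q > 2" and k: "k \<le> n" "card V = CARD('a) ^ k" and e: "\<And>j. j < n \<Longrightarrow> lin (e j)"
    and surj: "jointly_surj {..<k} e"
    and w0: "admissible n w0" "card (radical (diag_form n w0 e)) \<ge> CARD('a) ^ s"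
  shows "\<exists>w. admissible n w \<and> card (radical (diag_form n w e)) = CARD('a) ^ s"
proof -
  note Q = card_field_gt_1
  have "{u\<in>V. \<forall>j<k. e j u = 0} = {0}" using joint_kernel_trivial[OF _ surj k(2)] e k by simp
  hence inj: "u = 0" if "u \<in> V" "\<And>j. j < k \<Longrightarrow> e j u = 0" for u
  proof -
    have "u \<in> {u\<in>V. \<forall>j<k. e j u = 0}" using that by simp
    thus ?thesis using \<open>{u\<in>V. \<forall>j<k. e j u = 0} = {0}\<close> by simp
  qed
  obtain w1 where w1: "admissible n w1" "radical (diag_form n w1 e) = {0}"
    using nondegenerate_weights[OF assms(1) k(1) e surj inj] by blast
  \<comment> \<open>Interpolates from the nondegenerate \<open>w1\<close> at \<open>m = 0\<close> to
    the given \<open>w0\<close> at \<open>m = n\<close>.\<close>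
  define W where "W m = (\<lambda>j. if j < m then w0 j else w1 j)" for m
  have W: "admissible n (W m)" for m using w0 w1 by (simp add: W_def admissible_def)
  have herm: "hermitian (diag_form n (W m) e)" for m by (rule hermitian_diag_form[OF e W])
  have "\<exists>r. card (radical (diag_form n (W m) e)) = CARD('a) ^ r" for m
    by (rule card_radical_power[OF herm[of m] k(2)]) blast
  then obtain f where f: "\<And>m. card (radical (diag_form n (W m) e)) = CARD('a) ^ f m" by metis
  have step: "f m \<le> f (Suc m) + 1 \<and> f (Suc m) \<le> f m + 1" if m: "m < n" for m
  proof -
    have split: "diag_form n (W m') e u v = (\<Sum>j\<in>{..<n}-{m}. W m' j * e j u * e j v ^ q) + W m' m * e m u * e m v ^ q"
      for m' u v unfolding diag_form_def using m by (subst sum.remove[of _ m]) (simp_all add: add.commute)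
    have rest: "(\<Sum>j\<in>{..<n}-{m}. W (Suc m) j * e j u * e j v ^ q) = (\<Sum>j\<in>{..<n}-{m}. W m j * e j u * e j v ^ q)" for u v
      by (intro sum.cong refl) (auto simp: W_def less_Suc_eq)
    \<comment> \<open>The change is a rank-one term in either direction, which bounds the exponent
      both ways.\<close>
    have 1: "diag_form n (W (Suc m)) e u v = diag_form n (W m) e u v + (W (Suc m) m - W m m) * e m u * e m v ^ q"
      and 2: "diag_form n (W m) e u v = diag_form n (W (Suc m)) e u v + (W m m - W (Suc m) m) * e m u * e m v ^ q" for u v
      unfolding split rest by (simp_all add: algebra_simps)
    have "CARD('a) ^ f m \<le> CARD('a) ^ (f (Suc m) + 1)" "CARD('a) ^ f (Suc m) \<le> CARD('a) ^ (f m + 1)"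
      using card_radical_rank_one[OF herm e[OF m] 1] card_radical_rank_one[OF herm e[OF m] 2] by (simp_all add: f)
    thus ?thesis using power_le_imp_le_exp[OF Q] by blast
  qed
  have "\<exists>m\<le>n. int (f m) = int s"
  proof (rule nat0_intermed_int_val)
    show "\<forall>i<n. \<bar>int (f (i + 1)) - int (f i)\<bar> \<le> 1" using step by force
    have "diag_form n (W 0) e = diag_form n w1 e" by (simp add: W_def)
    hence "CARD('a) ^ f 0 = 1" using f[of 0] w1(2) by simp
    thus "int (f 0) \<le> int s" using Q by simp
    have "diag_form n (W n) e = diag_form n w0 e"
      unfolding diag_form_def W_def by (intro ext sum.cong) auto
    hence "CARD('a) ^ s \<le> CARD('a) ^ f n" using f[of n] w0(2) by simp
    thus "int s \<le> int (f n)" using Q by simp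
  qed
  thus ?thesis using W f by (metis of_nat_eq_iff)
qed

text \<open>The form is completed to zero by the negatives of the terms of its diagonalization; the added
  coordinates become the receiver halves.\<close>
lemma EAQECC_if_radical:
  assumes k: "k \<le> n" "card V = CARD('a) ^ k" and e: "\<And>j. j < n \<Longrightarrow> lin (e j)"
    and surj: "\<And>T. T \<subseteq> {..<n} \<Longrightarrow> card T \<le> k \<Longrightarrow> jointly_surj T e"
    and w: "admissible n w" "card (radical (diag_form n w e)) = CARD('a) ^ s"
    and \<kappa>: "\<kappa> + k + s = n"
  shows "EAQECC q n \<kappa> (k + 1) (k - s)"
proof -
  have herm: "hermitian (diag_form n w e)" by (rule hermitian_diag_form[OF e w(1)])
  obtain t d l where l: "\<And>j. j < t \<Longrightarrow> lin (l j)" and d: "admissible t d" and ls: "jointly_surj {..<t} l"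
    and eq: "\<And>u v. u \<in> V \<Longrightarrow> v \<in> V \<Longrightarrow> diag_form n w e u v = diag_form t d l u v"
    using diagonalization[OF herm] by blast
  \<comment> \<open>The rank \<open>t\<close> is \<open>k - s\<close>, so the appended coordinates
    match the number of entangled pairs.\<close>
  have "CARD('a) ^ k = CARD('a) ^ (s + t)"
    using card_radical_diag_form[OF l d ls eq] k(2) w(2) by (simp add: power_add)
  hence kst: "k = s + t" using card_field_gt_1 by simp
  have surjk: "jointly_surj {..<k} e" using surj[of "{..<k}"] k by auto
  have ker: "{u\<in>V. \<forall>j<k. e j u = 0} = {0}" using joint_kernel_trivial[OF _ surjk k(2)] e k by simp
  define e' where "e' j = (if j < n then e j else l (j - n))" for j
  define w' where "w' j = (if j < n then w j else - d (j - n))" for j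
  have e'_lin: "lin (e' j)" if "j < n + t" for j using that e l by (auto simp: e'_def)
  have "EAQECC q n \<kappa> (k + 1) t"
  proof (rule EAQECC_if_self_orthogonal[of V k n t e' w'])
    show "card V = q ^ (2 * k)" using k card by (simp add: power_mult)
    show "w' j \<in> base" "w' j \<noteq> 0" if "j < n + t" for j
      using that w d by (auto simp: w'_def admissible_def base_minus)
    show "e' j (u + v) = e' j u + e' j v" if "j < n + t" "u \<in> V" "v \<in> V" for j u v
      using lin_add[OF e'_lin[OF that(1)] that(2,3)] .
    show "(\<Sum>j<n + t. w' j * e' j u * e' j v ^ q) = 0" if "u \<in> V" "v \<in> V" for u v
    proof -
      have "(\<Sum>j<n + t. f j) = (\<Sum>j<n. f j) + (\<Sum>j<t. f (n + j))" for f :: "nat \<Rightarrow> 'a"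
        by (induction t) (simp_all add: add.assoc)
      hence "(\<Sum>j<n + t. w' j * e' j u * e' j v ^ q) = diag_form n w e u v - diag_form t d l u v"
        by (simp add: w'_def e'_def diag_form_def sum_negf)
      thus ?thesis using eq that by simp
    qed
    show "u = 0" if "u \<in> V" "\<And>j. j < n \<Longrightarrow> e' j u = 0" for u
    proof -
      have "e j u = 0" if "j < k" for j using \<open>\<And>j. j < n \<Longrightarrow> e' j u = 0\<close>[of j] that k by (simp add: e'_def)
      hence "u \<in> {u\<in>V. \<forall>j<k. e j u = 0}" using that by simp
      thus ?thesis using ker by simp
    qed
    show "\<exists>u\<in>V. \<forall>j\<in>T. e' j u = \<tau> j" if T: "T \<subseteq> {..<n}" "card T \<le> k" for T \<tau>
    proof -
      obtain u where "u \<in> V" "\<forall>j\<in>T. e j u = \<tau> j" using surj[OF T] unfolding jointly_surj_def by blast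
      thus ?thesis using T by (intro bexI[of _ u]) (auto simp: e'_def)
    qed
    show "\<exists>u\<in>V. \<forall>j\<in>{n..<n + t}. e' j u = \<tau> j" for \<tau>
    proof -
      obtain u where "u \<in> V" "\<forall>j\<in>{..<t}. l j u = \<tau> (n + j)"
        using ls[unfolded jointly_surj_def, rule_format, of "\<lambda>j. \<tau> (n + j)"] by blast
      thus ?thesis by (intro bexI[of _ u]) (auto simp: e'_def)
    qed
    show "\<kappa> + 2 * k = n + t" using \<kappa> kst by simp
  qed (use V in auto)
  thus ?thesis using kst by simp
qed

end

section \<open>Extended generalized Reed-Solomon codes\<close>

text \<open>Coordinates in a basis are unique, so vectors are counted by coordinate functions. This
  links \<open>code_dim\<close> with the cardinalities used elsewhere.\<close>

lemma (in vectorspace) card_carrier_eq_card_power_dim: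
  assumes K: "finite (carrier K)" and V: "finite (carrier V)"
  shows "card (carrier V) = card (carrier K) ^ dim"
proof -
  have "fin_dim"
    unfolding fin_dim_def using V span_is_subset2[of "carrier V"] in_own_span[of "carrier V"] by blast
  then obtain b where b: "finite b" "basis b" using finite_basis_exists by blast
  hence bV: "b \<subseteq> carrier V" by (simp add: basis_def)
  have crit: "\<And>v. v \<in> carrier V \<Longrightarrow> \<exists>!a. a \<in> b \<rightarrow>\<^sub>E carrier K \<and> lincomb a b = v"
    using basis_criterion[OF b(1) bV] b(2) by blast
  have "bij_betw (\<lambda>a. lincomb a b) (b \<rightarrow>\<^sub>E carrier K) (carrier V)"
    unfolding bij_betw_def
  proof
    have closed: "lincomb a b \<in> carrier V" if "a \<in> b \<rightarrow>\<^sub>E carrier K" for a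
      using that bV by (intro lincomb_closed) (auto simp: PiE_def)
    show "inj_on (\<lambda>a. lincomb a b) (b \<rightarrow>\<^sub>E carrier K)"
      using crit closed unfolding inj_on_def by blast
    show "(\<lambda>a. lincomb a b) ` (b \<rightarrow>\<^sub>E carrier K) = carrier V"
      using crit closed by blast
  qed
  hence "card (carrier V) = card (b \<rightarrow>\<^sub>E carrier K)" by (metis bij_betw_same_card)
  also have "\<dots> = card (carrier K) ^ card b" using b(1) by (simp add: card_PiE)
  finally show ?thesis using dim_basis[OF b] by simp
qed

lemma card_linear_code:
  fixes H :: "'a::{field,finite} vec set"
  assumes "linear_code n H" "finite H"
  shows "card H = CARD('a) ^ code_dim n H"
proof -
  interpret vec: vectorspace class_ring "module_vec TYPE('a) n" by (rule vec_vs)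
  have "vectorspace class_ring ((module_vec TYPE('a) n)\<lparr>carrier := H\<rparr>)"
    using vec.subspace_is_vs assms(1) unfolding linear_code_def by blast
  from vectorspace.card_carrier_eq_card_power_dim[OF this] show ?thesis
    using assms(2) by (simp add: code_dim_def)
qed

lemma finite_carrier_vec: "finite (carrier_vec n :: 'a::finite vec set)"
proof -
  have "carrier_vec n \<subseteq> (\<lambda>xs. vec n (\<lambda>i. xs ! i)) ` {xs :: 'a list. set xs \<subseteq> UNIV \<and> length xs = n}"
  proof
    fix x :: "'a vec" assume "x \<in> carrier_vec n"
    hence 1: "x = vec n (\<lambda>i. list_of_vec x ! i)" and 2: "length (list_of_vec x) = n" by auto
    show "x \<in> (\<lambda>xs. vec n (\<lambda>i. xs ! i)) ` {xs :: 'a list. set xs \<subseteq> UNIV \<and> length xs = n}"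
    proof (rule image_eqI)
      show "x = vec n (\<lambda>i. list_of_vec x ! i)" by (rule 1)
    qed (use 2 in simp)
  qed
  thus ?thesis by (rule finite_subset) (intro finite_imageI finite_lists_length_eq finite)
qed

text \<open>Allows the dimension of the hull to be converted into its number of words.\<close>

lemma (in square_order_field) linear_code_hermitian_hull:
  fixes C :: "'a vec set"
  assumes "linear_code n C"
  shows "linear_code n (hermitian_hull q n C)"
proof -
  have C: "submodule class_ring C (module_vec TYPE('a) n)" and vs: "vectorspace class_ring (module_vec TYPE('a) n)"
    using assms by (auto simp: linear_code_def VectorSpace.subspace_def)
  have Csub: "C \<subseteq> carrier_vec n" and Cadd: "\<And>x y. x \<in> C \<Longrightarrow> y \<in> C \<Longrightarrow> x + y \<in> C"
    and C0: "0\<^sub>v n \<in> C" and Csm: "\<And>a x. x \<in> C \<Longrightarrow> a \<cdot>\<^sub>v x \<in> C"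
    using submodule.subset[OF C] submodule.m_closed[OF C] submodule.zero_closed[OF C] submodule.smult_closed[OF C]
    by (simp_all add: module_vec_simps)
  have "submodule class_ring (hermitian_hull q n C) (module_vec TYPE('a) n)"
  proof (rule submodule.intro)
    show "Module.module class_ring (module_vec TYPE('a) n)" by (rule vec_module)
    show "hermitian_hull q n C \<subseteq> carrier (module_vec TYPE('a) n)"
      using Csub by (auto simp: hermitian_hull_def module_vec_simps)
    show "\<zero>\<^bsub>module_vec TYPE('a) n\<^esub> \<in> hermitian_hull q n C"
      using C0 by (simp add: hermitian_hull_def hermitian_dual_def module_vec_simps frob_zero)
    fix x y assume xy: "x \<in> hermitian_hull q n C" "y \<in> hermitian_hull q n C"
    hence "x \<in> carrier_vec n" "y \<in> carrier_vec n" using Csub by (auto simp: hermitian_hull_def)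
    thus "x \<oplus>\<^bsub>module_vec TYPE('a) n\<^esub> y \<in> hermitian_hull q n C"
      using xy Cadd by (auto simp: hermitian_hull_def hermitian_dual_def module_vec_simps frob_add
          ring_distribs sum.distrib)
  next
    fix c x assume x: "x \<in> hermitian_hull q n C"
    hence xn: "x \<in> carrier_vec n" using Csub by (auto simp: hermitian_hull_def)
    have "(\<Sum>i<n. y $ i * (c \<cdot>\<^sub>v x) $ i ^ q) = c ^ q * (\<Sum>i<n. y $ i * x $ i ^ q)" for y
      using xn by (simp add: power_mult_distrib sum_distrib_left mult_ac)
    thus "c \<odot>\<^bsub>module_vec TYPE('a) n\<^esub> x \<in> hermitian_hull q n C"
      using x xn Csm by (simp add: hermitian_hull_def hermitian_dual_def module_vec_simps)
  qed
  thus ?thesis using vs by (simp add: linear_code_def VectorSpace.subspace_def)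
qed

section \<open>Polynomials evaluated on the projective line\<close>

definition polys_below :: "nat \<Rightarrow> 'a::comm_ring_1 poly set" where
  "polys_below k = {f. \<forall>i\<ge>k. coeff f i = 0}"

lemma polys_below_iff: "f \<in> polys_below k \<longleftrightarrow> f = 0 \<or> degree f < k"
  unfolding polys_below_def using leading_coeff_0_iff[of f] coeff_eq_0[of f]
  by (auto simp: not_less)

lemma card_polys_below: "card (polys_below k :: 'a::{comm_ring_1,finite} poly set) = CARD('a) ^ k"
  and finite_polys_below: "finite (polys_below k :: 'a poly set)"
proof -
  have "bij_betw (\<lambda>f. \<lambda>i\<in>{..<k}. coeff f i) (polys_below k :: 'a poly set) ({..<k} \<rightarrow>\<^sub>E UNIV)"
  proof (rule bij_betwI[where g = "\<lambda>g. Poly (map g [0..<k])"])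
    show "(\<lambda>f. \<lambda>i\<in>{..<k}. coeff f i) \<in> polys_below k \<rightarrow> {..<k} \<rightarrow>\<^sub>E (UNIV :: 'a set)" by auto
    show "(\<lambda>g. Poly (map g [0..<k])) \<in> ({..<k} \<rightarrow>\<^sub>E (UNIV :: 'a set)) \<rightarrow> polys_below k"
      by (auto simp: polys_below_def nth_default_def)
    show "Poly (map (\<lambda>i\<in>{..<k}. coeff f i) [0..<k]) = f" if "f \<in> polys_below k" for f :: "'a poly"
      using that by (intro poly_eqI) (auto simp: nth_default_def polys_below_def)
    show "(\<lambda>i\<in>{..<k}. coeff (Poly (map g [0..<k])) i) = g" if "g \<in> {..<k} \<rightarrow>\<^sub>E UNIV" for g :: "nat \<Rightarrow> 'a"
      using that by (intro ext) (auto simp: nth_default_def PiE_def extensional_def)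
  qed
  moreover have "finite ({..<k} \<rightarrow>\<^sub>E (UNIV :: 'a set))" by (intro finite_PiE) auto
  moreover have "card ({..<k} \<rightarrow>\<^sub>E (UNIV :: 'a set)) = CARD('a) ^ k" by (simp add: card_PiE)
  ultimately show "card (polys_below k :: 'a poly set) = CARD('a) ^ k" "finite (polys_below k :: 'a poly set)"
    by (metis bij_betw_same_card, metis bij_betw_finite)
qed

text \<open>Evaluation on the projective line: \<open>None\<close> is the point at infinity.\<close>
definition proj_eval :: "nat \<Rightarrow> 'a::field option \<Rightarrow> 'a poly \<Rightarrow> 'a" where
  "proj_eval k p f = (case p of Some x \<Rightarrow> poly f x | None \<Rightarrow> coeff f (k - 1))"

text \<open>A nonzero \<open>f\<close> has at most \<open>degree f < k\<close> finite zeros. If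
  infinity is among the \<open>k\<close> points, the coefficient at \<open>k - 1\<close> vanishes
  too, which pushes the degree below the number \<open>k - 1\<close> of the remaining
  points.\<close>

lemma proj_eval_kernel:
  fixes f :: "'a::field poly"
  assumes f: "f \<in> polys_below k" and P: "finite P" "card P = k" and zero: "\<And>p. p \<in> P \<Longrightarrow> proj_eval k p f = 0"
  shows "f = 0"
proof (rule ccontr)
  assume nz: "f \<noteq> 0"
  define X where "X = Some -` P"
  have PX: "P - {None} = Some ` X" by (auto simp: X_def)
  have "finite X" unfolding X_def using P(1) by (rule finite_vimageI) simp
  have cX: "card X = card (P - {None})" unfolding PX by (simp add: card_image)
  have "X \<subseteq> {x. poly f x = 0}" using zero by (force simp: X_def proj_eval_def)
  hence "card X \<le> card {x. poly f x = 0}" using nz by (intro card_mono poly_roots_finite)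
  also have "\<dots> \<le> degree f" by (rule card_poly_roots_bound[OF nz])
  finally have le: "card X \<le> degree f" .
  have deg: "degree f < k" using f nz by (simp add: polys_below_iff)
  show False
  proof (cases "None \<in> P")
    case False
    hence "card X = k" using cX P by simp
    thus False using le deg by simp
  next
    case True
    hence "card X = k - 1" using cX P by simp
    hence "degree f = k - 1" using le deg by simp
    moreover have "coeff f (k - 1) = 0" using zero[OF True] by (simp add: proj_eval_def)
    ultimately show False using nz by (metis leading_coeff_0_iff)
  qed
qed

text \<open>With \<open>T\<close> enlarged to exactly \<open>k\<close> points, evaluation is an
  injective map between finite sets of equal size. This is the MDS property of the extended
  code.\<close>

lemma proj_eval_surj:
  fixes p :: "nat \<Rightarrow> 'a::{field,finite} option"
  assumes p: "inj_on p {..<n}" and T: "T \<subseteq> {..<n}" "card T \<le> k" and k: "k \<le> n"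
  shows "\<exists>f\<in>polys_below k. \<forall>j\<in>T. proj_eval k (p j) f = t j"
proof -
  obtain T' where T': "T \<subseteq> T'" "T' \<subseteq> {..<n}" "card T' = k"
    using exists_subset_between[of T k "{..<n}"] T k by auto
  have fin: "finite T'" using T'(2) finite_subset by blast
  have inj_p: "inj_on p T'" using p T'(2) inj_on_subset by blast
  define \<Phi> where "\<Phi> f = (\<lambda>j\<in>T'. proj_eval k (p j) f)" for f
  have "inj_on \<Phi> (polys_below k)"
  proof (rule inj_onI)
    fix f g assume fg: "f \<in> polys_below k" "g \<in> polys_below k" "\<Phi> f = \<Phi> g"
    have "f - g = 0"
    proof (rule proj_eval_kernel[of _ k "p ` T'"])
      show "f - g \<in> polys_below k" using fg by (simp add: polys_below_def)
      show "finite (p ` T')" "card (p ` T') = k" using fin T' inj_p by (simp_all add: card_image)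
      fix x assume "x \<in> p ` T'"
      then obtain j where j: "j \<in> T'" "x = p j" by blast
      have "proj_eval k (p j) f = proj_eval k (p j) g"
        using fun_cong[OF fg(3), of j] j by (simp add: \<Phi>_def)
      thus "proj_eval k x (f - g) = 0" by (simp add: j proj_eval_def split: option.splits)
    qed
    thus "f = g" by simp
  qed
  hence "card (\<Phi> ` polys_below k) = CARD('a) ^ k" by (simp add: card_image card_polys_below)
  moreover have "\<Phi> ` polys_below k \<subseteq> (T' \<rightarrow>\<^sub>E UNIV)" by (auto simp: \<Phi>_def)
  moreover have "finite (T' \<rightarrow>\<^sub>E (UNIV :: 'a set))" "card (T' \<rightarrow>\<^sub>E (UNIV :: 'a set)) = CARD('a) ^ k"
    using fin T' by (simp_all add: card_PiE finite_PiE)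
  ultimately have "\<Phi> ` polys_below k = (T' \<rightarrow>\<^sub>E UNIV)" by (intro card_subset_eq) auto
  moreover have "(\<lambda>j\<in>T'. t j) \<in> T' \<rightarrow>\<^sub>E UNIV" by auto
  ultimately obtain f where f: "f \<in> polys_below k" "\<Phi> f = (\<lambda>j\<in>T'. t j)" by (metis imageE)
  have "proj_eval k (p j) f = t j" if "j \<in> T" for j
    using fun_cong[OF f(2), of j] that T' by (auto simp: \<Phi>_def)
  thus ?thesis using f by blast
qed

text \<open>The projective line has \<open>CARD('a) + 1\<close> points and \<open>n\<close> are
  taken; this is the origin of the bound on \<open>i\<close>, and attaining it uses
  infinity.\<close>

lemma extend_to_projective_points:
  fixes a :: "nat \<Rightarrow> 'a::finite"
  assumes "inj_on a {..<n}" "i \<le> CARD('a) + 1 - n"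
  obtains p :: "nat \<Rightarrow> 'a option" where "inj_on p {..<n + i}" "\<And>j. j < n \<Longrightarrow> p j = Some (a j)"
proof -
  let ?A = "Some ` a ` {..<n}"
  have "card ?A = n" using assms(1) by (simp add: card_image)
  hence "card (UNIV - ?A) = CARD('a) + 1 - n" by (simp add: card_Diff_subset card_UNIV_option)
  then obtain D where D: "D \<subseteq> UNIV - ?A" "card D = i" using assms(2) obtain_subset_with_card_n by metis
  obtain b where b: "bij_betw b {n..<n + i} D"
    using finite_same_card_bij[of "{n..<n + i}" D] D by auto
  define p where "p j = (if j < n then Some (a j) else b j)" for j
  have "inj_on p {..<n + i}"
  proof (rule inj_onI)
    have bD: "b j \<noteq> Some (a j')" if "\<not> j < n" "j < n + i" "j' < n" for j j'
    proof -
      have "b j \<in> D" using bij_betwE[OF b] that by auto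
      thus ?thesis using D(1) that(3) by (metis DiffD2 imageI lessThan_iff subsetD)
    qed
    fix j j' assume j: "j \<in> {..<n + i}" "j' \<in> {..<n + i}" "p j = p j'"
    show "j = j'"
      using j assms(1) bD[of j j'] bD[of j' j] bij_betw_imp_inj_on[OF b]
      by (auto simp: p_def inj_on_def split: if_splits)
  qed
  thus ?thesis using that[of p] by (simp add: p_def)
qed

theorem theorem6:
  fixes q n k l i s :: nat
    and C :: "'a::{field,finite} vec set"
  assumes "primepow q" and "q > 2"
    and "CARD('a) = q ^ 2"
    and "2 * k \<le> n" and "l \<le> k"
    and "is_GRS_code n k C"
    and "code_dim n (hermitian_hull q n C) = l"
    and "hermitian_construction q n C (n - k - l) (k + 1) (k - l)"
    and "MDS_EAQECC q n (n - k - l) (k + 1) (k - l)"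
    and "i \<le> min l (q ^ 2 + 1 - n)" and "s \<le> l - i"
  shows "MDS_EAQECC q (n + i) (n + i - k - s) (k + 1) (k - s)"
proof -
  interpret square_order_field q "TYPE('a)" by unfold_locales (use assms in auto)
  define V where "V = (polys_below k :: 'a poly set)"
  interpret hermitian_space q "TYPE('a)" V Polynomial.smult
  proof unfold_locales
    show "finite V" by (simp add: V_def finite_polys_below)
  qed (auto simp: V_def add_subgroup_def polys_below_def)
  obtain a v where a: "inj_on a {..<n}" and v: "\<And>j. j < n \<Longrightarrow> v j \<noteq> 0"
    and C: "C = {vec n (\<lambda>j. v j * poly f (a j)) | f. f \<in> V}"
    using assms(6) unfolding is_GRS_code_def V_def polys_below_iff by blast
  obtain p where p: "inj_on p {..<n + i}" and pa: "\<And>j. j < n \<Longrightarrow> p j = Some (a j)"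
    using extend_to_projective_points[OF a, of i] assms(3,10) by auto
  define e where "e j = proj_eval k (p j)" for j
  have e: "lin (e j)" for j
    by (auto simp: lin_def e_def proj_eval_def split: option.splits)
  have surj: "jointly_surj T e" if "T \<subseteq> {..<n + i}" "card T \<le> k" for T
    unfolding jointly_surj_def e_def using proj_eval_surj[OF p that, folded V_def] assms(4) by simp
  \<comment> \<open>The Hermitian product contributes \<open>v j * v j ^ q\<close> at each old
    point; the new points start with weight 1.\<close>
  define w where "w j = (if j < n then v j ^ (q + 1) else 1)" for j
  have w: "admissible m w" for m
    using v base_norm base_1 by (auto simp: admissible_def w_def)
  have card_V: "card V = CARD('a) ^ k" by (simp add: V_def card_polys_below)
  \<comment> \<open>Every word of the hull is the image of a polynomial in the radical, so counting
    words bounds the radical from below.\<close>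
  have "CARD('a) ^ l \<le> card (radical (diag_form n w e))"
  proof -
    let ?H = "hermitian_hull q n C"
    have "linear_code n ?H"
      using linear_code_hermitian_hull assms(8) by (simp add: hermitian_construction_def)
    moreover have "?H \<subseteq> carrier_vec n" by (auto simp: hermitian_hull_def hermitian_dual_def)
    hence "finite ?H" using finite_carrier_vec by (rule finite_subset)
    ultimately have "CARD('a) ^ l = card ?H" using card_linear_code[of n ?H] assms(7) by simp
    also have "\<dots> \<le> card ((\<lambda>f. vec n (\<lambda>j. v j * poly f (a j))) ` radical (diag_form n w e))"
    proof (rule card_mono)
      show "?H \<subseteq> (\<lambda>f. vec n (\<lambda>j. v j * poly f (a j))) ` radical (diag_form n w e)"
      proof
        fix x assume x: "x \<in> ?H"
        then obtain f where f: "f \<in> V" "x = vec n (\<lambda>j. v j * poly f (a j))"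
          by (auto simp: hermitian_hull_def C)
        have "diag_form n w e f g = 0" if g: "g \<in> V" for g
        proof -
          let ?y = "vec n (\<lambda>j. v j * poly g (a j))"
          have "?y \<in> C" using g C by blast
          hence "(\<Sum>j<n. ?y $ j * x $ j ^ q) = 0"
            using x unfolding hermitian_hull_def hermitian_dual_def by blast
          also have "(\<Sum>j<n. ?y $ j * x $ j ^ q) = diag_form n w e g f"
            unfolding diag_form_def f(2)
            by (intro sum.cong refl) (simp add: w_def e_def pa proj_eval_def power_mult_distrib mult_ac)
          finally have "diag_form n w e g f = 0" .
          \<comment> \<open>The dual has the word of the hull in the second argument, the radical in
            the first.\<close>
          thus ?thesis using hermitian_swap[OF hermitian_diag_form[OF e w] g f(1)] by (simp add: frob_zero)
        qed
        thus "x \<in> (\<lambda>f. vec n (\<lambda>j. v j * poly f (a j))) ` radical (diag_form n w e)"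
          using f by (auto simp: radical_def)
      qed
    qed (simp add: finite_radical)
    also have "\<dots> \<le> card (radical (diag_form n w e))" by (rule card_image_le[OF finite_radical])
    finally show ?thesis .
  qed
  \<comment> \<open>Each new point costs the radical at most one factor
    \<open>CARD('a)\<close>.\<close>
  moreover have "card (radical (diag_form n w e)) \<le> CARD('a) ^ m * card (radical (diag_form (n + m) w e))" for m
  proof (induction m)
    case (Suc m)
    have "card (radical (diag_form (n + m) w e)) \<le> CARD('a) * card (radical (diag_form (n + Suc m) w e))"
      by (rule card_radical_rank_one[OF hermitian_diag_form[OF e w] e]) (simp add: diag_form_def)
    hence "CARD('a) ^ m * card (radical (diag_form (n + m) w e))
        \<le> CARD('a) ^ m * (CARD('a) * card (radical (diag_form (n + Suc m) w e)))" by (rule mult_le_mono2)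
    with Suc.IH have "card (radical (diag_form n w e))
        \<le> CARD('a) ^ m * (CARD('a) * card (radical (diag_form (n + Suc m) w e)))" by (rule le_trans)
    thus ?case by (simp add: mult_ac)
  qed simp
  ultimately have "CARD('a) ^ l \<le> CARD('a) ^ i * card (radical (diag_form (n + i) w e))"
    using le_trans by blast
  moreover have "CARD('a) ^ l = CARD('a) ^ i * CARD('a) ^ (l - i)"
    using assms(10) by (simp flip: power_add)
  ultimately have "CARD('a) ^ (l - i) \<le> card (radical (diag_form (n + i) w e))"
    using card_field_gt_1 by simp
  moreover have "CARD('a) ^ s \<le> CARD('a) ^ (l - i)"
    using assms(11) card_field_gt_1 by (intro power_increasing) auto
  ultimately have rad: "CARD('a) ^ s \<le> card (radical (diag_form (n + i) w e))" by (rule order.trans[rotated])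
  have "k \<le> n + i" "jointly_surj {..<k} e" using assms(4) surj[of "{..<k}"] by auto
  \<comment> \<open>All \<open>n + i\<close> weights may change here, including those that came from
    the multipliers \<open>v\<close>.\<close>
  then obtain w' where w': "admissible (n + i) w'" "card (radical (diag_form (n + i) w' e)) = CARD('a) ^ s"
    using weights_with_radical[OF assms(2) _ card_V e _ w rad] by blast
  have "EAQECC q (n + i) (n + i - k - s) (k + 1) (k - s)"
    by (rule EAQECC_if_radical[OF _ card_V e surj w']) (use assms in auto)
  \<comment> \<open>No subtraction truncates, since \<open>s \<le> l \<le> k\<close> and
    \<open>2 * k \<le> n\<close>.\<close>
  moreover have "MDS_parameters (n + i) (n + i - k - s) (k + 1) (k - s)"
    using assms by (auto simp: MDS_parameters_def of_nat_diff)
  ultimately show ?thesis by (simp add: MDS_EAQECC_def)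
qed

end
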